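(* Let $A\in\mathbb{R}^{n\times n}$ be a nonnegative matrix with $m$ nonzero entries and $\rho(A)<1$, and let $M=I-A$. Let $\epsilon>0$, and let $K\geq\max(\|M^{-1}\|_\infty,\|M^{-1}\|_1)$ be a known parameter. Then there is an algorithm (the paper's $\mathrm{MMatrix\text{-}Scale}(A,\epsilon,K)$) which, using the RCDD solver oracle, computes a pair of diagonal matrices $(L,R)$ such that $L((1+\epsilon)I-A)R$ is RCDD with high probability, and which runs in time \[ O\Big(\mathcal{T}_{solve}\Big(m,n,18K^2,\frac{1}{216K^3}\Big)\log(nK)\log\Big(\frac{\|A\|_1+\|A\|_\infty}{\epsilon}\Big)\Big). \]
   Context: A matrix $S$ is RCDD if $S_{ii}\geq\sum_{j\neq i}|S_{ij}|$ and $S_{ii}\geq\sum_{j\neq i}|S_{ji}|$ for all $i$. RCDD solver oracle: given an RCDD matrix $S\in\mathbb{R}^{n\times n}$ with $m$ nonzeros and $\epsilon>0$, it produces a (random) operator $Z:\mathbb{R}^n\to\mathbb{R}^n$ such that $\mathbb{E}\|\vec x-SZ(\vec x)\|_2\leq\epsilon\|\vec x\|_2$ for every $\vec x$, and $Z$ can be computed and applied to vectors in time $\mathcal{T}_{solve}(m,n,\kappa(S),\epsilon)$, where $\kappa(S)=\|S\|_2\|S^{-1}\|_2$. $\rho(A)$ is the spectral radius; $\|\cdot\|_1,\|\cdot\|_\infty$ are induced matrix norms.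
   Formalization: Logarithms are read as max(1, ln); T_solve is assumed nondecreasing in m and κ, at least m+n, and to grow by at most a constant factor when m becomes m+n; the random operator is assumed jointly measurable; "with high probability" means at least 1−n^(−c) for any fixed c>0. *)

theory Defs
  imports "HOL-Probability.Probability" "Jordan_Normal_Form.Spectral_Radius"
begin

section \<open>Matrices and norms\<close>

definition l1_norm :: "real Matrix.vec \<Rightarrow> real" where
  "l1_norm x = (\<Sum>i<dim_vec x. \<bar>vec_index x i\<bar>)"

definition l2_norm :: "real Matrix.vec \<Rightarrow> real" where
  "l2_norm x = sqrt (\<Sum>i<dim_vec x. (vec_index x i)\<^sup>2)"

text \<open>The 0 only matters for the vector of dimension 0.\<close>

definition linf_norm :: "real Matrix.vec \<Rightarrow> real" where
  "linf_norm x = Max (insert 0 {\<bar>vec_index x i\<bar> | i. i < dim_vec x})"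

definition induced_norm :: "(real Matrix.vec \<Rightarrow> real) \<Rightarrow> real Matrix.mat \<Rightarrow> real" where
  "induced_norm N A =
     (SUP x \<in> {x \<in> carrier_vec (dim_col A). N x \<le> 1}. N (A *\<^sub>v x))"

definition inverse_mat :: "real Matrix.mat \<Rightarrow> real Matrix.mat" where
  "inverse_mat A = (THE B. B \<in> carrier_mat (dim_row A) (dim_row A) \<and>
                            inverts_mat A B \<and> inverts_mat B A)"

definition cond_number :: "real Matrix.mat \<Rightarrow> real" where
  "cond_number S = induced_norm l2_norm S * induced_norm l2_norm (inverse_mat S)"

definition nnz :: "real Matrix.mat \<Rightarrow> nat" where
  "nnz A = card {(i, j). i < dim_row A \<and> j < dim_col A \<and> A $$ (i, j) \<noteq> 0}"

definition rcdd :: "real Matrix.mat \<Rightarrow> bool" where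
  "rcdd S \<longleftrightarrow> square_mat S \<and>
     (\<forall>i<dim_row S.
        S $$ (i, i) \<ge> (\<Sum>j\<in>{..<dim_row S} - {i}. \<bar>S $$ (i, j)\<bar>) \<and>
        S $$ (i, i) \<ge> (\<Sum>j\<in>{..<dim_row S} - {i}. \<bar>S $$ (j, i)\<bar>))"

text \<open>The arrays list each nonzero entry of the matrix exactly once, in any order;
  positions from \<open>p\<close> on are irrelevant.\<close>

definition sparse_rep ::
  "nat \<Rightarrow> nat \<Rightarrow> (nat \<Rightarrow> nat) \<Rightarrow> (nat \<Rightarrow> nat) \<Rightarrow> (nat \<Rightarrow> real) \<Rightarrow> real Matrix.mat \<Rightarrow> bool" where
  "sparse_rep n p ri ci v A \<longleftrightarrow> A \<in> carrier_mat n n \<and>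
     bij_betw (\<lambda>k. (ri k, ci k)) {..<p} {(i, j). i < n \<and> j < n \<and> A $$ (i, j) \<noteq> 0} \<and>
     (\<forall>k<p. v k = A $$ (ri k, ci k))"


section \<open>The RCDD solver oracle\<close>

text \<open>Condition numbers only make sense for invertible matrices, so these are the
  instances on which the oracle may be called.\<close>

definition admissible :: "nat \<Rightarrow> real Matrix.mat \<Rightarrow> bool" where
  "admissible n S \<longleftrightarrow> 0 < n \<and> S \<in> carrier_mat n n \<and> rcdd S \<and> invertible_mat S"

text \<open>\<open>slv \<omega> S \<delta>\<close> is the operator that the oracle builds for \<open>S\<close> and accuracy \<open>\<delta>\<close>
  from the random seed \<open>\<omega>\<close>, distributed according to \<open>M\<close>. It need not be linear.
  The last clause makes the probabilities of events about adaptive sequences of oracle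
  calls well defined. The expectation is a nonnegative Lebesgue integral, as a Bochner
  integral would be 0 for a nonintegrable error.\<close>

definition rcdd_solver ::
  "'w measure \<Rightarrow> ('w \<Rightarrow> real Matrix.mat \<Rightarrow> real \<Rightarrow> real Matrix.vec \<Rightarrow> real Matrix.vec) \<Rightarrow> bool" where
  "rcdd_solver M slv \<longleftrightarrow> prob_space M \<and>
     (\<forall>n S \<delta> x. admissible n S \<and> 0 < \<delta> \<and> x \<in> carrier_vec n \<longrightarrow>
        (\<forall>\<omega>\<in>space M. slv \<omega> S \<delta> x \<in> carrier_vec n) \<and>
        (\<integral>\<^sup>+ \<omega>. ennreal (l2_norm (x - S *\<^sub>v slv \<omega> S \<delta> x)) \<partial>M) \<le> ennreal (\<delta> * l2_norm x)) \<and>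
     (\<forall>n \<delta> i. 0 < \<delta> \<and> i < n \<longrightarrow>
        (\<lambda>(\<omega>, s, x). vec_index (slv \<omega> (Matrix.mat n n s) \<delta> (Matrix.vec n x)) i)
          \<in> borel_measurable
              (restrict_space
                (M \<Otimes>\<^sub>M (\<Pi>\<^sub>M ij\<in>{..<n} \<times> {..<n}. borel) \<Otimes>\<^sub>M (\<Pi>\<^sub>M k\<in>{..<n}. borel))
                {(\<omega>, s, x). admissible n (Matrix.mat n n s)}))"

text \<open>\<open>T m n \<kappa> \<delta>\<close> is the time for building the operator, and also for applying it
  once, for matrices with \<open>m\<close> nonzeros. It is monotone in \<open>m\<close> and \<open>\<kappa>\<close>, suffices for
  reading the input, and changes by at most a constant factor when \<open>n\<close> further entries
  (a diagonal) are added to the matrix.\<close>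

definition solver_time :: "real \<Rightarrow> (nat \<Rightarrow> nat \<Rightarrow> real \<Rightarrow> real \<Rightarrow> real) \<Rightarrow> bool" where
  "solver_time d T \<longleftrightarrow>
     (\<forall>m m' n \<kappa> \<kappa>' \<delta>. m \<le> m' \<and> 0 < n \<and> 1 \<le> \<kappa> \<and> \<kappa> \<le> \<kappa>' \<and> 0 < \<delta> \<and> \<delta> < 1 \<longrightarrow>
        T m n \<kappa> \<delta> \<le> T m' n \<kappa>' \<delta>) \<and>
     (\<forall>m n \<kappa> \<delta>. 0 < n \<and> 1 \<le> \<kappa> \<and> 0 < \<delta> \<and> \<delta> < 1 \<longrightarrow>
        real (m + n) \<le> T m n \<kappa> \<delta> \<and> T (m + n) n \<kappa> \<delta> \<le> d * T m n \<kappa> \<delta>)"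


section \<open>Algorithms: real RAM programs with access to the oracle\<close>

text \<open>A small imperative language over natural numbers, exact reals, and arrays of both
  (the usual unit-cost real RAM; there is no rounding of reals to integers and no
  multiplication of naturals). Variables and arrays are named by natural numbers.\<close>

datatype nexp =
    NLit nat | NVar nat | NGet nat nexp | NAdd nexp nexp | NSub nexp nexp

datatype rexp =
    RLit int | RVar nat | RGet nat nexp | RNat nexp
  | RAdd rexp rexp | RSub rexp rexp | RMul rexp rexp | RDiv rexp rexp

datatype bexp = NLess nexp nexp | RLess rexp rexp | BNot bexp | BAnd bexp bexp

text \<open>\<open>Build h n p ri ci v \<delta>\<close> calls the oracle on the \<open>n \<times> n\<close> matrix given by its \<open>p\<close>
  entries in the arrays \<open>ri\<close>, \<open>ci\<close>, \<open>v\<close> and keeps the resulting operator under the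
  name \<open>h\<close>; \<open>Apply h x y\<close> applies it to the array \<open>x\<close>, writing the result to \<open>y\<close>.\<close>

datatype com =
    Skip
  | NAssign nat nexp
  | RAssign nat rexp
  | NStore nat nexp nexp
  | RStore nat nexp rexp
  | Seq com com
  | If bexp com com
  | While bexp com
  | Build nat nexp nexp nat nat nat rexp
  | Apply nat nat nat

record state =
  nvar :: "nat \<Rightarrow> nat"
  rvar :: "nat \<Rightarrow> real"
  narr :: "nat \<Rightarrow> nat \<Rightarrow> nat"
  rarr :: "nat \<Rightarrow> nat \<Rightarrow> real"
  handle :: "nat \<Rightarrow> (nat \<times> real \<times> (real Matrix.vec \<Rightarrow> real Matrix.vec)) option"
    \<comment> \<open>dimension, cost of one application, operator\<close>
  calls :: nat
    \<comment> \<open>number of operators built so far, i.e. of seeds used\<close>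

fun nval :: "nexp \<Rightarrow> state \<Rightarrow> nat" where
  "nval (NLit c) s = c"
| "nval (NVar x) s = nvar s x"
| "nval (NGet a e) s = narr s a (nval e s)"
| "nval (NAdd e f) s = nval e s + nval f s"
| "nval (NSub e f) s = nval e s - nval f s"

fun rval :: "rexp \<Rightarrow> state \<Rightarrow> real" where
  "rval (RLit c) s = of_int c"
| "rval (RVar x) s = rvar s x"
| "rval (RGet a e) s = rarr s a (nval e s)"
| "rval (RNat e) s = real (nval e s)"
| "rval (RAdd e f) s = rval e s + rval f s"
| "rval (RSub e f) s = rval e s - rval f s"
| "rval (RMul e f) s = rval e s * rval f s"
| "rval (RDiv e f) s = rval e s / rval f s"

fun bval :: "bexp \<Rightarrow> state \<Rightarrow> bool" where
  "bval (NLess e f) s = (nval e s < nval f s)"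
| "bval (RLess e f) s = (rval e s < rval f s)"
| "bval (BNot b) s = (\<not> bval b s)"
| "bval (BAnd b c) s = (bval b s \<and> bval c s)"

fun ncost :: "nexp \<Rightarrow> nat" where
  "ncost (NLit c) = 1"
| "ncost (NVar x) = 1"
| "ncost (NGet a e) = 1 + ncost e"
| "ncost (NAdd e f) = 1 + ncost e + ncost f"
| "ncost (NSub e f) = 1 + ncost e + ncost f"

fun rcost :: "rexp \<Rightarrow> nat" where
  "rcost (RLit c) = 1"
| "rcost (RVar x) = 1"
| "rcost (RGet a e) = 1 + ncost e"
| "rcost (RNat e) = 1 + ncost e"
| "rcost (RAdd e f) = 1 + rcost e + rcost f"
| "rcost (RSub e f) = 1 + rcost e + rcost f"
| "rcost (RMul e f) = 1 + rcost e + rcost f"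
| "rcost (RDiv e f) = 1 + rcost e + rcost f"

fun bcost :: "bexp \<Rightarrow> nat" where
  "bcost (NLess e f) = 1 + ncost e + ncost f"
| "bcost (RLess e f) = 1 + rcost e + rcost f"
| "bcost (BNot b) = 1 + bcost b"
| "bcost (BAnd b c) = 1 + bcost b + bcost c"

text \<open>\<open>exec T slv \<omega> c s t s'\<close>: program \<open>c\<close>, started in \<open>s\<close>, terminates in \<open>s'\<close> after
  time \<open>t\<close>. Successive \<open>Build\<close> instructions use the seeds \<open>\<omega> 0\<close>, \<open>\<omega> 1\<close>, and so on. A
  \<open>Build\<close> on anything but a sparse representation of an admissible matrix has no
  execution.\<close>

inductive exec ::
  "(nat \<Rightarrow> nat \<Rightarrow> real \<Rightarrow> real \<Rightarrow> real)
   \<Rightarrow> ('w \<Rightarrow> real Matrix.mat \<Rightarrow> real \<Rightarrow> real Matrix.vec \<Rightarrow> real Matrix.vec)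
   \<Rightarrow> (nat \<Rightarrow> 'w) \<Rightarrow> com \<Rightarrow> state \<Rightarrow> real \<Rightarrow> state \<Rightarrow> bool"
  for T slv \<omega>
where
  Skip: "exec T slv \<omega> Skip s 1 s"
| NAssign: "exec T slv \<omega> (NAssign x e) s (real (1 + ncost e))
     (s\<lparr>nvar := (nvar s)(x := nval e s)\<rparr>)"
| RAssign: "exec T slv \<omega> (RAssign x e) s (real (1 + rcost e))
     (s\<lparr>rvar := (rvar s)(x := rval e s)\<rparr>)"
| NStore: "exec T slv \<omega> (NStore a i e) s (real (1 + ncost i + ncost e))
     (s\<lparr>narr := (narr s)(a := (narr s a)(nval i s := nval e s))\<rparr>)"
| RStore: "exec T slv \<omega> (RStore a i e) s (real (1 + ncost i + rcost e))
     (s\<lparr>rarr := (rarr s)(a := (rarr s a)(nval i s := rval e s))\<rparr>)"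
| Seq: "exec T slv \<omega> c1 s t1 s1 \<Longrightarrow> exec T slv \<omega> c2 s1 t2 s2 \<Longrightarrow>
     exec T slv \<omega> (Seq c1 c2) s (t1 + t2) s2"
| IfTrue: "bval b s \<Longrightarrow> exec T slv \<omega> c1 s t s' \<Longrightarrow>
     exec T slv \<omega> (If b c1 c2) s (real (1 + bcost b) + t) s'"
| IfFalse: "\<not> bval b s \<Longrightarrow> exec T slv \<omega> c2 s t s' \<Longrightarrow>
     exec T slv \<omega> (If b c1 c2) s (real (1 + bcost b) + t) s'"
| WhileFalse: "\<not> bval b s \<Longrightarrow> exec T slv \<omega> (While b c) s (real (1 + bcost b)) s"
| WhileTrue: "bval b s \<Longrightarrow> exec T slv \<omega> c s t1 s1 \<Longrightarrow> exec T slv \<omega> (While b c) s1 t2 s2 \<Longrightarrow>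
     exec T slv \<omega> (While b c) s (real (1 + bcost b) + t1 + t2) s2"
| Build: "n = nval ne s \<Longrightarrow> p = nval pe s \<Longrightarrow> \<delta> = rval de s \<Longrightarrow> 0 < \<delta> \<Longrightarrow>
     sparse_rep n p (narr s ri) (narr s ci) (rarr s v) S \<Longrightarrow> admissible n S \<Longrightarrow>
     t = T (nnz S) n (cond_number S) \<delta> \<Longrightarrow>
     exec T slv \<omega> (Build h ne pe ri ci v de) s (real (1 + ncost ne + ncost pe + rcost de) + t)
       (s\<lparr>handle := (handle s)(h := Some (n, t, slv (\<omega> (calls s)) S \<delta>)),
          calls := Suc (calls s)\<rparr>)"
| Apply: "handle s h = Some (n, t, Z) \<Longrightarrow> z = Z (Matrix.vec n (rarr s x)) \<Longrightarrow>
     exec T slv \<omega> (Apply h x y) s (1 + t)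
       (s\<lparr>rarr := (rarr s)(y := (\<lambda>i. if i < n then vec_index z i else rarr s y i))\<rparr>)"

lemma sparse_rep_unique:
  assumes A: "sparse_rep n p ri ci v A" and B: "sparse_rep n p ri ci v B"
  shows "A = B"
proof -
  have dims: "dim_row A = n" "dim_col A = n" "dim_row B = n" "dim_col B = n"
    using A B by (auto simp: sparse_rep_def)
  have sup: "{(i, j). i < n \<and> j < n \<and> A $$ (i, j) \<noteq> 0} = {(i, j). i < n \<and> j < n \<and> B $$ (i, j) \<noteq> 0}"
    using A B unfolding sparse_rep_def bij_betw_def by metis
  have "A $$ (i, j) = B $$ (i, j)" if ij: "i < n" "j < n" for i j
  proof (cases "A $$ (i, j) = 0")
    case True
    then have "(i, j) \<notin> {(i, j). i < n \<and> j < n \<and> B $$ (i, j) \<noteq> 0}"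
      unfolding sup[symmetric] by simp
    then show ?thesis using ij True by simp
  next
    case False
    then have "(i, j) \<in> (\<lambda>k. (ri k, ci k)) ` {..<p}"
      using A ij unfolding sparse_rep_def bij_betw_def by simp
    then obtain k where k: "k < p" "ri k = i" "ci k = j" by auto
    have "v k = A $$ (ri k, ci k)" "v k = B $$ (ri k, ci k)"
      using A B k(1) by (auto simp: sparse_rep_def)
    then show ?thesis using k by simp
  qed
  then show ?thesis by (intro eq_matI) (simp_all add: dims)
qed

inductive_cases exec_SkipE: "exec T slv \<omega> Skip s t s'"
inductive_cases exec_NAssignE: "exec T slv \<omega> (NAssign x e) s t s'"
inductive_cases exec_RAssignE: "exec T slv \<omega> (RAssign x e) s t s'"
inductive_cases exec_NStoreE: "exec T slv \<omega> (NStore a i e) s t s'"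
inductive_cases exec_RStoreE: "exec T slv \<omega> (RStore a i e) s t s'"
inductive_cases exec_SeqE: "exec T slv \<omega> (Seq c1 c2) s t s'"
inductive_cases exec_IfE: "exec T slv \<omega> (If b c1 c2) s t s'"
inductive_cases exec_WhileE: "exec T slv \<omega> (While b c) s t s'"
inductive_cases exec_BuildE: "exec T slv \<omega> (Build h ne pe ri ci v de) s t s'"
inductive_cases exec_ApplyE: "exec T slv \<omega> (Apply h x y) s t s'"

lemma exec_deterministic:
  "exec T slv \<omega> c s t s' \<Longrightarrow> exec T slv \<omega> c s u s'' \<Longrightarrow> u = t \<and> s'' = s'"
proof (induction arbitrary: u s'' rule: exec.induct)
  case (Seq c1 s t1 s1 c2 t2 s2)
  from Seq.prems show ?case
  proof (rule exec_SeqE)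
    fix u1 r1 u2
    assume u: "u = u1 + u2"
      and 1: "exec T slv \<omega> c1 s u1 r1" and 2: "exec T slv \<omega> c2 r1 u2 s''"
    have "u1 = t1" "r1 = s1" using Seq.IH(1)[OF 1] by auto
    then show ?thesis using Seq.IH(2)[of u2 s''] 2 u by simp
  qed
next
  case (IfTrue b s c1 t s' c2)
  from IfTrue.prems show ?case
  proof (rule exec_IfE)
    fix u1
    assume u: "u = 1 + real (bcost b) + u1" and 1: "exec T slv \<omega> c1 s u1 s''"
    show ?thesis using IfTrue.IH[OF 1] u by simp
  qed (use IfTrue.hyps in simp)
next
  case (IfFalse b s c2 t s' c1)
  from IfFalse.prems show ?case
  proof (rule exec_IfE)
    fix u1
    assume u: "u = 1 + real (bcost b) + u1" and 1: "exec T slv \<omega> c2 s u1 s''"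
    show ?thesis using IfFalse.IH[OF 1] u by simp
  qed (use IfFalse.hyps in simp)
next
  case (WhileFalse b s c)
  from WhileFalse.prems show ?case
    by (rule exec_WhileE) (use WhileFalse.hyps in simp_all)
next
  case (WhileTrue b s c t1 s1 t2 s2)
  from WhileTrue.prems show ?case
  proof (rule exec_WhileE)
    fix u1 r1 u2
    assume u: "u = 1 + real (bcost b) + u1 + u2"
      and 1: "exec T slv \<omega> c s u1 r1" and 2: "exec T slv \<omega> (While b c) r1 u2 s''"
    have "u1 = t1" "r1 = s1" using WhileTrue.IH(1)[OF 1] by auto
    then show ?thesis using WhileTrue.IH(2)[of u2 s''] 2 u by simp
  qed (use WhileTrue.hyps in simp)
next
  case (Build n ne s p pe \<delta> de ri ci v S t h)
  from Build.prems show ?case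
  proof (rule exec_BuildE)
    fix S'
    assume u: "u = 1 + (real (ncost ne) + real (ncost pe) + real (rcost de)) +
          T (nnz S') (nval ne s) (cond_number S') (rval de s)"
      and s'': "s'' = s\<lparr>handle := (handle s)(h \<mapsto>
            (nval ne s, T (nnz S') (nval ne s) (cond_number S') (rval de s),
             slv (\<omega> (calls s)) S' (rval de s))),
          calls := Suc (calls s)\<rparr>"
      and S': "sparse_rep (nval ne s) (nval pe s) (narr s ri) (narr s ci) (rarr s v) S'"
    have "S' = S"
      by (rule sparse_rep_unique[OF S'])
        (use Build.hyps(5) in \<open>simp only: Build.hyps(1)[symmetric] Build.hyps(2)[symmetric]\<close>)
    then show ?thesis using u s'' Build.hyps(1,3,7) by simp
  qed
next
  case (Apply s h n t Z z x y)
  from Apply.prems show ?case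
  proof (rule exec_ApplyE)
    fix n' t' Z'
    assume u: "u = 1 + t'"
      and s'': "s'' = s\<lparr>rarr := (rarr s)(y := (\<lambda>i. if i < n' then vec_index (Z' (Matrix.vec n' (rarr s x))) i
                                             else rarr s y i))\<rparr>"
      and h: "handle s h = Some (n', t', Z')"
    have e: "n' = n" "t' = t" "Z' = Z" using h Apply.hyps(1) by auto
    show ?thesis unfolding u s'' e Apply.hyps(2)[symmetric] by blast
  qed
qed (erule exec_SkipE exec_NAssignE exec_RAssignE exec_NStoreE exec_RStoreE; simp)+

definition init_state ::
  "nat \<Rightarrow> nat \<Rightarrow> (nat \<Rightarrow> nat) \<Rightarrow> (nat \<Rightarrow> nat) \<Rightarrow> (nat \<Rightarrow> real) \<Rightarrow> real \<Rightarrow> real \<Rightarrow> state" where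
  "init_state n m ri ci v \<epsilon> K =
     \<lparr>nvar = (\<lambda>_. 0)(0 := n, 1 := m),
      rvar = (\<lambda>_. 0)(0 := \<epsilon>, 1 := K),
      narr = (\<lambda>_ _. 0)(0 := ri, 1 := ci),
      rarr = (\<lambda>_ _. 0)(0 := v),
      handle = (\<lambda>_. None),
      calls = 0\<rparr>"

definition output_L :: "nat \<Rightarrow> state \<Rightarrow> real Matrix.mat" where
  "output_L n s = mat_diag n (rarr s 1)"

definition output_R :: "nat \<Rightarrow> state \<Rightarrow> real Matrix.mat" where
  "output_R n s = mat_diag n (rarr s 2)"

text \<open>Scalings have positive diagonal: \<open>L = R = 0\<close> would make any matrix RCDD.\<close>

definition scales_to_rcdd :: "real Matrix.mat \<Rightarrow> real Matrix.mat \<Rightarrow> real Matrix.mat \<Rightarrow> bool" where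
  "scales_to_rcdd L R B \<longleftrightarrow>
     (\<forall>i<dim_row B. 0 < L $$ (i, i) \<and> 0 < R $$ (i, i)) \<and> rcdd (L * B * R)"

text \<open>Logarithms in running times are at least 1, so that bounds do not degenerate to 0 or
  below (\<open>n = K = 1\<close>, or \<open>\<epsilon>\<close> large).\<close>

definition log_factor :: "real \<Rightarrow> real" where
  "log_factor x = max 1 (ln x)"

end

theory Submission
  imports Defs
begin

text \<open>
Put \<open>M\<^sub>\<alpha> = I - A / (1 + \<alpha>)\<close>. If \<open>r\<close> and \<open>l\<close> satisfy \<open>\<parallel>1 - M\<^sub>\<alpha> r\<parallel>\<^sub>\<infinity> \<le> 1/2\<close> and
\<open>\<parallel>1 - M\<^sub>\<alpha>\<^sup>T l\<parallel>\<^sub>\<infinity> \<le> 1/2\<close>, which a program can check, then \<open>S = diag(l) M\<^sub>\<alpha> diag(r)\<close> is RCDD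
with slack \<open>1/4\<close> and has absolute row and column sums at most \<open>9/2 K\<^sup>2\<close>, so that
\<open>\<kappa>(S) \<le> 18 K\<^sup>2\<close> and the oracle may be called on it, whatever the earlier answers were.

Using the solver for \<open>S\<close> as a preconditioner, Richardson iteration for \<open>M\<^sub>\<alpha>\<^sub>/\<^sub>2 x = 1\<close>
reduces the residual by \<open>1/2\<close>, plus the error of the solver, in the Euclidean norm with
weights \<open>ls / rs\<close>, where \<open>rs = M\<^sup>-\<^sup>1 1\<close> and \<open>ls = M\<^sup>-\<^sup>T 1\<close>: by Schur's test \<open>A\<close> has norm
at most 1 there. These weights lie in \<open>[1/K, K]\<close>, so accuracy \<open>1/(216 K\<^sup>3)\<close> gives an expected
contraction by \<open>2/3\<close>, provided each step uses a fresh seed. Hence \<open>O(log (n K))\<close> steps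
certify a pair for \<open>\<alpha> / 2\<close> with high probability (Markov). Halving starts at an \<open>\<alpha>\<close> certified by
\<open>l = r = 1\<close> and may stop as soon as \<open>\<alpha> \<le> \<epsilon>\<close> or \<open>3 K \<alpha> \<le> 1\<close>; the second
condition bounds the number of phases in terms of \<open>K\<close> alone, as the union bound requires.
\<close>

section \<open>Matrices as functions\<close>

text \<open>The preconditioner works because the matrices for \<alpha> and \<alpha>/2 differ only by
  a multiple of A. With \<beta> = 1/(1+\<alpha>) and \<beta>' = 1/(1+\<alpha>/2), an exact
  correction turns the residual \<open>res\<close> into
  \<open>(\<beta>' - \<beta>) A M\<^sub>\<alpha>\<^sup>-\<^sup>1 res\<close>. Where A has norm at
  most 1, \<open>A M\<^sub>\<alpha>\<^sup>-\<^sup>1\<close> has norm at most (1+\<alpha>)/\<alpha>,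
  and the product with \<beta>' - \<beta> is at most 1/2. The oracle speaks about the Euclidean norm
  and the certificate about the maximum norm; each passage to or from the weighted norm costs a
  factor sqrt K. The obstacle is that a call on a matrix that is not admissible has no execution,
  while the time bound is claimed for every seed sequence. Hence a candidate pair replaces the
  current one only after a check, and a rejection keeps the last certified pair while the schedule
  of \<alpha>, and so the number of rounds, goes on regardless. Randomness can spoil the quality of
  the result, but neither admissibility nor time. Stopping at 3 K \<alpha> \<le> 1 is sound because
  the slack 1/2 of the certificate pays for \<alpha> times \<open>r\<close>.\<close>

definition mv :: "nat \<Rightarrow> (nat \<Rightarrow> nat \<Rightarrow> real) \<Rightarrow> (nat \<Rightarrow> real) \<Rightarrow> nat \<Rightarrow> real" where
  "mv n a x i = (\<Sum>j<n. a i j * x j)"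

definition resid :: "nat \<Rightarrow> (nat \<Rightarrow> nat \<Rightarrow> real) \<Rightarrow> real \<Rightarrow> (nat \<Rightarrow> real) \<Rightarrow> nat \<Rightarrow> real" where
  "resid n a \<beta> x i = 1 - (x i - \<beta> * mv n a x i)"

definition certified :: "nat \<Rightarrow> (nat \<Rightarrow> nat \<Rightarrow> real) \<Rightarrow> real \<Rightarrow> (nat \<Rightarrow> real) \<Rightarrow> bool" where
  "certified n a \<alpha> x \<longleftrightarrow> (\<forall>i<n. \<bar>resid n a (1 / (1 + \<alpha>)) x i\<bar> \<le> 1 / 2)"

definition scaled :: "(nat \<Rightarrow> nat \<Rightarrow> real) \<Rightarrow> real \<Rightarrow> (nat \<Rightarrow> real) \<Rightarrow> (nat \<Rightarrow> real) \<Rightarrow> nat \<Rightarrow> nat \<Rightarrow> real" where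
  "scaled a \<alpha> l r i j = l i * ((if i = j then 1 else 0) - 1 / (1 + \<alpha>) * a i j) * r j"

abbreviation (input) tr :: "(nat \<Rightarrow> nat \<Rightarrow> real) \<Rightarrow> nat \<Rightarrow> nat \<Rightarrow> real" where
  "tr a \<equiv> (\<lambda>i j. a j i)"

lemma mv_add: "mv n a (\<lambda>j. x j + y j) i = mv n a x i + mv n a y i"
  by (simp add: mv_def algebra_simps sum.distrib)

lemma mv_diff: "mv n a (\<lambda>j. x j - y j) i = mv n a x i - mv n a y i"
  by (simp add: mv_def algebra_simps sum_subtractf)

lemma mv_scale: "mv n a (\<lambda>j. c * x j) i = c * mv n a x i"
  by (simp add: mv_def algebra_simps sum_distrib_left)

lemma resid_cong: "(\<And>j. j < n \<Longrightarrow> x j = y j) \<Longrightarrow> i < n \<Longrightarrow> resid n a \<beta> x i = resid n a \<beta> y i"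
  by (simp add: resid_def mv_def)

lemma certified_cong: "(\<And>j. j < n \<Longrightarrow> x j = y j) \<Longrightarrow> certified n a \<alpha> x = certified n a \<alpha> y"
  unfolding certified_def by (metis (no_types, lifting) resid_cong)

lemma scaled_tr: "scaled (tr a) \<alpha> r l i j = scaled a \<alpha> l r j i"
  unfolding scaled_def by (cases "i = j") (simp_all add: mult_ac)

lemma sum_kronecker: "i < n \<Longrightarrow> (\<Sum>j<n. ((if i = j then 1 else 0) - \<beta> * a i j) * x j) = x i - \<beta> * mv n a (x :: nat \<Rightarrow> real) i"
  by (simp add: mv_def left_diff_distrib sum_subtractf sum_distrib_left mult.assoc if_distrib[of "\<lambda>z. z * _"] cong: if_cong)

lemma scaled_row_sum:
  "i < n \<Longrightarrow> (\<Sum>j<n. scaled a \<alpha> l r i j) = l i * (1 - resid n a (1 / (1 + \<alpha>)) r i)"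
  unfolding scaled_def mult.assoc sum_distrib_left[symmetric] by (simp only: sum_kronecker) (simp add: resid_def)

text \<open>The weights \<open>rs\<close> and \<open>ls\<close> stand for \<open>M\<^sup>-\<^sup>1 1\<close> and \<open>M\<^sup>-\<^sup>T 1\<close>.\<close>

locale mmatrix =
  fixes n :: nat and a :: "nat \<Rightarrow> nat \<Rightarrow> real" and K :: real and rs ls :: "nat \<Rightarrow> real"
  assumes nonneg: "i < n \<Longrightarrow> j < n \<Longrightarrow> 0 \<le> a i j"
    and rs_eq: "i < n \<Longrightarrow> rs i = 1 + mv n a rs i"
    and ls_eq: "i < n \<Longrightarrow> ls i = 1 + mv n (tr a) ls i"
    and rs_ge: "i < n \<Longrightarrow> 1 \<le> rs i" and ls_ge: "i < n \<Longrightarrow> 1 \<le> ls i"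
    and rs_le: "i < n \<Longrightarrow> rs i \<le> K" and ls_le: "i < n \<Longrightarrow> ls i \<le> K"
begin

lemma transposed: "mmatrix n (tr a) K ls rs"
  using nonneg rs_eq ls_eq rs_ge ls_ge rs_le ls_le by unfold_locales auto

lemma K_ge_1: "0 < n \<Longrightarrow> 1 \<le> K"
  using rs_ge rs_le by (meson order_trans)

lemma mv_nonneg: "(\<And>j. j < n \<Longrightarrow> 0 \<le> x j) \<Longrightarrow> i < n \<Longrightarrow> 0 \<le> mv n a x i"
  by (auto simp: mv_def intro!: sum_nonneg mult_nonneg_nonneg nonneg)

lemma mv_mono: "(\<And>j. j < n \<Longrightarrow> x j \<le> y j) \<Longrightarrow> i < n \<Longrightarrow> mv n a x i \<le> mv n a y i"
  by (auto simp: mv_def intro!: sum_mono mult_left_mono nonneg)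

lemma row_sum_le: "i < n \<Longrightarrow> (\<Sum>j<n. a i j) \<le> K"
proof -
  assume i: "i < n"
  have "(\<Sum>j<n. a i j) = mv n a (\<lambda>_. 1) i" by (simp add: mv_def)
  also have "\<dots> \<le> mv n a rs i" by (rule mv_mono[OF rs_ge i])
  also have "\<dots> \<le> K" using rs_eq[OF i] rs_le[OF i] by simp
  finally show ?thesis .
qed

text \<open>Otherwise \<open>rs\<close>, added with the least factor that makes \<open>z\<close> nonnegative, would have a
  nonpositive image at the index where the sum vanishes.\<close>

lemma inverse_nonneg:
  assumes \<beta>: "0 \<le> \<beta>" "\<beta> \<le> 1" and z: "\<And>i. i < n \<Longrightarrow> 0 \<le> z i - \<beta> * mv n a z i" and i: "i < n"
  shows "0 \<le> z i"
proof (rule ccontr)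
  assume neg: "\<not> 0 \<le> z i"
  define \<theta> where "\<theta> = Max ((\<lambda>i. - z i / rs i) ` {..<n})"
  have "\<theta> \<in> (\<lambda>i. - z i / rs i) ` {..<n}" unfolding \<theta>_def using i by (intro Max_in) auto
  then obtain k where k: "k < n" "\<theta> = - z k / rs k" by auto
  have le: "- z j / rs j \<le> \<theta>" if "j < n" for j unfolding \<theta>_def using that by (intro Max_ge) auto
  have pos: "0 < rs j" if "j < n" for j using rs_ge[OF that] by simp
  have "0 < - z i / rs i" using neg pos[OF i] by (simp add: divide_neg_pos)
  then have \<theta>: "0 < \<theta>" using le[OF i] by simp
  have 0: "0 \<le> z j + \<theta> * rs j" if "j < n" for j
    using le[OF that] pos[OF that] by (simp add: field_simps)
  have "0 \<le> mv n a (\<lambda>j. z j + \<theta> * rs j) k" by (rule mv_nonneg[OF 0 k(1)])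
  then have "0 \<le> \<beta> * (mv n a z k + \<theta> * mv n a rs k)" using \<beta> by (simp add: mv_add mv_scale)
  moreover have "z k + \<theta> * rs k = 0" using k pos[OF k(1)] by simp
  moreover have "0 \<le> z k - \<beta> * mv n a z k" by (rule z[OF k(1)])
  ultimately have "\<theta> * (rs k - \<beta> * mv n a rs k) \<le> 0" by (simp add: algebra_simps)
  moreover have "rs k - \<beta> * mv n a rs k = (1 - \<beta>) * rs k + \<beta>"
    using rs_eq[OF k(1)] by (simp add: algebra_simps)
  moreover have "0 < (1 - \<beta>) * rs k + \<beta>"
  proof -
    have "(1 - \<beta>) * 1 \<le> (1 - \<beta>) * rs k" using \<beta> rs_ge[OF k(1)] by (intro mult_left_mono) auto
    then show ?thesis by simp
  qed
  ultimately show False using \<theta> by (simp add: mult_le_0_iff)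
qed

text \<open>The certificate says that \<open>I - a / (1 + \<alpha>)\<close> maps \<open>x\<close>
  into [1/2, 3/2] entrywise. Its inverse is monotone by \<open>inverse_nonneg\<close>, so
  \<open>x\<close> is compared with a vector whose image is at most 1/2 (the constant 1/2) and with
  one whose image is at least 3/2 (a multiple of \<open>rs\<close>).\<close>

lemma certified_bounds:
  assumes \<alpha>: "0 \<le> \<alpha>" and c: "certified n a \<alpha> x" and i: "i < n"
  shows "1 / 2 \<le> x i" "x i \<le> 3 / 2 * K"
proof -
  define \<beta> where "\<beta> = 1 / (1 + \<alpha>)"
  have \<beta>: "0 \<le> \<beta>" "\<beta> \<le> 1" using \<alpha> by (auto simp: \<beta>_def divide_simps)
  have c: "1 / 2 \<le> x j - \<beta> * mv n a x j" "x j - \<beta> * mv n a x j \<le> 3 / 2" if "j < n" for j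
    using c[unfolded certified_def resid_def, rule_format, OF that] unfolding \<beta>_def[symmetric] abs_le_iff by linarith+
  have "0 \<le> x i - 1 / 2"
  proof (rule inverse_nonneg[OF \<beta> _ i, of "\<lambda>i. x i - 1 / 2"])
    fix j assume j: "j < n"
    have "0 \<le> \<beta> * mv n a (\<lambda>_. 1 / 2) j" using \<beta> by (intro mult_nonneg_nonneg mv_nonneg j) auto
    then show "0 \<le> x j - 1 / 2 - \<beta> * mv n a (\<lambda>i. x i - 1 / 2) j"
      using c(1)[OF j] by (simp add: mv_diff algebra_simps)
  qed
  then show "1 / 2 \<le> x i" by simp
  have "0 \<le> 3 / 2 * rs i - x i"
  proof (rule inverse_nonneg[OF \<beta> _ i, of "\<lambda>i. 3 / 2 * rs i - x i"])
    fix j assume j: "j < n"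
    \<comment> \<open>As \<open>mv n a rs\<close> is \<open>rs - 1\<close>, the image of
      \<open>rs\<close> is \<open>(1 - \<beta>) * rs + \<beta>\<close>, which is at least 1.\<close>
    have "(1 - \<beta>) * 1 \<le> (1 - \<beta>) * rs j" using \<beta> rs_ge[OF j] by (intro mult_left_mono) auto
    then have "1 \<le> rs j - \<beta> * (rs j - 1)" by (simp add: algebra_simps)
    then have "1 \<le> rs j - \<beta> * mv n a rs j" using rs_eq[OF j] by simp
    then show "0 \<le> 3 / 2 * rs j - x j - \<beta> * mv n a (\<lambda>i. 3 / 2 * rs i - x i) j"
      using c(2)[OF j] unfolding mv_diff mv_scale by (simp add: algebra_simps)
  qed
  then show "x i \<le> 3 / 2 * K" using rs_le[OF i] by linarith
qed

text \<open>All terms of \<open>mv n a x i\<close> are nonnegative, so keeping only the diagonal one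
  leaves a product with \<open>x i\<close> that is still at least 1/2. Strict positivity puts the
  whole diagonal into the support of the scaled matrix.\<close>

lemma certified_diagonal:
  assumes \<alpha>: "0 \<le> \<alpha>" and c: "certified n a \<alpha> x" and i: "i < n"
  shows "0 < 1 - 1 / (1 + \<alpha>) * a i i"
proof -
  have x: "0 < x j" if "j < n" for j using certified_bounds(1)[OF \<alpha> c that] by simp
  have "a i i * x i \<le> mv n a x i"
    unfolding mv_def using i x by (intro member_le_sum) (auto intro!: mult_nonneg_nonneg nonneg simp: less_imp_le)
  then have "1 / (1 + \<alpha>) * (a i i * x i) \<le> 1 / (1 + \<alpha>) * mv n a x i"
    using \<alpha> by (intro mult_left_mono) auto
  moreover have "1 / 2 \<le> x i - 1 / (1 + \<alpha>) * mv n a x i"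
    using c[unfolded certified_def resid_def, rule_format, OF i] unfolding abs_le_iff by linarith
  ultimately have "0 < (1 - 1 / (1 + \<alpha>) * a i i) * x i" by (simp add: algebra_simps)
  then show ?thesis using x[OF i] by (simp add: zero_less_mult_iff)
qed

lemma scaled_offdiag:
  assumes "0 \<le> \<alpha>" "certified n a \<alpha> r" "certified n (tr a) \<alpha> l" "i < n" "j < n" "i \<noteq> j"
  shows "scaled a \<alpha> l r i j \<le> 0"
proof -
  interpret T: mmatrix n "tr a" K ls rs by (rule transposed)
  have "0 \<le> 1 / (1 + \<alpha>) * a i j * r j * l i"
    using certified_bounds(1)[OF assms(1,2,5)] T.certified_bounds(1)[OF assms(1,3,4)] assms
    by (intro mult_nonneg_nonneg) (auto simp: nonneg)
  then show ?thesis using assms by (simp add: scaled_def mult_ac)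
qed

text \<open>The support does not depend on \<alpha>, \<open>l\<close> or \<open>r\<close>. One list
  of positions, the diagonal together with the support of \<open>a\<close>, therefore represents
  every matrix handed to the oracle.\<close>

lemma scaled_nonzero_iff:
  assumes "0 \<le> \<alpha>" "certified n a \<alpha> r" "certified n (tr a) \<alpha> l" "i < n" "j < n"
  shows "scaled a \<alpha> l r i j \<noteq> 0 \<longleftrightarrow> i = j \<or> a i j \<noteq> 0"
proof -
  interpret T: mmatrix n "tr a" K ls rs by (rule transposed)
  have "0 < r j" "0 < l i"
    using certified_bounds(1)[OF assms(1,2,5)] T.certified_bounds(1)[OF assms(1,3,4)] by auto
  then show ?thesis using certified_diagonal[OF assms(1,2,4)] assms(1) by (auto simp: scaled_def)
qed

text \<open>Off-diagonal entries are nonpositive, so the excess of the diagonal over their absolute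
  sum is the plain row sum, a product of two factors that are at least 1/2. The diagonal is at most
  \<open>l i * r i\<close>, hence at most 9/4 times the square of \<open>K\<close>, and dominance at
  most doubles this for the absolute row sum.\<close>

lemma scaled_row:
  assumes \<alpha>: "0 \<le> \<alpha>" and r: "certified n a \<alpha> r" and l: "certified n (tr a) \<alpha> l" and i: "i < n"
  shows "1 / 4 + (\<Sum>j\<in>{..<n} - {i}. \<bar>scaled a \<alpha> l r i j\<bar>) \<le> scaled a \<alpha> l r i i"
    and "(\<Sum>j<n. \<bar>scaled a \<alpha> l r i j\<bar>) \<le> 9 / 2 * K\<^sup>2"
proof -
  interpret T: mmatrix n "tr a" K ls rs by (rule transposed)
  note rb = certified_bounds[OF \<alpha> r] and lb = T.certified_bounds[OF \<alpha> l]
  define u where "u = 1 - resid n a (1 / (1 + \<alpha>)) r i"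
  have u: "1 / 2 \<le> u"
    using r[unfolded certified_def, rule_format, OF i] unfolding u_def abs_le_iff by linarith
  have tot: "scaled a \<alpha> l r i i + (\<Sum>j\<in>{..<n} - {i}. scaled a \<alpha> l r i j) = l i * u"
    using scaled_row_sum[OF i, of a \<alpha> l r] i unfolding u_def by (simp add: sum.remove)
  have off: "(\<Sum>j\<in>{..<n} - {i}. \<bar>scaled a \<alpha> l r i j\<bar>) = - (\<Sum>j\<in>{..<n} - {i}. scaled a \<alpha> l r i j)"
    unfolding sum_negf[symmetric] using scaled_offdiag[OF \<alpha> r l i] by (intro sum.cong) auto
  have "1 / 2 * (1 / 2) \<le> l i * u" using lb(1)[OF i] u by (intro mult_mono) auto
  then show slack: "1 / 4 + (\<Sum>j\<in>{..<n} - {i}. \<bar>scaled a \<alpha> l r i j\<bar>) \<le> scaled a \<alpha> l r i i"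
    using tot off by linarith
  have nn: "0 \<le> (\<Sum>j\<in>{..<n} - {i}. \<bar>scaled a \<alpha> l r i j\<bar>)" by (simp add: sum_nonneg)
  have "(1 - 1 / (1 + \<alpha>) * a i i) * r i \<le> 1 * r i"
    using \<alpha> rb(1)[OF i] nonneg[OF i i] by (intro mult_right_mono) auto
  then have "l i * ((1 - 1 / (1 + \<alpha>) * a i i) * r i) \<le> l i * r i"
    using lb(1)[OF i] by (intro mult_left_mono) auto
  also have "\<dots> \<le> (3 / 2 * K) * (3 / 2 * K)"
    using lb[OF i] rb[OF i] by (intro mult_mono) auto
  finally have d: "scaled a \<alpha> l r i i \<le> 9 / 4 * K\<^sup>2"
    by (simp add: scaled_def power2_eq_square mult.assoc)
  have "(\<Sum>j<n. \<bar>scaled a \<alpha> l r i j\<bar>) = \<bar>scaled a \<alpha> l r i i\<bar> + (\<Sum>j\<in>{..<n} - {i}. \<bar>scaled a \<alpha> l r i j\<bar>)"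
    using i by (simp add: sum.remove)
  then show "(\<Sum>j<n. \<bar>scaled a \<alpha> l r i j\<bar>) \<le> 9 / 2 * K\<^sup>2"
    using slack d nn by linarith
qed

lemma scaled_col:
  assumes \<alpha>: "0 \<le> \<alpha>" and r: "certified n a \<alpha> r" and l: "certified n (tr a) \<alpha> l" and i: "i < n"
  shows "1 / 4 + (\<Sum>j\<in>{..<n} - {i}. \<bar>scaled a \<alpha> l r j i\<bar>) \<le> scaled a \<alpha> l r i i"
    and "(\<Sum>j<n. \<bar>scaled a \<alpha> l r j i\<bar>) \<le> 9 / 2 * K\<^sup>2"
proof -
  interpret T: mmatrix n "tr a" K ls rs by (rule transposed)
  show "1 / 4 + (\<Sum>j\<in>{..<n} - {i}. \<bar>scaled a \<alpha> l r j i\<bar>) \<le> scaled a \<alpha> l r i i"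
    "(\<Sum>j<n. \<bar>scaled a \<alpha> l r j i\<bar>) \<le> 9 / 2 * K\<^sup>2"
    using T.scaled_row[OF \<alpha> l _ i, of r] r unfolding scaled_tr[of a \<alpha> r l] by auto
qed

section \<open>The weighted norm\<close>

text \<open>The weights \<open>ls / rs\<close> on the squares enter as square roots, so that the
  norm laws come from \<open>L2_set\<close>. In the transposed instance the weights are
  \<open>rs / ls\<close>: the iterations for \<open>r\<close> and \<open>l\<close> are measured in
  different norms.\<close>

definition wnorm :: "(nat \<Rightarrow> real) \<Rightarrow> real" where
  "wnorm x = L2_set (\<lambda>i. sqrt (ls i / rs i) * x i) {..<n}"

lemma wnorm_nonneg: "0 \<le> wnorm x"
  by (simp add: wnorm_def)

lemma wnorm_cong: "(\<And>i. i < n \<Longrightarrow> x i = y i) \<Longrightarrow> wnorm x = wnorm y"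
  unfolding wnorm_def by (rule L2_set_cong) auto

lemma wnorm_add: "wnorm (\<lambda>i. x i + y i) \<le> wnorm x + wnorm y"
  unfolding wnorm_def distrib_left by (rule L2_set_triangle_ineq)

lemma wnorm_scale: "0 \<le> c \<Longrightarrow> wnorm (\<lambda>i. c * x i) = c * wnorm x"
  by (simp add: wnorm_def L2_set_right_distrib mult.left_commute)

lemma weight_bounds: "i < n \<Longrightarrow> 1 / K \<le> ls i / rs i" "i < n \<Longrightarrow> ls i / rs i \<le> K"
proof -
  assume i: "i < n"
  have *: "1 \<le> ls i" "1 \<le> rs i" "ls i \<le> K" "rs i \<le> K" using ls_ge rs_ge ls_le rs_le i by auto
  show "1 / K \<le> ls i / rs i" using * by (intro frac_le) auto
  have "ls i / rs i \<le> K / 1" using * by (intro frac_le) auto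
  then show "ls i / rs i \<le> K" by simp
qed

lemma wnorm_le_L2: "0 < n \<Longrightarrow> wnorm x \<le> sqrt K * L2_set x {..<n}"
proof -
  assume n: "0 < n"
  have "wnorm x \<le> L2_set (\<lambda>i. sqrt K * \<bar>x i\<bar>) {..<n}"
    unfolding wnorm_def L2_set_def using weight_bounds
    by (intro real_sqrt_le_mono sum_mono)
       (auto simp: power_mult_distrib intro!: mult_right_mono power_mono divide_nonneg_nonneg
         order_trans[OF zero_le_one ls_ge] order_trans[OF zero_le_one rs_ge])
  also have "\<dots> = sqrt K * L2_set x {..<n}"
    using K_ge_1[OF n] by (simp add: L2_set_right_distrib[symmetric]) (simp add: L2_set_def)
  finally show ?thesis .
qed

lemma L2_le_wnorm: "0 < n \<Longrightarrow> L2_set x {..<n} \<le> sqrt K * wnorm x"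
proof -
  assume n: "0 < n"
  have K: "0 < K" using K_ge_1[OF n] by simp
  have "(x i)\<^sup>2 \<le> (sqrt K * (sqrt (ls i / rs i) * x i))\<^sup>2" if i: "i < n" for i
  proof -
    have 0: "0 \<le> ls i / rs i" using ls_ge[OF i] rs_ge[OF i] by simp
    have "1 \<le> K * (ls i / rs i)" using weight_bounds(1)[OF i] K by (simp add: field_simps)
    then have "1 * (x i)\<^sup>2 \<le> K * (ls i / rs i) * (x i)\<^sup>2" by (intro mult_right_mono) auto
    then show ?thesis using K 0 by (simp add: power_mult_distrib)
  qed
  then have "L2_set x {..<n} \<le> L2_set (\<lambda>i. sqrt K * (sqrt (ls i / rs i) * x i)) {..<n}"
    unfolding L2_set_def by (intro real_sqrt_le_mono sum_mono) auto
  also have "\<dots> = sqrt K * wnorm x"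
    unfolding wnorm_def using K by (simp add: L2_set_right_distrib)
  finally show ?thesis .
qed

text \<open>Schur's test: \<open>a rs \<le> rs\<close> and \<open>a\<^sup>T ls \<le> ls\<close>.\<close>

lemma wnorm_mv: "wnorm (mv n a x) \<le> wnorm x"
proof -
  have rp: "0 < rs i" "0 < ls i" if "i < n" for i using rs_ge[OF that] ls_ge[OF that] by auto
  have sq: "(mv n a x i)\<^sup>2 \<le> rs i * (\<Sum>j<n. a i j * ((x j)\<^sup>2 / rs j))" if i: "i < n" for i
  proof -
    \<comment> \<open>Distributing \<open>rs j\<close> and its inverse over the two factors makes
      Cauchy-Schwarz produce \<open>mv n a rs i\<close>, which is at most
      \<open>rs i\<close>.\<close>
    have "mv n a x i = (\<Sum>j<n. (sqrt (a i j) * sqrt (rs j)) * (sqrt (a i j) * (x j / sqrt (rs j))))"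
      unfolding mv_def
    proof (rule sum.cong)
      fix j assume "j \<in> {..<n}"
      then have "sqrt (a i j) * sqrt (a i j) = a i j" "sqrt (rs j) / sqrt (rs j) = 1"
        using nonneg[OF i] rp by (simp_all add: less_imp_neq[THEN not_sym])
      then have "a i j * x j = (sqrt (a i j) * sqrt (a i j)) * x j * (sqrt (rs j) / sqrt (rs j))" by (simp only: mult_1_right)
      then show "a i j * x j = (sqrt (a i j) * sqrt (rs j)) * (sqrt (a i j) * (x j / sqrt (rs j)))"
        by (simp only: mult_ac times_divide_eq_right times_divide_eq_left)
    qed simp
    then have "(mv n a x i)\<^sup>2 \<le> (\<Sum>j<n. (sqrt (a i j) * sqrt (rs j))\<^sup>2) * (\<Sum>j<n. (sqrt (a i j) * (x j / sqrt (rs j)))\<^sup>2)"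
      using Cauchy_Schwarz_ineq_sum[of "\<lambda>j. sqrt (a i j) * sqrt (rs j)" "\<lambda>j. sqrt (a i j) * (x j / sqrt (rs j))" "{..<n}"] by simp
    also have "(\<Sum>j<n. (sqrt (a i j) * sqrt (rs j))\<^sup>2) = mv n a rs i"
      unfolding mv_def using rp nonneg[OF i] by (intro sum.cong) (auto simp: power_mult_distrib less_imp_le)
    also have "(\<Sum>j<n. (sqrt (a i j) * (x j / sqrt (rs j)))\<^sup>2) = (\<Sum>j<n. a i j * ((x j)\<^sup>2 / rs j))"
      using rp nonneg[OF i] by (intro sum.cong) (auto simp: power_mult_distrib power_divide less_imp_le)
    also have "mv n a rs i * (\<Sum>j<n. a i j * ((x j)\<^sup>2 / rs j)) \<le> rs i * (\<Sum>j<n. a i j * ((x j)\<^sup>2 / rs j))"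
      using rs_eq[OF i] rp nonneg[OF i] by (intro mult_right_mono sum_nonneg) (auto simp: less_imp_le)
    finally show ?thesis .
  qed
  have "(\<Sum>i<n. (sqrt (ls i / rs i) * mv n a x i)\<^sup>2) = (\<Sum>i<n. ls i / rs i * (mv n a x i)\<^sup>2)"
    using rp by (intro sum.cong) (auto simp: power_mult_distrib less_imp_le)
  also have "\<dots> \<le> (\<Sum>i<n. ls i / rs i * (rs i * (\<Sum>j<n. a i j * ((x j)\<^sup>2 / rs j))))"
    using rp sq by (intro sum_mono mult_left_mono) (auto simp: less_imp_le)
  also have "\<dots> = (\<Sum>i<n. \<Sum>j<n. ls i * a i j * ((x j)\<^sup>2 / rs j))"
    using rp by (intro sum.cong) (auto simp: sum_distrib_left mult_ac less_imp_neq[THEN not_sym])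
  also have "\<dots> = (\<Sum>j<n. mv n (tr a) ls j * ((x j)\<^sup>2 / rs j))"
    unfolding mv_def sum_distrib_right by (subst sum.swap) (simp add: mult.commute)
  also have "\<dots> \<le> (\<Sum>j<n. ls j * ((x j)\<^sup>2 / rs j))"
    using ls_eq rp by (intro sum_mono mult_right_mono) (auto simp: less_imp_le)
  also have "\<dots> = (\<Sum>j<n. (sqrt (ls j / rs j) * x j)\<^sup>2)"
    using rp by (intro sum.cong) (auto simp: power_mult_distrib less_imp_le)
  finally show ?thesis unfolding wnorm_def L2_set_def by (rule real_sqrt_le_mono)
qed

text \<open>\<open>e\<close> is the error of the solver in the scaled system.\<close>

lemma richardson_step:
  assumes n: "0 < n" and \<alpha>: "0 < \<alpha>" and lb: "\<And>i. i < n \<Longrightarrow> 1 / 2 \<le> l i"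
    and y: "\<And>i. i < n \<Longrightarrow>
      l i * (y i - 1 / (1 + \<alpha>) * mv n a y i) = l i * resid n a (1 / (1 + \<alpha> / 2)) x i - e i"
  shows "wnorm (resid n a (1 / (1 + \<alpha> / 2)) (\<lambda>i. x i + y i))
    \<le> 1 / 2 * wnorm (resid n a (1 / (1 + \<alpha> / 2)) x) + 3 * sqrt K * L2_set e {..<n}"
proof -
  define \<beta> where "\<beta> = 1 / (1 + \<alpha>)"
  define \<beta>' where "\<beta>' = 1 / (1 + \<alpha> / 2)"
  define res where "res = resid n a \<beta>' x"
  define g where "g i = e i / l i" for i
  define f where "f i = res i - g i" for i
  have K: "1 \<le> K" by (rule K_ge_1[OF n])
  \<comment> \<open>\<open>f\<close> is the image of the correction \<open>y\<close> under the
    matrix for \<alpha>. It is the residual up to \<open>g\<close>, the solver error with the row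
    scaling \<open>l\<close> removed.\<close>
  have f: "f i = y i - \<beta> * mv n a y i" if "i < n" for i
    using y[OF that] lb[OF that] unfolding f_def g_def res_def \<beta>_def[symmetric] \<beta>'_def[symmetric]
    by (simp add: field_simps)
  have ay: "wnorm (mv n a y) \<le> wnorm y" by (rule wnorm_mv)
  have "wnorm y = wnorm (\<lambda>i. f i + \<beta> * mv n a y i)" by (rule wnorm_cong) (simp add: f)
  also have "\<dots> \<le> wnorm f + \<beta> * wnorm (mv n a y)"
    using wnorm_add[of f "\<lambda>i. \<beta> * mv n a y i"] wnorm_scale[of \<beta> "mv n a y"] \<alpha> by (simp add: \<beta>_def)
  finally have "wnorm y - wnorm (mv n a y) / (1 + \<alpha>) \<le> wnorm f" by (simp add: \<beta>_def)
  then have "(1 + \<alpha>) * wnorm y - wnorm (mv n a y) \<le> (1 + \<alpha>) * wnorm f"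
    using \<alpha> by (simp add: field_simps)
  \<comment> \<open>Because \<open>wnorm y\<close> is at least \<open>wnorm (mv n a y)\<close>. This
    bounds \<open>a\<close> after the inverse of \<open>I - a / (1 + \<alpha>)\<close> by
    \<open>(1 + \<alpha>) / \<alpha>\<close>.\<close>
  then have y1: "\<alpha> * wnorm (mv n a y) \<le> (1 + \<alpha>) * wnorm f"
    using ay mult_left_mono[OF ay, of "\<alpha>"] \<alpha> unfolding distrib_right by linarith
  \<comment> \<open>The part of the residual that \<open>y\<close> removes cancels. What stays is
    the solver error and the mismatch between the matrices for \<alpha> and \<alpha>/2.\<close>
  have new: "resid n a \<beta>' (\<lambda>i. x i + y i) i = g i + (\<beta>' - \<beta>) * mv n a y i" if i: "i < n" for i
    using f[OF i] unfolding f_def by (simp add: res_def resid_def mv_add algebra_simps)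
  \<comment> \<open>The second value is exactly \<open>1 / (2 + \<alpha>)\<close>; halving \<alpha>
    is what fixes the contraction at 1/2.\<close>
  have b: "0 \<le> \<beta>' - \<beta>" "(\<beta>' - \<beta>) * (1 + \<alpha>) / \<alpha> \<le> 1 / 2"
  proof -
    have "\<beta>' - \<beta> = \<alpha> / 2 / ((1 + \<alpha> / 2) * (1 + \<alpha>))"
      using \<alpha> by (simp add: \<beta>_def \<beta>'_def diff_frac_eq)
    moreover have "\<dots> * (1 + \<alpha>) / \<alpha> = 1 / 2 / (1 + \<alpha> / 2)" using \<alpha> by simp
    moreover have "\<dots> \<le> 1 / 2" using \<alpha> by (simp add: divide_le_eq)
    ultimately show "0 \<le> \<beta>' - \<beta>" "(\<beta>' - \<beta>) * (1 + \<alpha>) / \<alpha> \<le> 1 / 2" using \<alpha> by simp_all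
  qed
  have "wnorm (resid n a \<beta>' (\<lambda>i. x i + y i)) = wnorm (\<lambda>i. g i + (\<beta>' - \<beta>) * mv n a y i)"
    by (rule wnorm_cong) (simp add: new)
  also have "\<dots> \<le> wnorm g + (\<beta>' - \<beta>) * wnorm (mv n a y)"
    using wnorm_add[of g "\<lambda>i. (\<beta>' - \<beta>) * mv n a y i"] wnorm_scale[OF b(1), of "mv n a y"] by simp
  also have "(\<beta>' - \<beta>) * wnorm (mv n a y) \<le> (\<beta>' - \<beta>) * ((1 + \<alpha>) / \<alpha> * wnorm f)"
    using b y1 \<alpha> by (intro mult_left_mono) (auto simp: field_simps)
  also have "(\<beta>' - \<beta>) * ((1 + \<alpha>) / \<alpha> * wnorm f) = (\<beta>' - \<beta>) * (1 + \<alpha>) / \<alpha> * wnorm f" by simp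
  also have "\<dots> \<le> 1 / 2 * wnorm f" by (rule mult_right_mono[OF b(2) wnorm_nonneg])
  finally have 1: "wnorm (resid n a \<beta>' (\<lambda>i. x i + y i)) \<le> wnorm g + 1 / 2 * wnorm f" by simp
  have "wnorm f \<le> wnorm res + wnorm (\<lambda>i. - g i)"
    using wnorm_add[of res "\<lambda>i. - g i"] by (simp add: f_def[abs_def])
  also have "wnorm (\<lambda>i. - g i) = wnorm g" by (simp add: wnorm_def L2_set_def)
  finally have 2: "wnorm f \<le> wnorm res + wnorm g" .
  have "wnorm g \<le> sqrt K * L2_set g {..<n}" by (rule wnorm_le_L2[OF n])
  also have "L2_set g {..<n} \<le> L2_set (\<lambda>i. 2 * e i) {..<n}"
    unfolding L2_set_def
  proof (intro real_sqrt_le_mono sum_mono)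
    fix i assume "i \<in> {..<n}"
    then have "1 / 2 \<le> l i" using lb by simp
    then have "\<bar>e i\<bar> / \<bar>l i\<bar> \<le> \<bar>e i\<bar> / (1 / 2)" by (intro divide_left_mono) auto
    then have "\<bar>e i / l i\<bar> \<le> \<bar>2 * e i\<bar>" by (simp add: abs_mult)
    then show "(g i)\<^sup>2 \<le> (2 * e i)\<^sup>2" unfolding g_def abs_le_square_iff .
  qed
  also have "L2_set (\<lambda>i. 2 * e i) {..<n} = 2 * L2_set e {..<n}" by (simp add: L2_set_right_distrib)
  finally have 3: "wnorm g \<le> 2 * sqrt K * L2_set e {..<n}" using K by simp
  \<comment> \<open>\<open>g\<close> counts once directly and once more, halved, through
    \<open>f\<close>. With the factor 2 in fact \<open>3\<close> this makes the 3 of the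
    claim.\<close>
  have "wnorm (resid n a \<beta>' (\<lambda>i. x i + y i)) \<le> 1 / 2 * wnorm res + 3 / 2 * wnorm g" using 1 2 by linarith
  also have "\<dots> \<le> 1 / 2 * wnorm res + 3 * sqrt K * L2_set e {..<n}" using 3 by simp
  finally show ?thesis unfolding res_def \<beta>'_def .
qed

end

section \<open>Induced norms\<close>

lemma l2_norm_eq: "l2_norm x = L2_set (vec_index x) {..<dim_vec x}"
  by (simp add: l2_norm_def L2_set_def)

lemma l2_norm_vec: "l2_norm (Matrix.vec n f) = L2_set f {..<n}"
  unfolding l2_norm_eq by (rule L2_set_cong) auto

lemma mult_mat_vec_index:
  assumes "A \<in> carrier_mat m n" "x \<in> carrier_vec n" "i < m"
  shows "vec_index (A *\<^sub>v x) i = (\<Sum>j<n. A $$ (i, j) * vec_index x j)"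
  using assms by (auto simp: scalar_prod_def atLeast0LessThan)

lemma linf_norm_le: "0 \<le> c \<Longrightarrow> (\<And>i. i < dim_vec x \<Longrightarrow> \<bar>vec_index x i\<bar> \<le> c) \<Longrightarrow> linf_norm x \<le> c"
  unfolding linf_norm_def by (subst Max_le_iff) auto

lemma linf_norm_ge: "i < dim_vec x \<Longrightarrow> \<bar>vec_index x i\<bar> \<le> linf_norm x"
  unfolding linf_norm_def by (rule Max_ge) auto

lemma index_le_norms:
  assumes "i < dim_vec x"
  shows "\<bar>vec_index x i\<bar> \<le> l1_norm x" "\<bar>vec_index x i\<bar> \<le> l2_norm x"
proof -
  show "\<bar>vec_index x i\<bar> \<le> l1_norm x"
    unfolding l1_norm_def using assms by (intro member_le_sum) auto
  have "\<bar>vec_index x i\<bar> \<le> L2_set (\<lambda>i. \<bar>vec_index x i\<bar>) {..<dim_vec x}"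
    using assms by (intro member_le_L2_set) auto
  then show "\<bar>vec_index x i\<bar> \<le> l2_norm x" by (simp add: l2_norm_eq L2_set_def)
qed

text \<open>A real supremum is informative only over a bounded set. Any \<open>N\<close> between the
  absolute entries and \<open>l1_norm\<close> is bounded on the image of its unit ball by the sum of
  all absolute matrix entries, so one argument serves \<open>linf_norm\<close>,
  \<open>l1_norm\<close> and \<open>l2_norm\<close>.\<close>

lemma induced_norm_upper:
  assumes A: "A \<in> carrier_mat n n" and x: "x \<in> carrier_vec n" "N x \<le> 1"
    and idx: "\<And>y i. y \<in> carrier_vec n \<Longrightarrow> i < n \<Longrightarrow> \<bar>vec_index y i\<bar> \<le> N y"
    and l1: "\<And>y. y \<in> carrier_vec n \<Longrightarrow> N y \<le> l1_norm y"
  shows "N (A *\<^sub>v x) \<le> induced_norm N A"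
  unfolding induced_norm_def
proof (rule cSUP_upper)
  show "x \<in> {x \<in> carrier_vec (dim_col A). N x \<le> 1}" using A x by auto
  show "bdd_above ((\<lambda>x. N (A *\<^sub>v x)) ` {x \<in> carrier_vec (dim_col A). N x \<le> 1})"
  proof (rule bdd_aboveI2)
    fix y assume "y \<in> {x \<in> carrier_vec (dim_col A). N x \<le> 1}"
    then have y: "y \<in> carrier_vec n" "N y \<le> 1" using A by auto
    have "N (A *\<^sub>v y) \<le> l1_norm (A *\<^sub>v y)" using A y by (intro l1) auto
    also have "\<dots> \<le> (\<Sum>i<n. \<Sum>j<n. \<bar>A $$ (i, j)\<bar>)"
    proof -
      have "\<bar>vec_index (A *\<^sub>v y) i\<bar> \<le> (\<Sum>j<n. \<bar>A $$ (i, j)\<bar>)" if i: "i < n" for i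
        unfolding mult_mat_vec_index[OF A y(1) i]
      proof (rule order_trans[OF sum_abs sum_mono])
        fix j assume "j \<in> {..<n}"
        then have "\<bar>vec_index y j\<bar> \<le> 1" using idx[OF y(1), of j] y(2) by simp
        then have "\<bar>A $$ (i, j)\<bar> * \<bar>vec_index y j\<bar> \<le> \<bar>A $$ (i, j)\<bar> * 1" by (intro mult_left_mono) auto
        then show "\<bar>A $$ (i, j) * vec_index y j\<bar> \<le> \<bar>A $$ (i, j)\<bar>" by (simp add: abs_mult)
      qed
      then show ?thesis unfolding l1_norm_def using A by (auto intro!: sum_mono)
    qed
    finally show "N (A *\<^sub>v y) \<le> (\<Sum>i<n. \<Sum>j<n. \<bar>A $$ (i, j)\<bar>)" .
  qed
qed

lemma l1_norm_ge_linf: "linf_norm y \<le> l1_norm y"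
proof (rule linf_norm_le)
  show "0 \<le> l1_norm y" by (simp add: l1_norm_def sum_nonneg)
qed (rule index_le_norms(1))

lemma l1_norm_ge_l2: "l2_norm y \<le> l1_norm y"
  unfolding l2_norm_eq l1_norm_def by (rule L2_set_le_sum_abs)

text \<open>The sign vector of the row attains its absolute sum; for columns, a unit vector does.
  These bounds carry \<open>K\<close> over to the weights \<open>rs\<close> and \<open>ls\<close>,
  and the norms of the input over to the starting value of \<alpha>.\<close>

lemma row_sum_le_induced:
  assumes A: "A \<in> carrier_mat n n" and i: "i < n"
  shows "(\<Sum>j<n. \<bar>A $$ (i, j)\<bar>) \<le> induced_norm linf_norm A"
proof -
  define x where "x = Matrix.vec n (\<lambda>j. sgn (A $$ (i, j)))"
  have x: "x \<in> carrier_vec n" by (simp add: x_def)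
  have "(\<Sum>j<n. \<bar>A $$ (i, j)\<bar>) = vec_index (A *\<^sub>v x) i"
    unfolding mult_mat_vec_index[OF A x i] by (simp add: x_def abs_sgn)
  also have "\<dots> \<le> linf_norm (A *\<^sub>v x)" using linf_norm_ge[of i "A *\<^sub>v x"] A i by auto
  also have "\<dots> \<le> induced_norm linf_norm A"
    by (rule induced_norm_upper[OF A x])
       (auto simp: x_def sgn_if intro!: linf_norm_le linf_norm_ge l1_norm_ge_linf)
  finally show ?thesis .
qed

lemma col_sum_le_induced:
  assumes A: "A \<in> carrier_mat n n" and j: "j < n"
  shows "(\<Sum>i<n. \<bar>A $$ (i, j)\<bar>) \<le> induced_norm l1_norm A"
proof -
  have "l1_norm (A *\<^sub>v unit_vec n j) = (\<Sum>i<n. \<bar>A $$ (i, j)\<bar>)"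
    unfolding l1_norm_def
  proof (rule sum.cong)
    fix i assume "i \<in> {..<n}"
    then have i: "i < n" by simp
    show "\<bar>vec_index (A *\<^sub>v unit_vec n j) i\<bar> = \<bar>A $$ (i, j)\<bar>"
      unfolding mult_mat_vec_index[OF A unit_vec_carrier i] using j
      by (simp add: unit_vec_def if_distrib[of "\<lambda>z. _ * z"] cong: if_cong)
  qed (use A in auto)
  moreover have "l1_norm (A *\<^sub>v unit_vec n j) \<le> induced_norm l1_norm A"
  proof (rule induced_norm_upper[OF A unit_vec_carrier])
    show "l1_norm (unit_vec n j) \<le> 1"
      using j by (simp add: l1_norm_def unit_vec_def if_distrib[of abs] cong: if_cong)
  qed (auto simp: index_le_norms)
  ultimately show ?thesis by simp
qed

text \<open>Schur's test with unit weights: Cauchy-Schwarz splits each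
  \<open>\<bar>s i j\<bar>\<close> into two square roots; one factor is a row sum, and summation
  over the rows turns the other into column sums.\<close>

lemma schur_L2:
  fixes s :: "nat \<Rightarrow> nat \<Rightarrow> real"
  assumes r: "\<And>i. i < n \<Longrightarrow> (\<Sum>j<n. \<bar>s i j\<bar>) \<le> c" and q: "\<And>j. j < n \<Longrightarrow> (\<Sum>i<n. \<bar>s i j\<bar>) \<le> c"
    and c: "0 \<le> (c :: real)"
  shows "L2_set (\<lambda>i. \<Sum>j<n. s i j * x j) {..<n} \<le> c * L2_set x {..<n}"
proof -
  have sq: "(\<Sum>j<n. s i j * x j)\<^sup>2 \<le> c * (\<Sum>j<n. \<bar>s i j\<bar> * (x j)\<^sup>2)" if i: "i < n" for i
  proof -
    have "\<bar>\<Sum>j<n. s i j * x j\<bar> \<le> (\<Sum>j<n. sqrt \<bar>s i j\<bar> * (sqrt \<bar>s i j\<bar> * \<bar>x j\<bar>))"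
      by (rule order_trans[OF sum_abs]) (simp add: abs_mult flip: mult.assoc)
    then have "(\<Sum>j<n. s i j * x j)\<^sup>2 \<le> (\<Sum>j<n. sqrt \<bar>s i j\<bar> * (sqrt \<bar>s i j\<bar> * \<bar>x j\<bar>))\<^sup>2"
      by (metis abs_ge_zero power2_abs power_mono)
    also have "\<dots> \<le> (\<Sum>j<n. (sqrt \<bar>s i j\<bar>)\<^sup>2) * (\<Sum>j<n. (sqrt \<bar>s i j\<bar> * \<bar>x j\<bar>)\<^sup>2)"
      by (rule Cauchy_Schwarz_ineq_sum)
    also have "\<dots> = (\<Sum>j<n. \<bar>s i j\<bar>) * (\<Sum>j<n. \<bar>s i j\<bar> * (x j)\<^sup>2)"
      by (simp add: power_mult_distrib)
    also have "\<dots> \<le> c * (\<Sum>j<n. \<bar>s i j\<bar> * (x j)\<^sup>2)"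
      using r[OF i] by (intro mult_right_mono sum_nonneg) auto
    finally show ?thesis .
  qed
  have "(\<Sum>i<n. (\<Sum>j<n. s i j * x j)\<^sup>2) \<le> (\<Sum>i<n. c * (\<Sum>j<n. \<bar>s i j\<bar> * (x j)\<^sup>2))"
    using sq by (intro sum_mono) auto
  also have "\<dots> = c * (\<Sum>j<n. (\<Sum>i<n. \<bar>s i j\<bar>) * (x j)\<^sup>2)"
    unfolding sum_distrib_left[symmetric] sum_distrib_right by (subst sum.swap) simp
  also have "\<dots> \<le> c * (\<Sum>j<n. c * (x j)\<^sup>2)"
    using q c by (intro mult_left_mono sum_mono mult_right_mono) auto
  also have "\<dots> = (c * L2_set x {..<n})\<^sup>2"
    by (simp add: L2_set_def power_mult_distrib sum_nonneg flip: sum_distrib_left) (simp add: power2_eq_square)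
  finally show ?thesis
    unfolding L2_set_def[of "\<lambda>i. \<Sum>j<n. s i j * x j"] using c by (intro real_le_lsqrt) (auto simp: sum_nonneg)
qed

text \<open>Diagonal dominance with slack \<open>\<sigma>\<close> gives \<open>\<sigma> \<parallel>x\<parallel>\<^sup>2 \<le> x\<^sup>T S x\<close>.\<close>

lemma dominant_L2:
  fixes s :: "nat \<Rightarrow> nat \<Rightarrow> real"
  assumes r: "\<And>i. i < n \<Longrightarrow> \<sigma> + (\<Sum>j\<in>{..<n} - {i}. \<bar>s i j\<bar>) \<le> s i i"
    and q: "\<And>i. i < n \<Longrightarrow> \<sigma> + (\<Sum>j\<in>{..<n} - {i}. \<bar>s j i\<bar>) \<le> (s i i :: real)"
  shows "\<sigma> * L2_set x {..<n} \<le> L2_set (\<lambda>i. \<Sum>j<n. s i j * x j) {..<n}"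
proof -
  define o' where "o' i j = (if i = j then 0 else \<bar>s i j\<bar>)" for i j
  have o': "(\<Sum>j\<in>{..<n} - {i}. \<bar>s i j\<bar>) = (\<Sum>j<n. o' i j)" "(\<Sum>j\<in>{..<n} - {i}. \<bar>s j i\<bar>) = (\<Sum>j<n. o' j i)"
    if "i < n" for i
    using that unfolding o'_def
    by (auto intro!: sum.mono_neutral_cong_left split: if_splits)
  \<comment> \<open>Half of each off-diagonal entry is charged to row \<open>i\<close> and half to
    column \<open>j\<close>, so the diagonal pays for the average of a row sum and a column
    sum.\<close>
  have entry: "x i * (s i j * x j) \<ge> (if i = j then s i i * (x i)\<^sup>2 else 0) - o' i j * ((x i)\<^sup>2 + (x j)\<^sup>2) / 2"
    for i j
  proof (cases "i = j")
    case False
    have "\<bar>x i * x j\<bar> \<le> ((x i)\<^sup>2 + (x j)\<^sup>2) / 2"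
      using sum_squares_bound[of "\<bar>x i\<bar>" "\<bar>x j\<bar>"] by (simp add: abs_mult)
    then have "\<bar>s i j\<bar> * \<bar>x i * x j\<bar> \<le> \<bar>s i j\<bar> * (((x i)\<^sup>2 + (x j)\<^sup>2) / 2)" by (intro mult_left_mono) auto
    then have "\<bar>x i * (s i j * x j)\<bar> \<le> \<bar>s i j\<bar> * (((x i)\<^sup>2 + (x j)\<^sup>2) / 2)" by (simp add: abs_mult mult_ac)
    then show ?thesis using False by (simp add: o'_def)
  qed (simp add: o'_def power2_eq_square)
  have "\<sigma> * (\<Sum>i<n. (x i)\<^sup>2) = (\<Sum>i<n. \<sigma> * (x i)\<^sup>2)" by (simp add: sum_distrib_left)
  also have "\<dots> \<le> (\<Sum>i<n. (s i i - ((\<Sum>j<n. o' i j) + (\<Sum>j<n. o' j i)) / 2) * (x i)\<^sup>2)"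
  proof (intro sum_mono mult_right_mono)
    fix i assume "i \<in> {..<n}"
    then have i: "i < n" by simp
    show "\<sigma> \<le> s i i - ((\<Sum>j<n. o' i j) + (\<Sum>j<n. o' j i)) / 2"
      using r[OF i] q[OF i] unfolding o'[OF i] by argo
  qed simp
  also have "\<dots> = (\<Sum>i<n. s i i * (x i)\<^sup>2) - ((\<Sum>i<n. (\<Sum>j<n. o' i j) * (x i)\<^sup>2) + (\<Sum>i<n. (\<Sum>j<n. o' j i) * (x i)\<^sup>2)) / 2"
    by (simp add: left_diff_distrib sum_subtractf distrib_right add_divide_distrib sum.distrib flip: sum_divide_distrib)
  also have "(\<Sum>i<n. (\<Sum>j<n. o' j i) * (x i)\<^sup>2) = (\<Sum>i<n. \<Sum>j<n. o' i j * (x j)\<^sup>2)"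
    unfolding sum_distrib_right by (rule sum.swap)
  also have "(\<Sum>i<n. (\<Sum>j<n. o' i j) * (x i)\<^sup>2) = (\<Sum>i<n. \<Sum>j<n. o' i j * (x i)\<^sup>2)"
    unfolding sum_distrib_right ..
  also have "(\<Sum>i<n. s i i * (x i)\<^sup>2) = (\<Sum>i<n. \<Sum>j<n. if i = j then s i i * (x i)\<^sup>2 else 0)"
    by (intro sum.cong) (simp_all add: sum.delta')
  also have "\<dots> - ((\<Sum>i<n. \<Sum>j<n. o' i j * (x i)\<^sup>2) + (\<Sum>i<n. \<Sum>j<n. o' i j * (x j)\<^sup>2)) / 2
      = (\<Sum>i<n. \<Sum>j<n. (if i = j then s i i * (x i)\<^sup>2 else 0) - o' i j * ((x i)\<^sup>2 + (x j)\<^sup>2) / 2)"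
    unfolding sum_subtractf sum_divide_distrib[symmetric] distrib_left sum.distrib ..
  also have "\<dots> \<le> (\<Sum>i<n. \<Sum>j<n. x i * (s i j * x j))" by (intro sum_mono entry)
  also have "\<dots> = (\<Sum>i<n. x i * (\<Sum>j<n. s i j * x j))" by (simp add: sum_distrib_left)
  also have "\<dots> \<le> (\<Sum>i<n. \<bar>x i\<bar> * \<bar>\<Sum>j<n. s i j * x j\<bar>)"
    by (intro sum_mono) (metis abs_ge_self abs_mult)
  also have "\<dots> \<le> L2_set x {..<n} * L2_set (\<lambda>i. \<Sum>j<n. s i j * x j) {..<n}" by (rule L2_set_mult_ineq)
  finally have "\<sigma> * (L2_set x {..<n})\<^sup>2 \<le> L2_set x {..<n} * L2_set (\<lambda>i. \<Sum>j<n. s i j * x j) {..<n}"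
    by (simp add: L2_set_def sum_nonneg)
  then have *: "L2_set x {..<n} * (\<sigma> * L2_set x {..<n}) \<le> L2_set x {..<n} * L2_set (\<lambda>i. \<Sum>j<n. s i j * x j) {..<n}"
    by (simp add: power2_eq_square mult_ac)
  show ?thesis
  proof (cases "L2_set x {..<n} = 0")
    case False
    then have "0 < L2_set x {..<n}" using L2_set_nonneg[of x "{..<n}"] by linarith
    then show ?thesis using * by (simp add: mult_le_cancel_left)
  qed simp
qed

text \<open>\<open>inverse_mat\<close> is a definite description, so its value is known only after
  existence and uniqueness are shown. The trivial kernel yields existence through the
  determinant.\<close>

lemma inverse_mat_props:
  fixes A :: "real Matrix.mat"
  assumes A: "A \<in> carrier_mat n n" and inj: "\<And>v. v \<in> carrier_vec n \<Longrightarrow> A *\<^sub>v v = 0\<^sub>v n \<Longrightarrow> v = 0\<^sub>v n"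
  shows "inverse_mat A \<in> carrier_mat n n" "A * inverse_mat A = 1\<^sub>m n" "inverse_mat A * A = 1\<^sub>m n"
    "invertible_mat A"
proof -
  have "det A \<noteq> 0" using det_0_iff_vec_prod_zero[OF A] inj by blast
  then obtain B where B: "B \<in> carrier_mat n n" "B * A = 1\<^sub>m n"
    using det_non_zero_imp_unit[OF A, of "()"] unfolding Units_def by (auto simp: ring_mat_def)
  have B': "A * B = 1\<^sub>m n" by (rule mat_mult_left_right_inverse[OF B(1) A B(2)])
  have "inverse_mat A = B"
    unfolding inverse_mat_def
  proof (rule the_equality)
    show "B \<in> carrier_mat (dim_row A) (dim_row A) \<and> inverts_mat A B \<and> inverts_mat B A"
      using A B B' by (auto simp: inverts_mat_def)
    fix C assume "C \<in> carrier_mat (dim_row A) (dim_row A) \<and> inverts_mat A C \<and> inverts_mat C A"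
    then have C: "C \<in> carrier_mat n n" "C * A = 1\<^sub>m n" using A by (auto simp: inverts_mat_def)
    have "C = C * (A * B)" using B' C by simp
    also have "\<dots> = (C * A) * B" by (rule assoc_mult_mat[OF C(1) A B(1), symmetric])
    also have "\<dots> = B" using B C by simp
    finally show "C = B" .
  qed
  then show "inverse_mat A \<in> carrier_mat n n" "A * inverse_mat A = 1\<^sub>m n" "inverse_mat A * A = 1\<^sub>m n"
    using B B' by auto
  show "invertible_mat A" unfolding invertible_mat_def
    using A B B' by (auto simp: inverts_mat_def square_mat.simps)
qed

text \<open>The slack 1/4 bounds the norm of the inverse by 4 (\<open>dominant_L2\<close>), and
  \<open>schur_L2\<close> bounds that of \<open>S\<close> by \<open>c\<close>; with
  \<open>c = 9 / 2 * K\<^sup>2\<close> this is the 18 of the time bound. The lower bound 1 is stated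
  because \<open>solver_time\<close> assumes monotonicity only from condition number 1 on.\<close>

lemma dominant_admissible:
  fixes s :: "nat \<Rightarrow> nat \<Rightarrow> real"
  assumes n: "0 < n"
    and r: "\<And>i. i < n \<Longrightarrow> 1 / 4 + (\<Sum>j\<in>{..<n} - {i}. \<bar>s i j\<bar>) \<le> s i i"
    and q: "\<And>i. i < n \<Longrightarrow> 1 / 4 + (\<Sum>j\<in>{..<n} - {i}. \<bar>s j i\<bar>) \<le> s i i"
    and rc: "\<And>i. i < n \<Longrightarrow> (\<Sum>j<n. \<bar>s i j\<bar>) \<le> c" and qc: "\<And>i. i < n \<Longrightarrow> (\<Sum>j<n. \<bar>s j i\<bar>) \<le> c"
  defines "S \<equiv> Matrix.mat n n (\<lambda>(i, j). s i j)"
  shows "admissible n S" "1 \<le> cond_number S" "cond_number S \<le> 4 * c"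
proof -
  have S: "S \<in> carrier_mat n n" by (simp add: S_def)
  have Sx: "l2_norm (S *\<^sub>v x) = L2_set (\<lambda>i. \<Sum>j<n. s i j * vec_index x j) {..<n}" if "x \<in> carrier_vec n" for x
    unfolding l2_norm_eq
  proof (rule L2_set_cong)
    fix i assume "i \<in> {..<n}"
    then show "vec_index (S *\<^sub>v x) i = (\<Sum>j<n. s i j * vec_index x j)"
      using mult_mat_vec_index[OF S that, of i] by (simp add: S_def)
  qed (use S in simp)
  have low: "1 / 4 * l2_norm x \<le> l2_norm (S *\<^sub>v x)" if "x \<in> carrier_vec n" for x
    using dominant_L2[of n "1 / 4" s "vec_index x"] r q that unfolding Sx[OF that] by (simp add: l2_norm_eq)
  have c: "0 \<le> c" using rc[OF n] sum_nonneg[of "{..<n}" "\<lambda>j. \<bar>s 0 j\<bar>"] by linarith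
  have up: "l2_norm (S *\<^sub>v x) \<le> c * l2_norm x" if "x \<in> carrier_vec n" for x
    using schur_L2[of n s c "vec_index x"] rc qc c that unfolding Sx[OF that] by (simp add: l2_norm_eq)
  have zero: "x = 0\<^sub>v n" if "x \<in> carrier_vec n" "l2_norm x \<le> 0" for x
  proof (rule eq_vecI)
    fix i assume "i < dim_vec (0\<^sub>v n :: real Matrix.vec)"
    then have i: "i < n" by simp
    then have "\<bar>vec_index x i\<bar> \<le> 0" using index_le_norms(2)[of i x] that by simp
    then show "vec_index x i = vec_index (0\<^sub>v n) i" using i by simp
  qed (use that in simp)
  have z0: "l2_norm (0\<^sub>v n) = 0" by (simp add: l2_norm_def)
  have inj: "v = 0\<^sub>v n" if "v \<in> carrier_vec n" "S *\<^sub>v v = 0\<^sub>v n" for v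
    using low[OF that(1)] that z0 by (intro zero) auto
  note I = inverse_mat_props[OF S inj]
  show "admissible n S"
    unfolding admissible_def rcdd_def
  proof (intro conjI allI impI)
    fix i assume "i < dim_row S"
    then have i: "i < n" using S by simp
    show "(\<Sum>j\<in>{..<dim_row S} - {i}. \<bar>S $$ (i, j)\<bar>) \<le> S $$ (i, i)"
      "(\<Sum>j\<in>{..<dim_row S} - {i}. \<bar>S $$ (j, i)\<bar>) \<le> S $$ (i, i)"
      using r[OF i] q[OF i] i by (simp_all add: S_def)
  qed (use n S I(4) in \<open>auto simp: square_mat.simps\<close>)
  have upI: "l2_norm (inverse_mat S *\<^sub>v x) \<le> 4 * l2_norm x" if x: "x \<in> carrier_vec n" for x
  proof -
    have "S *\<^sub>v (inverse_mat S *\<^sub>v x) = x"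
      using I(1,2) S x by (simp flip: assoc_mult_mat_vec[of S n n "inverse_mat S" n x])
    then show ?thesis using low[of "inverse_mat S *\<^sub>v x"] I(1) x by auto
  qed
  have nS: "induced_norm l2_norm S \<le> c"
    unfolding induced_norm_def
  proof (rule cSUP_least)
    show "{x \<in> carrier_vec (dim_col S). l2_norm x \<le> 1} \<noteq> {}"
      using S z0 by (auto intro!: exI[of _ "0\<^sub>v n"])
    fix x assume "x \<in> {x \<in> carrier_vec (dim_col S). l2_norm x \<le> 1}"
    then show "l2_norm (S *\<^sub>v x) \<le> c" using up[of x] c S mult_left_mono[of "l2_norm x" 1 c] by auto
  qed
  have nI: "induced_norm l2_norm (inverse_mat S) \<le> 4"
    unfolding induced_norm_def
  proof (rule cSUP_least)
    show "{x \<in> carrier_vec (dim_col (inverse_mat S)). l2_norm x \<le> 1} \<noteq> {}"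
      using I(1) z0 by (auto intro!: exI[of _ "0\<^sub>v n"])
    fix x assume "x \<in> {x \<in> carrier_vec (dim_col (inverse_mat S)). l2_norm x \<le> 1}"
    then show "l2_norm (inverse_mat S *\<^sub>v x) \<le> 4" using upI[of x] I(1) by auto
  qed
  have ind: "l2_norm (A *\<^sub>v x) \<le> induced_norm l2_norm A"
    if "A \<in> carrier_mat n n" "x \<in> carrier_vec n" "l2_norm x \<le> 1" for A x
    by (rule induced_norm_upper[where N = l2_norm, OF that]) (auto simp: index_le_norms l1_norm_ge_l2)
  \<comment> \<open>For the lower bound: the preimage \<open>y\<close> of the unit vector
    \<open>e\<close>, rescaled to length at most 1, is mapped by \<open>S\<close> to
    \<open>e\<close> divided by the norm of the inverse.\<close>
  define e where "e = (unit_vec n 0 :: real Matrix.vec)"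
  have e: "e \<in> carrier_vec n" by (simp add: e_def)
  have e1: "l2_norm e = 1" using n
    by (simp add: l2_norm_def e_def unit_vec_def if_distrib[of "\<lambda>z. z\<^sup>2"] cong: if_cong)
  define y where "y = inverse_mat S *\<^sub>v e"
  have y: "y \<in> carrier_vec n" unfolding y_def using I(1) e by auto
  have Sy: "S *\<^sub>v y = e"
    using I(1,2) S e by (simp add: y_def flip: assoc_mult_mat_vec[of S n n "inverse_mat S" n e])
  define p where "p = induced_norm l2_norm (inverse_mat S)"
  have yp: "l2_norm y \<le> p" unfolding y_def p_def using ind[OF I(1) e] e1 by simp
  have p: "0 < p"
  proof (rule ccontr)
    assume "\<not> 0 < p"
    then have "y = 0\<^sub>v n" using yp y by (intro zero) auto
    then have "S *\<^sub>v y = 0\<^sub>v n" using S by auto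
    then show False using Sy e1 z0 by simp
  qed
  have sm: "l2_norm (k \<cdot>\<^sub>v x) = \<bar>k\<bar> * l2_norm x" for k x
    by (simp add: l2_norm_def power_mult_distrib real_sqrt_mult flip: sum_distrib_left)
  have "l2_norm (S *\<^sub>v ((1 / p) \<cdot>\<^sub>v y)) \<le> induced_norm l2_norm S"
    using yp p y by (intro ind[OF S]) (auto simp: sm divide_le_eq)
  moreover have "S *\<^sub>v ((1 / p) \<cdot>\<^sub>v y) = (1 / p) \<cdot>\<^sub>v e"
    using mult_mat_vec[OF S y] Sy by simp
  ultimately have "1 / p \<le> induced_norm l2_norm S" using p e1 by (simp add: sm)
  then have "1 \<le> induced_norm l2_norm S * p" using p by (simp add: divide_le_eq)
  then show "1 \<le> cond_number S" by (simp add: cond_number_def p_def)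
  have "cond_number S \<le> c * 4"
    unfolding cond_number_def using nS nI c p by (intro mult_mono) (auto simp: p_def)
  then show "cond_number S \<le> 4 * c" by simp
qed

section \<open>The resolvent of a nonnegative matrix\<close>

text \<open>Boundedness of the powers, not their decay, is what
  \<open>inverse_one_minus_nonneg\<close> draws from the spectral radius; no Neumann series has to
  be summed.\<close>

lemma bounded_powers:
  fixes A :: "real Matrix.mat"
  assumes A: "A \<in> carrier_mat n n" and sr: "spectral_radius (map_mat complex_of_real A) < 1"
  obtains c where "\<And>k i j. i < n \<Longrightarrow> j < n \<Longrightarrow> \<bar>(A ^\<^sub>m k) $$ (i, j)\<bar> \<le> c"
proof -
  let ?A = "map_mat complex_of_real A"
  have A': "?A \<in> carrier_mat n n" using A by simp
  obtain c where c: "norm_bound (?A ^\<^sub>m k) c" for k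
    using spectral_radius_jnf_norm_bound_less_1_upper_triangular[OF A' sr] by blast
  have "\<bar>(A ^\<^sub>m k) $$ (i, j)\<bar> \<le> c" if "i < n" "j < n" for k i j
  proof -
    have "?A ^\<^sub>m k = map_mat complex_of_real (A ^\<^sub>m k)"
      by (rule of_real_hom.mat_hom_pow[OF A, symmetric])
    then show ?thesis using c[of k] that A pow_carrier_mat[OF A, of k] unfolding norm_bound_def by auto
  qed
  then show thesis by (rule that)
qed

lemma one_minus_injective:
  fixes A :: "real Matrix.mat"
  assumes A: "A \<in> carrier_mat n n" and n: "0 < n" and sr: "spectral_radius (map_mat complex_of_real A) < 1"
    and v: "v \<in> carrier_vec n" "(1\<^sub>m n - A) *\<^sub>v v = 0\<^sub>v n"
  shows "v = 0\<^sub>v n"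
proof (rule ccontr)
  assume v0: "v \<noteq> 0\<^sub>v n"
  have Av: "A *\<^sub>v v = v"
  proof (rule eq_vecI)
    fix i assume "i < dim_vec v"
    then have i: "i < n" using v by simp
    have "vec_index ((1\<^sub>m n - A) *\<^sub>v v) i = vec_index v i - vec_index (A *\<^sub>v v) i"
      using A v i by (subst minus_mult_distrib_mat_vec[of _ n n]) auto
    then show "vec_index (A *\<^sub>v v) i = vec_index v i" using v(2) i by simp
  qed (use A v in simp)
  let ?A = "map_mat complex_of_real A" and ?v = "map_vec complex_of_real v"
  have "?A *\<^sub>v ?v = ?v" using of_real_hom.mult_mat_vec_hom[OF A v(1)] unfolding Av by (rule sym)
  moreover have "?v \<noteq> 0\<^sub>v n"
  proof
    assume "?v = 0\<^sub>v n"
    then have "vec_index ?v i = 0" if "i < n" for i using that by simp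
    then have "v = 0\<^sub>v n" using v(1) by (intro eq_vecI) auto
    then show False using v0 by simp
  qed
  ultimately have "eigenvalue ?A 1"
    unfolding eigenvalue_def eigenvector_def using A v(1) by (intro exI[of _ ?v]) auto
  then have "norm (1 :: complex) \<in> norm ` spectrum ?A" unfolding spectrum_def by blast
  then have "norm (1 :: complex) \<le> spectral_radius ?A"
    using A n by (intro spectral_radius_mem_max(2)[of _ n]) auto
  then show False using sr by simp
qed

text \<open>With \<open>x = B b\<close> and \<open>z = B x\<close>, the vectors \<open>A\<^sup>k x\<close> decrease in \<open>k\<close> while their partial
  sums \<open>z - A\<^sup>N z\<close> stay bounded, so \<open>x\<close> has no negative entry.\<close>

lemma inverse_one_minus_nonneg:
  fixes A :: "real Matrix.mat"
  assumes A: "A \<in> carrier_mat n n" and nn: "\<And>i j. i < n \<Longrightarrow> j < n \<Longrightarrow> 0 \<le> A $$ (i, j)"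
    and sr: "spectral_radius (map_mat complex_of_real A) < 1"
    and B: "B \<in> carrier_mat n n" "(1\<^sub>m n - A) * B = 1\<^sub>m n"
    and i: "i < n" and l: "l < n"
  shows "0 \<le> B $$ (i, l)"
proof -
  define p where "p k i j = (A ^\<^sub>m k) $$ (i, j)" for k i j
  define P where "P k f i = (\<Sum>j<n. p k i j * f j)" for k and f :: "nat \<Rightarrow> real" and i
  have Ak: "A ^\<^sub>m k \<in> carrier_mat n n" for k using A by (rule pow_carrier_mat)
  have pS: "p (Suc k) i j = (\<Sum>m<n. p k i m * A $$ (m, j))" if "i < n" "j < n" for k i j
    using Ak[of k] A that by (simp add: p_def scalar_prod_def atLeast0LessThan)
  have p0: "p 0 i j = (if i = j then 1 else 0)" if "i < n" "j < n" for i j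
    using A that by (simp add: p_def)
  have pn: "0 \<le> p k i j" if "i < n" "j < n" for k i j
    using that
  proof (induction k arbitrary: j)
    case (Suc k) then show ?case unfolding pS[OF Suc.prems] by (intro sum_nonneg mult_nonneg_nonneg nn) auto
  qed (simp add: p0)
  obtain c where c: "\<bar>p k i j\<bar> \<le> c" if "i < n" "j < n" for k i j
    using bounded_powers[OF A sr] unfolding p_def by metis
  have PA: "P (Suc k) f i = P k (\<lambda>m. \<Sum>j<n. A $$ (m, j) * f j) i" if "i < n" for k f i
  proof -
    have "P (Suc k) f i = (\<Sum>j<n. \<Sum>m<n. p k i m * (A $$ (m, j) * f j))"
      unfolding P_def using pS that by (intro sum.cong) (simp_all add: sum_distrib_right mult.assoc)
    also have "\<dots> = P k (\<lambda>m. \<Sum>j<n. A $$ (m, j) * f j) i"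
      unfolding P_def sum_distrib_left by (rule sum.swap)
    finally show ?thesis .
  qed
  have telescope: "P (Suc k) f i = P k f i - P k g i"
    if "i < n" "\<And>m. m < n \<Longrightarrow> (\<Sum>j<n. A $$ (m, j) * f j) = f m - g m" for k f g i
    unfolding PA[OF that(1)] unfolding P_def sum_subtractf[symmetric] using that(2)
    by (intro sum.cong) (simp_all add: right_diff_distrib)
  have Beq: "(\<Sum>m<n. A $$ (i, m) * B $$ (m, j)) = B $$ (i, j) - (if i = j then 1 else 0)"
    if "i < n" "j < n" for i j
  proof -
    have "(1\<^sub>m n - A) * B = B - A * B" using A B by (simp add: minus_mult_distrib_mat[of _ n n])
    then have "(B - A * B) $$ (i, j) = (1\<^sub>m n) $$ (i, j)" using B by simp
    then show ?thesis using that A B by (simp add: scalar_prod_def atLeast0LessThan)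
  qed
  define x where "x m = B $$ (m, l)" for m
  define z where "z m = (\<Sum>j<n. B $$ (m, j) * x j)" for m
  have Ax: "(\<Sum>j<n. A $$ (m, j) * x j) = x m - (if m = l then 1 else 0)" if "m < n" for m
    unfolding x_def using Beq[OF that l] by simp
  have Az: "(\<Sum>j<n. A $$ (m, j) * z j) = z m - x m" if m: "m < n" for m
  proof -
    have "(\<Sum>j<n. A $$ (m, j) * z j) = (\<Sum>q<n. (\<Sum>j<n. A $$ (m, j) * B $$ (j, q)) * x q)"
      unfolding z_def sum_distrib_left sum_distrib_right by (subst sum.swap) (simp add: mult.assoc)
    also have "\<dots> = (\<Sum>q<n. B $$ (m, q) * x q - (if m = q then x q else 0))"
      using m by (intro sum.cong) (simp_all add: Beq left_diff_distrib)
    also have "\<dots> = z m - x m" using m by (simp add: sum_subtractf z_def)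
    finally show ?thesis .
  qed
  \<comment> \<open>\<open>A\<close> maps \<open>x\<close> to \<open>x\<close> minus a unit vector,
    so each further power subtracts an entry of a nonnegative matrix.\<close>
  have dec: "P k x i \<le> x i" for k
  proof (induction k)
    case 0 show ?case using i by (simp add: P_def p0 if_distrib[of "\<lambda>t. t * _"] cong: if_cong)
  next
    case (Suc k)
    have "0 \<le> P k (\<lambda>m. if m = l then 1 else 0) i"
      unfolding P_def using i pn by (intro sum_nonneg) auto
    then show ?case using Suc telescope[OF i Ax, of k] by simp
  qed
  have part: "(\<Sum>k<N. P k x i) = P 0 z i - P N z i" for N
    by (induction N) (simp_all add: telescope[OF i Az])
  have bd: "\<bar>P N z i\<bar> \<le> (\<Sum>j<n. c * \<bar>z j\<bar>)" for N
    unfolding P_def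
  proof (rule order_trans[OF sum_abs sum_mono])
    fix j assume "j \<in> {..<n}"
    then show "\<bar>p N i j * z j\<bar> \<le> c * \<bar>z j\<bar>" using c[OF i, of j N] by (simp add: abs_mult mult_right_mono)
  qed
  show ?thesis
  proof (rule ccontr)
    assume "\<not> ?thesis"
    then have neg: "x i < 0" by (simp add: x_def)
    \<comment> \<open>If \<open>x i\<close> were negative, the partial sums would fall below every
      bound, whereas telescoping keeps them within twice the bound in \<open>bd\<close>.\<close>
    obtain N :: nat where N: "2 * (\<Sum>j<n. c * \<bar>z j\<bar>) < real N * (- x i)"
      using reals_Archimedean3[of "- x i"] neg by auto
    have "P 0 z i - P N z i \<le> real N * x i"
      unfolding part[symmetric] using sum_bounded_above[of "{..<N}" "\<lambda>k. P k x i" "x i"] dec by simp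
    then show False using bd[of 0] bd[of N] N by (simp add: abs_le_iff)
  qed
qed

text \<open>\<open>rs\<close> and \<open>ls\<close> are the row and column sums of the inverse
  \<open>B\<close>. Their equations come from B = I + A B = I + B A, and nonnegativity of
  \<open>B\<close> makes both at least 1.\<close>

lemma mmatrix_weights:
  fixes A :: "real Matrix.mat"
  assumes A: "A \<in> carrier_mat n n" and n: "0 < n" and nn: "\<And>i j. i < n \<Longrightarrow> j < n \<Longrightarrow> 0 \<le> A $$ (i, j)"
    and sr: "spectral_radius (map_mat complex_of_real A) < 1"
    and K: "induced_norm linf_norm (inverse_mat (1\<^sub>m n - A)) \<le> K" "induced_norm l1_norm (inverse_mat (1\<^sub>m n - A)) \<le> K"
  obtains rs ls where "mmatrix n (\<lambda>i j. A $$ (i, j)) K rs ls"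
proof -
  define B where "B = inverse_mat (1\<^sub>m n - A)"
  have I: "1\<^sub>m n - A \<in> carrier_mat n n" by (rule minus_carrier_mat[OF A])
  note inv = inverse_mat_props[OF I one_minus_injective[OF A n sr], folded B_def]
  have Bn: "0 \<le> B $$ (i, j)" if "i < n" "j < n" for i j
    by (rule inverse_one_minus_nonneg[OF A nn sr inv(1,2) that])
  have e1: "B $$ (i, j) = (if i = j then 1 else 0) + (\<Sum>m<n. A $$ (i, m) * B $$ (m, j))"
    and e2: "B $$ (i, j) = (if i = j then 1 else 0) + (\<Sum>m<n. B $$ (i, m) * A $$ (m, j))" if "i < n" "j < n" for i j
  proof -
    have "(1\<^sub>m n - A) * B = B - A * B" "B * (1\<^sub>m n - A) = B - B * A"
      using A inv(1) by (simp_all add: minus_mult_distrib_mat[of _ n n] mult_minus_distrib_mat[of _ n n _ n])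
    then have "(B - A * B) $$ (i, j) = (1\<^sub>m n) $$ (i, j)" "(B - B * A) $$ (i, j) = (1\<^sub>m n) $$ (i, j)"
      using inv by simp_all
    then show "B $$ (i, j) = (if i = j then 1 else 0) + (\<Sum>m<n. A $$ (i, m) * B $$ (m, j))"
      "B $$ (i, j) = (if i = j then 1 else 0) + (\<Sum>m<n. B $$ (i, m) * A $$ (m, j))"
      using that A inv(1) by (simp_all add: scalar_prod_def atLeast0LessThan)
  qed
  define rs where "rs i = (\<Sum>j<n. B $$ (i, j))" for i
  define ls where "ls j = (\<Sum>i<n. B $$ (i, j))" for j
  have rs: "rs i = 1 + mv n (\<lambda>i j. A $$ (i, j)) rs i" if i: "i < n" for i
  proof -
    have "rs i = (\<Sum>j<n. (if i = j then 1 else 0) + (\<Sum>m<n. A $$ (i, m) * B $$ (m, j)))"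
      unfolding rs_def using e1[OF i] by (intro sum.cong) auto
    also have "\<dots> = 1 + (\<Sum>j<n. \<Sum>m<n. A $$ (i, m) * B $$ (m, j))" using i by (simp add: sum.distrib)
    also have "(\<Sum>j<n. \<Sum>m<n. A $$ (i, m) * B $$ (m, j)) = mv n (\<lambda>i j. A $$ (i, j)) rs i"
      unfolding mv_def rs_def sum_distrib_left by (rule sum.swap)
    finally show ?thesis .
  qed
  have ls: "ls j = 1 + mv n (\<lambda>i j. A $$ (j, i)) ls j" if j: "j < n" for j
  proof -
    have "ls j = (\<Sum>i<n. (if i = j then 1 else 0) + (\<Sum>m<n. B $$ (i, m) * A $$ (m, j)))"
      unfolding ls_def using e2[OF _ j] by (intro sum.cong) auto
    also have "\<dots> = 1 + (\<Sum>i<n. \<Sum>m<n. B $$ (i, m) * A $$ (m, j))" using j by (simp add: sum.distrib)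
    also have "(\<Sum>i<n. \<Sum>m<n. B $$ (i, m) * A $$ (m, j)) = mv n (\<lambda>i j. A $$ (j, i)) ls j"
      unfolding mv_def ls_def sum_distrib_left by (subst sum.swap) (simp add: mult.commute)
    finally show ?thesis .
  qed
  have pos: "0 \<le> rs i" "0 \<le> ls i" if "i < n" for i
    unfolding rs_def ls_def using Bn that by (auto intro!: sum_nonneg)
  show thesis
  proof (rule that, unfold_locales)
    fix i assume i: "i < n"
    show "1 \<le> rs i" unfolding rs[OF i] mv_def using nn pos i by (auto intro!: sum_nonneg mult_nonneg_nonneg)
    show "1 \<le> ls i" unfolding ls[OF i] mv_def using nn pos i by (auto intro!: sum_nonneg mult_nonneg_nonneg)
    have "rs i \<le> (\<Sum>j<n. \<bar>B $$ (i, j)\<bar>)" unfolding rs_def by (intro sum_mono) auto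
    then show "rs i \<le> K" using row_sum_le_induced[OF inv(1) i] K(1) unfolding B_def by linarith
    have "ls i \<le> (\<Sum>j<n. \<bar>B $$ (j, i)\<bar>)" unfolding ls_def by (intro sum_mono) auto
    then show "ls i \<le> K" using col_sum_le_induced[OF inv(1) i] K(2) unfolding B_def by linarith
  qed (use rs ls nn in auto)
qed

section \<open>Randomised Richardson iteration\<close>

type_synonym 'w solver = "'w \<Rightarrow> real Matrix.mat \<Rightarrow> real \<Rightarrow> real Matrix.vec \<Rightarrow> real Matrix.vec"

text \<open>Multiplying the inverse of the scaled matrix by \<open>l\<close> and \<open>r\<close>
  gives back the inverse of \<open>I - a / (1 + \<alpha>)\<close>. This is thus Richardson's step
  for \<alpha>/2 preconditioned by the matrix for \<alpha>, expressed through the matrix that the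
  oracle accepts.\<close>

definition rstep :: "'w solver \<Rightarrow> real \<Rightarrow> nat \<Rightarrow> (nat \<Rightarrow> nat \<Rightarrow> real) \<Rightarrow> real \<Rightarrow> (nat \<Rightarrow> real) \<Rightarrow> (nat \<Rightarrow> real)
    \<Rightarrow> (nat \<Rightarrow> real) \<Rightarrow> 'w \<Rightarrow> nat \<Rightarrow> real" where
  "rstep slv \<delta> n a \<alpha> l r x w i = x i + r i *
     vec_index (slv w (Matrix.mat n n (\<lambda>(i, j). scaled a \<alpha> l r i j)) \<delta>
       (Matrix.vec n (\<lambda>i. l i * resid n a (1 / (1 + \<alpha> / 2)) x i))) i"

fun riter :: "'w solver \<Rightarrow> real \<Rightarrow> nat \<Rightarrow> (nat \<Rightarrow> nat \<Rightarrow> real) \<Rightarrow> real \<Rightarrow> (nat \<Rightarrow> real) \<Rightarrow> (nat \<Rightarrow> real)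
    \<Rightarrow> (nat \<Rightarrow> 'w) \<Rightarrow> nat \<Rightarrow> nat \<Rightarrow> real" where
  "riter slv \<delta> n a \<alpha> l r \<sigma> 0 = (\<lambda>_. 0)"
| "riter slv \<delta> n a \<alpha> l r \<sigma> (Suc k) = rstep slv \<delta> n a \<alpha> l r (riter slv \<delta> n a \<alpha> l r \<sigma> k) (\<sigma> k)"

lemma riter_cong: "(\<And>i. i < k \<Longrightarrow> \<sigma> i = \<tau> i) \<Longrightarrow> riter slv \<delta> n a \<alpha> l r \<sigma> k = riter slv \<delta> n a \<alpha> l r \<tau> k"
  by (induction k) auto

text \<open>The two iterations use the even and the odd seeds of a block, in the order in which the
  program alternates them. A rejected pair of candidates changes nothing, so a certified triple
  stays certified for every seed sequence; chance decides only whether \<alpha> is halved.\<close>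

definition phase :: "'w solver \<Rightarrow> real \<Rightarrow> nat \<Rightarrow> (nat \<Rightarrow> nat \<Rightarrow> real) \<Rightarrow> nat \<Rightarrow> (nat \<Rightarrow> 'w)
    \<Rightarrow> real \<times> (nat \<Rightarrow> real) \<times> (nat \<Rightarrow> real) \<Rightarrow> real \<times> (nat \<Rightarrow> real) \<times> (nat \<Rightarrow> real)" where
  "phase slv \<delta> n a k \<sigma> = (\<lambda>(\<alpha>, l, r).
     let x = riter slv \<delta> n a \<alpha> l r (\<lambda>i. \<sigma> (2 * i)) k;
         y = riter slv \<delta> n (tr a) \<alpha> r l (\<lambda>i. \<sigma> (2 * i + 1)) k
     in if certified n a (\<alpha> / 2) x \<and> certified n (tr a) (\<alpha> / 2) y then (\<alpha> / 2, y, x) else (\<alpha>, l, r))"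

fun phases :: "'w solver \<Rightarrow> real \<Rightarrow> nat \<Rightarrow> (nat \<Rightarrow> nat \<Rightarrow> real) \<Rightarrow> nat \<Rightarrow> real \<Rightarrow> (nat \<Rightarrow> 'w) \<Rightarrow> nat
    \<Rightarrow> real \<times> (nat \<Rightarrow> real) \<times> (nat \<Rightarrow> real)" where
  "phases slv \<delta> n a k \<alpha>\<^sub>0 \<sigma> 0 = (\<alpha>\<^sub>0, \<lambda>_. 1, \<lambda>_. 1)"
| "phases slv \<delta> n a k \<alpha>\<^sub>0 \<sigma> (Suc j) =
     phase slv \<delta> n a k (\<lambda>i. \<sigma> (2 * k * j + i)) (phases slv \<delta> n a k \<alpha>\<^sub>0 \<sigma> j)"

lemma phase_cong: "(\<And>i. i < 2 * k \<Longrightarrow> \<sigma> i = \<tau> i) \<Longrightarrow> phase slv \<delta> n a k \<sigma> = phase slv \<delta> n a k \<tau>"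
proof -
  assume eq: "\<And>i. i < 2 * k \<Longrightarrow> \<sigma> i = \<tau> i"
  have "riter slv \<delta> n a \<alpha> l r (\<lambda>i. \<sigma> (2 * i)) k = riter slv \<delta> n a \<alpha> l r (\<lambda>i. \<tau> (2 * i)) k"
    "riter slv \<delta> n (tr a) \<alpha> r l (\<lambda>i. \<sigma> (2 * i + 1)) k = riter slv \<delta> n (tr a) \<alpha> r l (\<lambda>i. \<tau> (2 * i + 1)) k" for \<alpha> l r
    using eq by (auto intro!: riter_cong)
  then show ?thesis by (simp add: phase_def)
qed

lemma phases_cong:
  "(\<And>i. i < 2 * k * j \<Longrightarrow> \<sigma> i = \<tau> i) \<Longrightarrow> phases slv \<delta> n a k \<alpha>\<^sub>0 \<sigma> j = phases slv \<delta> n a k \<alpha>\<^sub>0 \<tau> j"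
proof (induction j)
  case (Suc j)
  have "phase slv \<delta> n a k (\<lambda>i. \<sigma> (2 * k * j + i)) = phase slv \<delta> n a k (\<lambda>i. \<tau> (2 * k * j + i))"
    using Suc.prems by (intro phase_cong) (auto simp: algebra_simps)
  then show ?case using Suc by simp
qed simp

text \<open>Redrawing one coordinate does not change a product measure. Applied to the coordinate
  that the next step reads, this integrates out a fresh seed and takes the place of conditional
  expectations.\<close>

lemma resample:
  assumes M: "prob_space M" and f: "f \<in> borel_measurable (\<Pi>\<^sub>M k\<in>(UNIV :: 'i set). M)"
  shows "(\<integral>\<^sup>+ \<omega>. f \<omega> \<partial>(\<Pi>\<^sub>M k\<in>(UNIV :: 'i set). M)) = (\<integral>\<^sup>+ \<omega>. (\<integral>\<^sup>+ w. f (fun_upd \<omega> k w) \<partial>M) \<partial>(\<Pi>\<^sub>M k\<in>(UNIV :: 'i set). M))"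
proof -
  let ?S = "\<Pi>\<^sub>M k\<in>(UNIV :: 'i set). M"
  interpret M: prob_space M by fact
  interpret S: prob_space ?S by (rule prob_space_PiM) (rule M)
  interpret pair_sigma_finite M ?S by unfold_locales
  have upd: "(\<lambda>(x, X). X(k := x)) \<in> measurable (M \<Otimes>\<^sub>M ?S) ?S"
    unfolding split_beta' by (rule measurable_fun_upd[where J = UNIV]) auto
  have d: "distr (M \<Otimes>\<^sub>M ?S) ?S (\<lambda>(x, X). X(k := x)) = ?S"
    using distr_pair_PiM_eq_PiM[of UNIV "\<lambda>_. M" k] M by simp
  have "(\<integral>\<^sup>+ \<omega>. f \<omega> \<partial>?S) = (\<integral>\<^sup>+ \<omega>. f \<omega> \<partial>distr (M \<Otimes>\<^sub>M ?S) ?S (\<lambda>(x, X). X(k := x)))" by (simp only: d)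
  also have "\<dots> = (\<integral>\<^sup>+ p. f ((\<lambda>(x, X). X(k := x)) p) \<partial>(M \<Otimes>\<^sub>M ?S))"
    by (rule nn_integral_distr[OF upd]) (simp add: f)
  also have "\<dots> = (\<integral>\<^sup>+ \<omega>. (\<integral>\<^sup>+ w. f ((\<lambda>(x, X). X(k := x)) (w, \<omega>)) \<partial>M) \<partial>?S)"
    by (rule nn_integral_snd[symmetric]) (rule measurable_compose[OF upd f])
  finally show ?thesis by simp
qed

definition accuracy :: "real \<Rightarrow> real" where "accuracy K = 1 / (216 * K ^ 3)"

locale scaling = mmatrix n a K rs ls for n a K rs ls +
  fixes M :: "'w measure" and slv :: "'w solver"
  assumes n_pos: "0 < n" and solver: "rcdd_solver M slv"
begin

abbreviation \<delta> :: real where "\<delta> \<equiv> accuracy K"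

abbreviation seeds :: "(nat \<Rightarrow> 'w) measure" where "seeds \<equiv> \<Pi>\<^sub>M k\<in>(UNIV :: nat set). M"

lemma transposed_scaling: "scaling n (tr a) K ls rs M slv"
  using transposed n_pos solver by (simp add: scaling_def scaling_axioms_def)

lemma K1: "1 \<le> K" by (rule K_ge_1[OF n_pos])

lemma delta_pos: "0 < \<delta>" using K1 by (simp add: accuracy_def)

lemma prob_M: "prob_space M" using solver by (simp add: rcdd_solver_def)

sublocale M: prob_space M by (rule prob_M)

sublocale S: prob_space seeds by (rule prob_space_PiM) (rule prob_M)

lemma scaled_admissible:
  assumes "0 \<le> \<alpha>" "certified n a \<alpha> r" "certified n (tr a) \<alpha> l"
  shows "admissible n (Matrix.mat n n (\<lambda>(i, j). scaled a \<alpha> l r i j))"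
    "1 \<le> cond_number (Matrix.mat n n (\<lambda>(i, j). scaled a \<alpha> l r i j))"
    "cond_number (Matrix.mat n n (\<lambda>(i, j). scaled a \<alpha> l r i j)) \<le> 18 * K\<^sup>2"
  using dominant_admissible[OF n_pos, of "scaled a \<alpha> l r" "9 / 2 * K\<^sup>2"]
    scaled_row[OF assms] scaled_col[OF assms] by auto

text \<open>\<open>rcdd_solver\<close> makes the operator measurable only on admissible instances.
  Certification at every point of the space keeps the arguments inside that region.\<close>

lemma rstep_measurable:
  assumes u: "u \<in> measurable N M"
    and m: "\<alpha> \<in> borel_measurable N" "\<And>i. i < n \<Longrightarrow> (\<lambda>\<omega>. l \<omega> i) \<in> borel_measurable N"
      "\<And>i. i < n \<Longrightarrow> (\<lambda>\<omega>. r \<omega> i) \<in> borel_measurable N" "\<And>i. i < n \<Longrightarrow> (\<lambda>\<omega>. x \<omega> i) \<in> borel_measurable N"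
    and c: "\<And>\<omega>. \<omega> \<in> space N \<Longrightarrow> 0 \<le> \<alpha> \<omega> \<and> certified n a (\<alpha> \<omega>) (r \<omega>) \<and> certified n (tr a) (\<alpha> \<omega>) (l \<omega>)"
    and i: "i < n"
  shows "(\<lambda>\<omega>. rstep slv \<delta> n a (\<alpha> \<omega>) (l \<omega>) (r \<omega>) (x \<omega>) (u \<omega>) i) \<in> borel_measurable N"
proof -
  define s where "s \<omega> = (\<lambda>ij\<in>{..<n} \<times> {..<n}. scaled a (\<alpha> \<omega>) (l \<omega>) (r \<omega>) (fst ij) (snd ij))" for \<omega>
  define b where "b \<omega> = (\<lambda>k\<in>{..<n}. l \<omega> k * resid n a (1 / (1 + \<alpha> \<omega> / 2)) (x \<omega>) k)" for \<omega>
  have mat: "Matrix.mat n n (s \<omega>) = Matrix.mat n n (\<lambda>(i, j). scaled a (\<alpha> \<omega>) (l \<omega>) (r \<omega>) i j)" for \<omega>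
    by (rule eq_matI) (auto simp: s_def)
  have vec: "Matrix.vec n (b \<omega>) = Matrix.vec n (\<lambda>i. l \<omega> i * resid n a (1 / (1 + \<alpha> \<omega> / 2)) (x \<omega>) i)" for \<omega>
    by (rule eq_vecI) (auto simp: b_def)
  have mv_m: "(\<lambda>\<omega>. mv n a (x \<omega>) i) \<in> borel_measurable N" for i
    unfolding mv_def using m by (intro borel_measurable_sum borel_measurable_times) auto
  have s: "s \<in> measurable N (\<Pi>\<^sub>M ij\<in>{..<n} \<times> {..<n}. borel)"
    unfolding s_def[abs_def] scaled_def
    by (rule measurable_restrict) (use m in \<open>auto intro!: borel_measurable_times borel_measurable_diff
      borel_measurable_divide borel_measurable_add\<close>)
  have b: "b \<in> measurable N (\<Pi>\<^sub>M k\<in>{..<n}. borel)"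
    unfolding b_def[abs_def] resid_def
    by (rule measurable_restrict) (use m mv_m in \<open>auto intro!: borel_measurable_times borel_measurable_diff
      borel_measurable_divide borel_measurable_add\<close>)
  let ?P = "M \<Otimes>\<^sub>M (\<Pi>\<^sub>M ij\<in>{..<n} \<times> {..<n}. borel) \<Otimes>\<^sub>M (\<Pi>\<^sub>M k\<in>{..<n}. borel)"
  let ?R = "{(\<omega>, s, x). admissible n (Matrix.mat n n s)}"
  have "(\<lambda>\<omega>. (u \<omega>, s \<omega>, b \<omega>)) \<in> measurable N (restrict_space ?P ?R)"
  proof (rule measurable_restrict_space2)
    show "(\<lambda>\<omega>. (u \<omega>, s \<omega>, b \<omega>)) \<in> space N \<rightarrow> ?R" using scaled_admissible(1) c by (auto simp: mat)
    show "(\<lambda>\<omega>. (u \<omega>, s \<omega>, b \<omega>)) \<in> measurable N ?P" using u s b by (intro measurable_Pair)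
  qed
  moreover have "(\<lambda>(\<omega>, s, x). vec_index (slv \<omega> (Matrix.mat n n s) \<delta> (Matrix.vec n x)) i) \<in> borel_measurable (restrict_space ?P ?R)"
    using solver delta_pos i unfolding rcdd_solver_def by blast
  ultimately have "(\<lambda>\<omega>. vec_index (slv (u \<omega>) (Matrix.mat n n (s \<omega>)) \<delta> (Matrix.vec n (b \<omega>))) i) \<in> borel_measurable N"
    by (drule_tac measurable_compose) (assumption, simp)
  then show ?thesis unfolding rstep_def mat vec using m i by (intro borel_measurable_add borel_measurable_times) auto
qed

lemma riter_measurable:
  assumes u: "\<And>k. (\<lambda>\<omega>. \<sigma> \<omega> k) \<in> measurable N M"
    and m: "\<alpha> \<in> borel_measurable N" "\<And>i. i < n \<Longrightarrow> (\<lambda>\<omega>. l \<omega> i) \<in> borel_measurable N"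
      "\<And>i. i < n \<Longrightarrow> (\<lambda>\<omega>. r \<omega> i) \<in> borel_measurable N"
    and c: "\<And>\<omega>. \<omega> \<in> space N \<Longrightarrow> 0 \<le> \<alpha> \<omega> \<and> certified n a (\<alpha> \<omega>) (r \<omega>) \<and> certified n (tr a) (\<alpha> \<omega>) (l \<omega>)"
    and i: "i < n"
  shows "(\<lambda>\<omega>. riter slv \<delta> n a (\<alpha> \<omega>) (l \<omega>) (r \<omega>) (\<sigma> \<omega>) k i) \<in> borel_measurable N"
  using i
proof (induction k arbitrary: i)
  case (Suc k) then show ?case using m c by (simp only: riter.simps) (intro rstep_measurable u)
qed simp

lemma resid_measurable:
  assumes "\<alpha> \<in> borel_measurable N" "\<And>i. i < n \<Longrightarrow> (\<lambda>\<omega>. x \<omega> i) \<in> borel_measurable N" "i < n"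
  shows "(\<lambda>\<omega>. resid n a (1 / (1 + \<alpha> \<omega> / 2)) (x \<omega>) i) \<in> borel_measurable N"
  unfolding resid_def mv_def using assms
  by (intro borel_measurable_times borel_measurable_diff borel_measurable_divide borel_measurable_add borel_measurable_sum) auto

lemma wnorm_measurable:
  "(\<And>i. i < n \<Longrightarrow> (\<lambda>\<omega>. x \<omega> i) \<in> borel_measurable N) \<Longrightarrow> (\<lambda>\<omega>. wnorm (x \<omega>)) \<in> borel_measurable N"
  unfolding wnorm_def L2_set_def
  by (intro borel_measurable_sqrt[THEN measurable_compose[rotated]] borel_measurable_sum borel_measurable_power borel_measurable_times) auto

text \<open>\<open>richardson_step\<close> contributes 1/2. The right-hand side has Euclidean norm
  at most \<open>3 / 2 * K * sqrt K\<close> times the weighted residual, so the solver adds at most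
  \<open>3 * sqrt K * \<delta>\<close> times that, which is \<open>1 / (48 * K)\<close>. Rounding
  this up to 1/6 gives 2/3.\<close>

lemma rstep_expectation:
  assumes \<alpha>: "0 < \<alpha>" and r: "certified n a \<alpha> r" and l: "certified n (tr a) \<alpha> l"
  shows "(\<integral>\<^sup>+ w. ennreal (wnorm (resid n a (1 / (1 + \<alpha> / 2)) (rstep slv \<delta> n a \<alpha> l r x w))) \<partial>M)
    \<le> ennreal (2 / 3 * wnorm (resid n a (1 / (1 + \<alpha> / 2)) x))"
proof -
  interpret T: mmatrix n "tr a" K ls rs by (rule transposed)
  have \<alpha>0: "0 \<le> \<alpha>" using \<alpha> by simp
  define S where "S = Matrix.mat n n (\<lambda>(i, j). scaled a \<alpha> l r i j)"
  define res where "res = resid n a (1 / (1 + \<alpha> / 2)) x"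
  define b where "b = Matrix.vec n (\<lambda>i. l i * res i)"
  define z where "z w = slv w S \<delta> b" for w
  define err where "err w = l2_norm (b - S *\<^sub>v z w)" for w
  have S: "S \<in> carrier_mat n n" "admissible n S" using scaled_admissible[OF \<alpha>0 r l] by (auto simp: S_def)
  have b: "b \<in> carrier_vec n" by (simp add: b_def)
  have z: "z w \<in> carrier_vec n" if "w \<in> space M" for w
    using solver S(2) delta_pos b that unfolding rcdd_solver_def z_def by blast
  have E: "(\<integral>\<^sup>+ w. ennreal (err w) \<partial>M) \<le> ennreal (\<delta> * l2_norm b)"
    using solver S(2) delta_pos b unfolding rcdd_solver_def err_def z_def by blast
  have lb: "1 / 2 \<le> l i" "l i \<le> 3 / 2 * K" if "i < n" for i using T.certified_bounds[OF \<alpha>0 l that] by auto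
  have Sz: "vec_index (S *\<^sub>v z w) i = l i * (r i * vec_index (z w) i - 1 / (1 + \<alpha>) * mv n a (\<lambda>i. r i * vec_index (z w) i) i)"
    if "w \<in> space M" "i < n" for w i
  proof -
    have "vec_index (S *\<^sub>v z w) i = (\<Sum>j<n. scaled a \<alpha> l r i j * vec_index (z w) j)"
      using that by (subst mult_mat_vec_index[OF S(1) z]) (auto simp: S_def)
    also have "\<dots> = l i * (\<Sum>j<n. ((if i = j then 1 else 0) - 1 / (1 + \<alpha>) * a i j) * (r j * vec_index (z w) j))"
      unfolding scaled_def sum_distrib_left by (simp add: mult.assoc)
    finally show ?thesis
      using sum_kronecker[OF that(2), of "1 / (1 + \<alpha>)" a "\<lambda>j. r j * vec_index (z w) j"] by (simp only:)
  qed
  have errL: "err w = L2_set (\<lambda>i. vec_index (b - S *\<^sub>v z w) i) {..<n}" if "w \<in> space M" for w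
    using S(1) by (simp add: err_def l2_norm_eq)
  \<comment> \<open>Measurability is known for the step as a whole; it passes to the answer of the
    oracle because the step is affine in it with nonzero slope \<open>r i\<close>.\<close>
  have zm: "(\<lambda>w. vec_index (z w) i) \<in> borel_measurable M" if "i < n" for i
  proof -
    have *: "rstep slv \<delta> n a \<alpha> l r x w i = x i + r i * vec_index (z w) i" for w
      by (simp add: rstep_def z_def S_def b_def res_def)
    have "(\<lambda>w. rstep slv \<delta> n a \<alpha> l r x w i) \<in> borel_measurable M"
      by (rule rstep_measurable) (use \<alpha>0 r l that in auto)
    then have "(\<lambda>w. (x i + r i * vec_index (z w) i - x i) / r i) \<in> borel_measurable M"
      unfolding * by (intro borel_measurable_divide borel_measurable_diff) auto
    moreover have "r i \<noteq> 0" using certified_bounds(1)[OF \<alpha>0 r that] by auto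
    ultimately show ?thesis by simp
  qed
  have errm: "err \<in> borel_measurable M"
  proof -
    have "(\<lambda>w. L2_set (\<lambda>i. l i * res i - l i * (r i * vec_index (z w) i - 1 / (1 + \<alpha>) * mv n a (\<lambda>i. r i * vec_index (z w) i) i)) {..<n})
        \<in> borel_measurable M"
      unfolding L2_set_def mv_def using zm
      by (intro borel_measurable_sqrt[THEN measurable_compose[rotated]] borel_measurable_sum borel_measurable_power
        borel_measurable_times borel_measurable_diff) auto
    also have "?this \<longleftrightarrow> err \<in> borel_measurable M"
    proof (rule measurable_cong)
      fix w assume w: "w \<in> space M"
      show "L2_set (\<lambda>i. l i * res i - l i * (r i * vec_index (z w) i - 1 / (1 + \<alpha>) * mv n a (\<lambda>i. r i * vec_index (z w) i) i)) {..<n} = err w"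
        unfolding errL[OF w] using S(1) w by (intro L2_set_cong) (simp_all add: Sz b_def del: index_mult_mat_vec)
    qed
    finally show ?thesis .
  qed
  have err0: "0 \<le> err w" for w by (simp add: err_def l2_norm_eq)
  have "(\<integral>\<^sup>+ w. ennreal (wnorm (resid n a (1 / (1 + \<alpha> / 2)) (rstep slv \<delta> n a \<alpha> l r x w))) \<partial>M)
      \<le> (\<integral>\<^sup>+ w. ennreal (1 / 2 * wnorm res) + ennreal (3 * sqrt K) * ennreal (err w) \<partial>M)"
  proof (rule nn_integral_mono)
    fix w assume w: "w \<in> space M"
    have "rstep slv \<delta> n a \<alpha> l r x w = (\<lambda>i. x i + r i * vec_index (z w) i)"
      by (simp add: fun_eq_iff rstep_def z_def S_def b_def res_def)
    moreover have "wnorm (resid n a (1 / (1 + \<alpha> / 2)) (\<lambda>i. x i + r i * vec_index (z w) i)) \<le> 1 / 2 * wnorm res + 3 * sqrt K * err w"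
      unfolding errL[OF w] res_def
    proof (rule richardson_step[OF n_pos \<alpha> lb(1)])
      fix i assume i: "i < n"
      show "l i * (r i * vec_index (z w) i - 1 / (1 + \<alpha>) * mv n a (\<lambda>i. r i * vec_index (z w) i) i)
          = l i * resid n a (1 / (1 + \<alpha> / 2)) x i - vec_index (b - S *\<^sub>v z w) i"
        unfolding Sz[OF w i, symmetric] using S(1) i by (simp add: b_def res_def del: index_mult_mat_vec)
    qed
    ultimately show "ennreal (wnorm (resid n a (1 / (1 + \<alpha> / 2)) (rstep slv \<delta> n a \<alpha> l r x w)))
        \<le> ennreal (1 / 2 * wnorm res) + ennreal (3 * sqrt K) * ennreal (err w)"
      using K1 err0 wnorm_nonneg by (simp flip: ennreal_plus ennreal_mult)
  qed
  also have "\<dots> = ennreal (1 / 2 * wnorm res) + ennreal (3 * sqrt K) * (\<integral>\<^sup>+ w. ennreal (err w) \<partial>M)"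
    using errm by (subst nn_integral_add) (simp_all add: nn_integral_cmult M.emeasure_space_1)
  also have "\<dots> \<le> ennreal (1 / 2 * wnorm res) + ennreal (3 * sqrt K) * ennreal (\<delta> * l2_norm b)"
    using E by (intro add_left_mono mult_left_mono) auto
  also have "\<dots> = ennreal (1 / 2 * wnorm res + 3 * sqrt K * (\<delta> * l2_norm b))"
    using K1 delta_pos wnorm_nonneg[of res] by (simp add: l2_norm_eq flip: ennreal_plus ennreal_mult)
  also have "\<dots> \<le> ennreal (2 / 3 * wnorm res)"
  proof (rule ennreal_leI)
    have "l2_norm b \<le> L2_set (\<lambda>i. 3 / 2 * K * res i) {..<n}"
      unfolding b_def l2_norm_vec L2_set_def
    proof (intro real_sqrt_le_mono sum_mono)
      fix i assume "i \<in> {..<n}"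
      then have "\<bar>l i * res i\<bar> \<le> \<bar>3 / 2 * K * res i\<bar>"
        using lb[of i] K1 by (simp only: abs_mult) (intro mult_right_mono, auto)
      then show "(l i * res i)\<^sup>2 \<le> (3 / 2 * K * res i)\<^sup>2" unfolding abs_le_square_iff .
    qed
    also have "\<dots> = 3 / 2 * K * L2_set res {..<n}" using K1 by (subst L2_set_right_distrib) simp_all
    also have "\<dots> \<le> 3 / 2 * K * (sqrt K * wnorm res)"
      using K1 by (intro mult_left_mono L2_le_wnorm n_pos) auto
    finally have "3 * sqrt K * (\<delta> * l2_norm b) \<le> 3 * sqrt K * (\<delta> * (3 / 2 * K * (sqrt K * wnorm res)))"
      using K1 delta_pos by (intro mult_left_mono) auto
    also have "\<dots> = (9 / 2 * \<delta> * K) * (sqrt K * sqrt K) * wnorm res" by simp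
    also have "\<dots> = 1 / (48 * K) * wnorm res" using K1 by (simp add: accuracy_def power3_eq_cube field_simps)
    also have "\<dots> \<le> 1 / 6 * wnorm res" using K1 by (intro mult_right_mono wnorm_nonneg frac_le) auto
    finally show "1 / 2 * wnorm res + 3 * sqrt K * (\<delta> * l2_norm b) \<le> 2 / 3 * wnorm res" by simp
  qed
  finally show ?thesis unfolding res_def .
qed

text \<open>\<alpha>, \<open>l\<close> and \<open>r\<close> are themselves random, being left by
  earlier phases, but do not see the seeds listed by \<open>idx\<close>. The expected weighted
  residual starts at \<open>sqrt K * sqrt n\<close> at most and shrinks by 2/3 per step. A failed
  check means an entry above 1/2, hence weighted norm above \<open>1 / (2 * sqrt K)\<close>, and
  Markov's inequality applies.\<close>

lemma riter_failure:
  fixes \<alpha> :: "(nat \<Rightarrow> 'w) \<Rightarrow> real"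
  assumes idx: "inj idx"
    and m: "\<alpha> \<in> borel_measurable seeds" "\<And>i. i < n \<Longrightarrow> (\<lambda>\<omega>. l \<omega> i) \<in> borel_measurable seeds"
      "\<And>i. i < n \<Longrightarrow> (\<lambda>\<omega>. r \<omega> i) \<in> borel_measurable seeds"
    and c: "\<And>\<omega>. \<omega> \<in> space seeds \<Longrightarrow> 0 < \<alpha> \<omega> \<and> certified n a (\<alpha> \<omega>) (r \<omega>) \<and> certified n (tr a) (\<alpha> \<omega>) (l \<omega>)"
    and indep: "\<And>\<omega> k w. \<alpha> (fun_upd \<omega> (idx k) w) = \<alpha> \<omega> \<and> l (fun_upd \<omega> (idx k) w) = l \<omega> \<and> r (fun_upd \<omega> (idx k) w) = r \<omega>"
  defines "it \<equiv> \<lambda>k \<omega>. riter slv \<delta> n a (\<alpha> \<omega>) (l \<omega>) (r \<omega>) (\<lambda>i. \<omega> (idx i)) k"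
  shows "{\<omega> \<in> space seeds. \<not> certified n a (\<alpha> \<omega> / 2) (it k \<omega>)} \<in> sets seeds"
    and "measure seeds {\<omega> \<in> space seeds. \<not> certified n a (\<alpha> \<omega> / 2) (it k \<omega>)} \<le> 2 * K * sqrt n * (2 / 3) ^ k"
proof -
  have itm: "(\<lambda>\<omega>. it k \<omega> i) \<in> borel_measurable seeds" if "i < n" for k i
    unfolding it_def by (rule riter_measurable) (use m c that in \<open>auto simp: less_imp_le\<close>)
  have resm: "(\<lambda>\<omega>. resid n a (1 / (1 + \<alpha> \<omega> / 2)) (it k \<omega>) i) \<in> borel_measurable seeds" if "i < n" for k i
    by (rule resid_measurable[OF m(1) itm that])
  define D where "D k \<omega> = ennreal (wnorm (resid n a (1 / (1 + \<alpha> \<omega> / 2)) (it k \<omega>)))" for k \<omega>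
  have Dm: "D k \<in> borel_measurable seeds" for k
    unfolding D_def[abs_def] using wnorm_measurable[OF resm] by simp
  show *: "{\<omega> \<in> space seeds. \<not> certified n a (\<alpha> \<omega> / 2) (it k \<omega>)} \<in> sets seeds"
  proof -
    have "{\<omega> \<in> space seeds. \<not> certified n a (\<alpha> \<omega> / 2) (it k \<omega>)} =
      (\<Union>i\<in>{..<n}. {\<omega> \<in> space seeds. \<not> \<bar>resid n a (1 / (1 + \<alpha> \<omega> / 2)) (it k \<omega>) i\<bar> \<le> 1 / 2})"
      by (auto simp: certified_def)
    also have "\<dots> \<in> sets seeds"
      by (intro sets.finite_UN) (use resm in \<open>auto simp: not_le intro!: borel_measurable_less borel_measurable_abs\<close>)
    finally show ?thesis .
  qed
  \<comment> \<open>The first \<open>k\<close> steps read only the seeds \<open>idx i\<close> with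
    \<open>i < k\<close>, and \<open>idx\<close> is injective.\<close>
  have same: "it k (fun_upd \<omega> (idx k) w) = it k \<omega>" for k \<omega> w
    unfolding it_def using indep[of \<omega> k w] idx
    by (simp add: inj_eq) (rule riter_cong, auto)
  have step: "(\<integral>\<^sup>+ \<omega>. D (Suc k) \<omega> \<partial>seeds) \<le> ennreal (2 / 3) * (\<integral>\<^sup>+ \<omega>. D k \<omega> \<partial>seeds)" for k
  proof -
    have "(\<integral>\<^sup>+ \<omega>. D (Suc k) \<omega> \<partial>seeds) = (\<integral>\<^sup>+ \<omega>. (\<integral>\<^sup>+ w. D (Suc k) (fun_upd \<omega> (idx k) w) \<partial>M) \<partial>seeds)"
      by (rule resample[OF prob_M Dm])
    also have "\<dots> \<le> (\<integral>\<^sup>+ \<omega>. ennreal (2 / 3) * D k \<omega> \<partial>seeds)"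
    proof (rule nn_integral_mono)
      fix \<omega> assume \<omega>: "\<omega> \<in> space seeds"
      have "D (Suc k) (fun_upd \<omega> (idx k) w) = ennreal (wnorm (resid n a (1 / (1 + \<alpha> \<omega> / 2))
          (rstep slv \<delta> n a (\<alpha> \<omega>) (l \<omega>) (r \<omega>) (it k \<omega>) w)))" for w
        using same[of k \<omega> w] indep[of \<omega> k w] unfolding D_def it_def by simp
      then show "(\<integral>\<^sup>+ w. D (Suc k) (fun_upd \<omega> (idx k) w) \<partial>M) \<le> ennreal (2 / 3) * D k \<omega>"
        using rstep_expectation[of "\<alpha> \<omega>" "r \<omega>" "l \<omega>" "it k \<omega>"] c[OF \<omega>] wnorm_nonneg
        by (simp add: D_def flip: ennreal_mult)
    qed
    also have "\<dots> = ennreal (2 / 3) * (\<integral>\<^sup>+ \<omega>. D k \<omega> \<partial>seeds)" using Dm by (rule nn_integral_cmult)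
    finally show ?thesis .
  qed
  have "D 0 \<omega> \<le> ennreal (sqrt K * sqrt n)" for \<omega>
  proof -
    have "resid n a (1 / (1 + \<alpha> \<omega> / 2)) (it 0 \<omega>) = (\<lambda>_. 1)"
      by (simp add: it_def resid_def mv_def fun_eq_iff)
    moreover have "wnorm (\<lambda>_. 1) \<le> sqrt K * sqrt n"
      using wnorm_le_L2[OF n_pos, of "\<lambda>_. 1"] by (simp add: L2_set_def)
    ultimately show ?thesis unfolding D_def by (simp only: ennreal_leI)
  qed
  then have D0: "(\<integral>\<^sup>+ \<omega>. D 0 \<omega> \<partial>seeds) \<le> ennreal (sqrt K * sqrt n)"
    using nn_integral_mono[of seeds "D 0" "\<lambda>_. ennreal (sqrt K * sqrt n)"] by (simp add: S.emeasure_space_1)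
  have Dk: "(\<integral>\<^sup>+ \<omega>. D k \<omega> \<partial>seeds) \<le> ennreal ((2 / 3) ^ k * (sqrt K * sqrt n))" for k
  proof (induction k)
    case 0 then show ?case using D0 by simp
  next
    case (Suc k)
    have "(\<integral>\<^sup>+ \<omega>. D (Suc k) \<omega> \<partial>seeds) \<le> ennreal (2 / 3) * ennreal ((2 / 3) ^ k * (sqrt K * sqrt n))"
      by (rule order_trans[OF step mult_left_mono[OF Suc]]) simp
    also have "\<dots> = ennreal ((2 / 3) ^ Suc k * (sqrt K * sqrt n))"
      using K1 by (simp add: ac_simps flip: ennreal_mult)
    finally show ?case .
  qed
  define c0 where "c0 = 2 * sqrt K"
  have sub: "{\<omega> \<in> space seeds. \<not> certified n a (\<alpha> \<omega> / 2) (it k \<omega>)} \<subseteq> {\<omega> \<in> space seeds. 1 \<le> ennreal c0 * D k \<omega>}"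
  proof safe
    fix \<omega> assume "\<not> certified n a (\<alpha> \<omega> / 2) (it k \<omega>)"
    then obtain i where i: "i < n" "1 / 2 < \<bar>resid n a (1 / (1 + \<alpha> \<omega> / 2)) (it k \<omega>) i\<bar>"
      by (auto simp: certified_def not_le)
    let ?x = "resid n a (1 / (1 + \<alpha> \<omega> / 2)) (it k \<omega>)"
    have "\<bar>?x i\<bar> \<le> L2_set (\<lambda>i. \<bar>?x i\<bar>) {..<n}" using i by (intro member_le_L2_set) auto
    also have "\<dots> = L2_set ?x {..<n}" by (simp add: L2_set_def)
    also have "\<dots> \<le> sqrt K * wnorm ?x" by (rule L2_le_wnorm[OF n_pos])
    finally have "1 \<le> c0 * wnorm ?x" using i by (simp add: c0_def)
    then have "ennreal 1 \<le> ennreal (c0 * wnorm ?x)" by (rule ennreal_leI)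
    then show "1 \<le> ennreal c0 * D k \<omega>" using K1 wnorm_nonneg by (simp add: D_def c0_def ennreal_mult)
  qed
  have "emeasure seeds {\<omega> \<in> space seeds. \<not> certified n a (\<alpha> \<omega> / 2) (it k \<omega>)}
      \<le> emeasure seeds {\<omega> \<in> space seeds. 1 \<le> ennreal c0 * D k \<omega>}"
    using Dm by (intro emeasure_mono sub) auto
  also have "\<dots> \<le> ennreal c0 * (\<integral>\<^sup>+ \<omega>. D k \<omega> \<partial>seeds)"
    using nn_integral_Markov_inequality[of "D k" "space seeds" seeds "ennreal c0"] Dm by (simp add: nn_set_integral_space)
  also have "\<dots> \<le> ennreal c0 * ennreal ((2 / 3) ^ k * (sqrt K * sqrt n))"
    by (intro mult_left_mono Dk) auto
  also have "\<dots> = ennreal (2 * (sqrt K * sqrt K) * sqrt n * (2 / 3) ^ k)"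
    using K1 by (simp add: c0_def ac_simps flip: ennreal_mult)
  also have "sqrt K * sqrt K = K" using K1 by simp
  finally show "measure seeds {\<omega> \<in> space seeds. \<not> certified n a (\<alpha> \<omega> / 2) (it k \<omega>)} \<le> 2 * K * sqrt n * (2 / 3) ^ k"
    using K1 by (simp add: S.emeasure_eq_measure)
qed

end

text \<open>At the all-one vector the residual is the row sum divided by
  \<open>1 + \<alpha>\<close>, hence at most \<alpha>/2 divided by
  \<open>1 + \<alpha>\<close>.\<close>

lemma certified_one:
  assumes \<alpha>: "0 \<le> \<alpha>" and a: "\<And>i j. i < n \<Longrightarrow> j < n \<Longrightarrow> 0 \<le> a i j" and s: "\<And>i. i < n \<Longrightarrow> 2 * (\<Sum>j<n. a i j) \<le> \<alpha>"
  shows "certified n a \<alpha> (\<lambda>_. 1)"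
  unfolding certified_def
proof (intro allI impI)
  fix i assume i: "i < n"
  have "0 \<le> (\<Sum>j<n. a i j)" using a[OF i] by (intro sum_nonneg) auto
  then show "\<bar>resid n a (1 / (1 + \<alpha>)) (\<lambda>_. 1) i\<bar> \<le> 1 / 2"
    using s[OF i] \<alpha> by (simp add: resid_def mv_def divide_le_eq)
qed

section \<open>Success probability of successive phases\<close>

context scaling
begin

lemma phase_invariant:
  assumes "0 < \<alpha>" "certified n a \<alpha> r" "certified n (tr a) \<alpha> l" and "phase slv \<delta> n a k \<sigma> (\<alpha>, l, r) = (\<alpha>', l', r')"
  shows "0 < \<alpha>'" "certified n a \<alpha>' r'" "certified n (tr a) \<alpha>' l'"
  using assms by (auto simp: phase_def Let_def split: if_splits)

lemma phases_invariant:
  assumes "0 < \<alpha>\<^sub>0" "certified n a \<alpha>\<^sub>0 (\<lambda>_. 1)" "certified n (tr a) \<alpha>\<^sub>0 (\<lambda>_. 1)"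
    and "phases slv \<delta> n a k \<alpha>\<^sub>0 \<sigma> j = (\<alpha>, l, r)"
  shows "0 < \<alpha> \<and> certified n a \<alpha> r \<and> certified n (tr a) \<alpha> l"
  using assms(4)
proof (induction j arbitrary: \<alpha> l r)
  case 0 then show ?case using assms(1-3) by auto
next
  case (Suc j)
  obtain \<alpha>' l' r' where p: "phases slv \<delta> n a k \<alpha>\<^sub>0 \<sigma> j = (\<alpha>', l', r')" by (metis prod_cases3)
  show ?case using Suc.IH[OF p] Suc.prems p phase_invariant[of \<alpha>' r' l'] by auto
qed

context
  fixes \<alpha>\<^sub>0 :: real and k :: nat
begin

definition "phase_at j \<omega> = phases slv \<delta> n a k \<alpha>\<^sub>0 \<omega> j"
definition "alpha_at j \<omega> = fst (phase_at j \<omega>)"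
definition "left_at j \<omega> = fst (snd (phase_at j \<omega>))"
definition "right_at j \<omega> = snd (snd (phase_at j \<omega>))"
definition "right_candidate j \<omega> = riter slv \<delta> n a (alpha_at j \<omega>) (left_at j \<omega>) (right_at j \<omega>) (\<lambda>i. \<omega> (2 * k * j + 2 * i)) k"
definition "left_candidate j \<omega> = riter slv \<delta> n (tr a) (alpha_at j \<omega>) (right_at j \<omega>) (left_at j \<omega>) (\<lambda>i. \<omega> (2 * k * j + 2 * i + 1)) k"

end

context
  fixes \<alpha>\<^sub>0 :: real and k :: nat
  assumes start: "0 < \<alpha>\<^sub>0" "certified n a \<alpha>\<^sub>0 (\<lambda>_. 1)" "certified n (tr a) \<alpha>\<^sub>0 (\<lambda>_. 1)"
begin

lemma phase_at_invariant: "0 < alpha_at \<alpha>\<^sub>0 k j \<omega>" "certified n a (alpha_at \<alpha>\<^sub>0 k j \<omega>) (right_at \<alpha>\<^sub>0 k j \<omega>)" "certified n (tr a) (alpha_at \<alpha>\<^sub>0 k j \<omega>) (left_at \<alpha>\<^sub>0 k j \<omega>)"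
  using phases_invariant[OF start, of k \<omega> j] unfolding alpha_at_def left_at_def right_at_def phase_at_def by (metis prod.collapse)+

lemma phase_at_Suc:
  "alpha_at \<alpha>\<^sub>0 k (Suc j) \<omega> = (if certified n a (alpha_at \<alpha>\<^sub>0 k j \<omega> / 2) (right_candidate \<alpha>\<^sub>0 k j \<omega>) \<and> certified n (tr a) (alpha_at \<alpha>\<^sub>0 k j \<omega> / 2) (left_candidate \<alpha>\<^sub>0 k j \<omega>) then alpha_at \<alpha>\<^sub>0 k j \<omega> / 2 else alpha_at \<alpha>\<^sub>0 k j \<omega>)"
  "left_at \<alpha>\<^sub>0 k (Suc j) \<omega> = (if certified n a (alpha_at \<alpha>\<^sub>0 k j \<omega> / 2) (right_candidate \<alpha>\<^sub>0 k j \<omega>) \<and> certified n (tr a) (alpha_at \<alpha>\<^sub>0 k j \<omega> / 2) (left_candidate \<alpha>\<^sub>0 k j \<omega>) then left_candidate \<alpha>\<^sub>0 k j \<omega> else left_at \<alpha>\<^sub>0 k j \<omega>)"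
  "right_at \<alpha>\<^sub>0 k (Suc j) \<omega> = (if certified n a (alpha_at \<alpha>\<^sub>0 k j \<omega> / 2) (right_candidate \<alpha>\<^sub>0 k j \<omega>) \<and> certified n (tr a) (alpha_at \<alpha>\<^sub>0 k j \<omega> / 2) (left_candidate \<alpha>\<^sub>0 k j \<omega>) then right_candidate \<alpha>\<^sub>0 k j \<omega> else right_at \<alpha>\<^sub>0 k j \<omega>)"
  by (simp_all add: alpha_at_def left_at_def right_at_def phase_at_def phase_def right_candidate_def left_candidate_def Let_def split_beta add.assoc)

text \<open>Block \<open>j\<close> starts at seed \<open>2 * k * j\<close>, and what precedes it
  ignores later seeds. This supplies the hypothesis \<open>indep\<close> of
  \<open>riter_failure\<close>.\<close>

lemma phase_at_indep: "2 * k * j \<le> i \<Longrightarrow> alpha_at \<alpha>\<^sub>0 k j (fun_upd \<omega> i w) = alpha_at \<alpha>\<^sub>0 k j \<omega> \<and> left_at \<alpha>\<^sub>0 k j (fun_upd \<omega> i w) = left_at \<alpha>\<^sub>0 k j \<omega> \<and> right_at \<alpha>\<^sub>0 k j (fun_upd \<omega> i w) = right_at \<alpha>\<^sub>0 k j \<omega>"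
  using phases_cong[of k j "fun_upd \<omega> i w" \<omega> slv \<delta> n a \<alpha>\<^sub>0] by (simp add: alpha_at_def left_at_def right_at_def phase_at_def)

lemma phase_at_measurable:
  "alpha_at \<alpha>\<^sub>0 k j \<in> borel_measurable seeds \<and> (\<forall>i<n. (\<lambda>\<omega>. left_at \<alpha>\<^sub>0 k j \<omega> i) \<in> borel_measurable seeds \<and> (\<lambda>\<omega>. right_at \<alpha>\<^sub>0 k j \<omega> i) \<in> borel_measurable seeds)"
proof (induction j)
  case 0 then show ?case by (simp add: alpha_at_def[abs_def] left_at_def right_at_def phase_at_def)
next
  case (Suc j)
  interpret T: scaling n "tr a" K ls rs M slv by (rule transposed_scaling)
  have x: "(\<lambda>\<omega>. right_candidate \<alpha>\<^sub>0 k j \<omega> i) \<in> borel_measurable seeds" if "i < n" for i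
    unfolding right_candidate_def by (rule riter_measurable) (use Suc that phase_at_invariant[of j] in \<open>auto simp: less_imp_le\<close>)
  have y: "(\<lambda>\<omega>. left_candidate \<alpha>\<^sub>0 k j \<omega> i) \<in> borel_measurable seeds" if "i < n" for i
    unfolding left_candidate_def by (rule T.riter_measurable) (use Suc that phase_at_invariant[of j] in \<open>auto simp: less_imp_le\<close>)
  have cx: "Measurable.pred seeds (\<lambda>\<omega>. certified n a (alpha_at \<alpha>\<^sub>0 k j \<omega> / 2) (right_candidate \<alpha>\<^sub>0 k j \<omega>))"
    unfolding certified_def using resid_measurable[OF conjunct1[OF Suc], of "right_candidate \<alpha>\<^sub>0 k j"] x by measurable
  have cy: "Measurable.pred seeds (\<lambda>\<omega>. certified n (tr a) (alpha_at \<alpha>\<^sub>0 k j \<omega> / 2) (left_candidate \<alpha>\<^sub>0 k j \<omega>))"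
    unfolding certified_def using T.resid_measurable[OF conjunct1[OF Suc], of "left_candidate \<alpha>\<^sub>0 k j"] y by measurable
  have c: "Measurable.pred seeds (\<lambda>\<omega>. certified n a (alpha_at \<alpha>\<^sub>0 k j \<omega> / 2) (right_candidate \<alpha>\<^sub>0 k j \<omega>) \<and> certified n (tr a) (alpha_at \<alpha>\<^sub>0 k j \<omega> / 2) (left_candidate \<alpha>\<^sub>0 k j \<omega>))"
    using cx cy by measurable
  show ?case
    using Suc x y c unfolding phase_at_Suc[abs_def] if_distrib[of "\<lambda>f. f _"]
    by (auto intro!: measurable_If[OF _ _ c[unfolded pred_def]])
qed

lemma phase_failure:
  "{\<omega> \<in> space seeds. alpha_at \<alpha>\<^sub>0 k (Suc j) \<omega> \<noteq> alpha_at \<alpha>\<^sub>0 k j \<omega> / 2} \<in> sets seeds"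
  "measure seeds {\<omega> \<in> space seeds. alpha_at \<alpha>\<^sub>0 k (Suc j) \<omega> \<noteq> alpha_at \<alpha>\<^sub>0 k j \<omega> / 2} \<le> 4 * K * sqrt n * (2 / 3) ^ k"
proof -
  interpret T: scaling n "tr a" K ls rs M slv by (rule transposed_scaling)
  let ?X = "{\<omega> \<in> space seeds. \<not> certified n a (alpha_at \<alpha>\<^sub>0 k j \<omega> / 2) (right_candidate \<alpha>\<^sub>0 k j \<omega>)}"
  let ?Y = "{\<omega> \<in> space seeds. \<not> certified n (tr a) (alpha_at \<alpha>\<^sub>0 k j \<omega> / 2) (left_candidate \<alpha>\<^sub>0 k j \<omega>)}"
  have inj: "inj (\<lambda>i. 2 * k * j + 2 * i)" "inj (\<lambda>i. 2 * k * j + 2 * i + 1)" by (auto simp: inj_def)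
  have m: "alpha_at \<alpha>\<^sub>0 k j \<in> borel_measurable seeds" "\<And>i. i < n \<Longrightarrow> (\<lambda>\<omega>. left_at \<alpha>\<^sub>0 k j \<omega> i) \<in> borel_measurable seeds"
      "\<And>i. i < n \<Longrightarrow> (\<lambda>\<omega>. right_at \<alpha>\<^sub>0 k j \<omega> i) \<in> borel_measurable seeds"
    using phase_at_measurable[of j] by auto
  have c: "0 < alpha_at \<alpha>\<^sub>0 k j \<omega> \<and> certified n a (alpha_at \<alpha>\<^sub>0 k j \<omega>) (right_at \<alpha>\<^sub>0 k j \<omega>) \<and> certified n (tr a) (alpha_at \<alpha>\<^sub>0 k j \<omega>) (left_at \<alpha>\<^sub>0 k j \<omega>)"
    "0 < alpha_at \<alpha>\<^sub>0 k j \<omega> \<and> certified n (tr a) (alpha_at \<alpha>\<^sub>0 k j \<omega>) (left_at \<alpha>\<^sub>0 k j \<omega>) \<and> certified n a (alpha_at \<alpha>\<^sub>0 k j \<omega>) (right_at \<alpha>\<^sub>0 k j \<omega>)" for \<omega>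
    by (simp_all add: phase_at_invariant)
  have ind: "alpha_at \<alpha>\<^sub>0 k j (fun_upd \<omega> (2 * k * j + 2 * i) w) = alpha_at \<alpha>\<^sub>0 k j \<omega> \<and> left_at \<alpha>\<^sub>0 k j (fun_upd \<omega> (2 * k * j + 2 * i) w) = left_at \<alpha>\<^sub>0 k j \<omega>
      \<and> right_at \<alpha>\<^sub>0 k j (fun_upd \<omega> (2 * k * j + 2 * i) w) = right_at \<alpha>\<^sub>0 k j \<omega>"
    "alpha_at \<alpha>\<^sub>0 k j (fun_upd \<omega> (2 * k * j + 2 * i + 1) w) = alpha_at \<alpha>\<^sub>0 k j \<omega> \<and> right_at \<alpha>\<^sub>0 k j (fun_upd \<omega> (2 * k * j + 2 * i + 1) w) = right_at \<alpha>\<^sub>0 k j \<omega>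
      \<and> left_at \<alpha>\<^sub>0 k j (fun_upd \<omega> (2 * k * j + 2 * i + 1) w) = left_at \<alpha>\<^sub>0 k j \<omega>" for \<omega> i w
    using phase_at_indep[of j "2 * k * j + 2 * i" \<omega> w] phase_at_indep[of j "2 * k * j + 2 * i + 1" \<omega> w] by (simp_all only: add.assoc le_add1)
  note X = riter_failure[OF inj(1) m c(1) ind(1), of k, folded right_candidate_def]
  note Y = T.riter_failure[OF inj(2) m(1,3,2) c(2) ind(2), of k, folded left_candidate_def]
  \<comment> \<open>A positive \<alpha> differs from its half, so the phases without halving are
    exactly those that rejected a candidate.\<close>
  have eq: "{\<omega> \<in> space seeds. alpha_at \<alpha>\<^sub>0 k (Suc j) \<omega> \<noteq> alpha_at \<alpha>\<^sub>0 k j \<omega> / 2} = ?X \<union> ?Y"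
    using phase_at_invariant(1)[of j, THEN less_imp_neq] by (auto simp: phase_at_Suc)
  show "{\<omega> \<in> space seeds. alpha_at \<alpha>\<^sub>0 k (Suc j) \<omega> \<noteq> alpha_at \<alpha>\<^sub>0 k j \<omega> / 2} \<in> sets seeds" unfolding eq using X Y by auto
  have "measure seeds (?X \<union> ?Y) \<le> measure seeds ?X + measure seeds ?Y"
    by (rule measure_Un_le[OF X(1) Y(1)])
  then show "measure seeds {\<omega> \<in> space seeds. alpha_at \<alpha>\<^sub>0 k (Suc j) \<omega> \<noteq> alpha_at \<alpha>\<^sub>0 k j \<omega> / 2} \<le> 4 * K * sqrt n * (2 / 3) ^ k"
    unfolding eq using X(2) Y(2) by simp
qed

text \<open>Union bound over the phases. On the good event the certified \<alpha> has kept up with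
  the schedule.\<close>

lemma phases_success:
  "measure seeds {\<omega> \<in> space seeds. alpha_at \<alpha>\<^sub>0 k N \<omega> = \<alpha>\<^sub>0 / 2 ^ N} \<ge> 1 - real N * (4 * K * sqrt n * (2 / 3) ^ k)"
proof -
  define F where "F j = {\<omega> \<in> space seeds. alpha_at \<alpha>\<^sub>0 k (Suc j) \<omega> \<noteq> alpha_at \<alpha>\<^sub>0 k j \<omega> / 2}" for j
  have Fs: "F j \<in> sets seeds" and Fm: "measure seeds (F j) \<le> 4 * K * sqrt n * (2 / 3) ^ k" for j
    unfolding F_def by (rule phase_failure)+
  have U: "(\<Union>j<N. F j) \<in> sets seeds" using Fs by (intro sets.finite_UN) auto
  have "measure seeds (\<Union>j<N. F j) \<le> (\<Sum>j<N. measure seeds (F j))"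
    using Fs by (intro S.finite_measure_subadditive_finite) auto
  also have "\<dots> \<le> real N * (4 * K * sqrt n * (2 / 3) ^ k)"
    using sum_bounded_above[of "{..<N}" "\<lambda>j. measure seeds (F j)", OF Fm] by simp
  finally have "1 - real N * (4 * K * sqrt n * (2 / 3) ^ k) \<le> 1 - measure seeds (\<Union>j<N. F j)" by simp
  also have "\<dots> = measure seeds (space seeds - (\<Union>j<N. F j))" using S.prob_compl[OF U] by simp
  also have "\<dots> \<le> measure seeds {\<omega> \<in> space seeds. alpha_at \<alpha>\<^sub>0 k N \<omega> = \<alpha>\<^sub>0 / 2 ^ N}"
  proof (rule S.finite_measure_mono)
    show "{\<omega> \<in> space seeds. alpha_at \<alpha>\<^sub>0 k N \<omega> = \<alpha>\<^sub>0 / 2 ^ N} \<in> sets seeds"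
    proof -
      have [measurable]: "alpha_at \<alpha>\<^sub>0 k N \<in> borel_measurable seeds" using phase_at_measurable[of N] ..
      show ?thesis by measurable
    qed
    show "space seeds - (\<Union>j<N. F j) \<subseteq> {\<omega> \<in> space seeds. alpha_at \<alpha>\<^sub>0 k N \<omega> = \<alpha>\<^sub>0 / 2 ^ N}"
    proof safe
      fix \<omega> assume \<omega>: "\<omega> \<in> space seeds" "\<omega> \<notin> (\<Union>j<N. F j)"
      have "alpha_at \<alpha>\<^sub>0 k j \<omega> = \<alpha>\<^sub>0 / 2 ^ j" if "j \<le> N" for j
        using that
      proof (induction j)
        case 0 then show ?case by (simp add: alpha_at_def phase_at_def)
      next
        case (Suc j)
        then have "\<omega> \<notin> F j" using \<omega>(2) by auto
        then have "alpha_at \<alpha>\<^sub>0 k (Suc j) \<omega> = alpha_at \<alpha>\<^sub>0 k j \<omega> / 2" using \<omega>(1) unfolding F_def by blast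
        then show ?case using Suc by simp
      qed
      then show "alpha_at \<alpha>\<^sub>0 k N \<omega> = \<alpha>\<^sub>0 / 2 ^ N" by simp
    qed
  qed
  finally show ?thesis .
qed

end

end

section \<open>The scaled matrix\<close>

lemma scales_iff:
  assumes B: "B \<in> carrier_mat n n"
  shows "scales_to_rcdd (mat_diag n l) (mat_diag n r) B \<longleftrightarrow>
    (\<forall>i<n. 0 < l i \<and> 0 < r i \<and>
      (\<Sum>j\<in>{..<n} - {i}. \<bar>l i * B $$ (i, j) * r j\<bar>) \<le> l i * B $$ (i, i) * r i \<and>
      (\<Sum>j\<in>{..<n} - {i}. \<bar>l j * B $$ (j, i) * r i\<bar>) \<le> l i * B $$ (i, i) * r i)"
proof -
  have "mat_diag n l * B * mat_diag n r = Matrix.mat n n (\<lambda>(i, j). l i * B $$ (i, j) * r j)"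
    using B by (subst mat_diag_mult_left[OF B], subst mat_diag_mult_right[of _ n n]) (auto intro!: eq_matI)
  moreover have "mat_diag n l $$ (i, i) = l i" "mat_diag n r $$ (i, i) = r i" if "i < n" for i
    using that by (simp_all add: mat_diag_def)
  ultimately show ?thesis
    using B by (auto simp: scales_to_rcdd_def rcdd_def square_mat.simps)
qed

lemma scales_cong:
  assumes "B \<in> carrier_mat n n" "\<And>i. i < n \<Longrightarrow> l i = l' i" "\<And>i. i < n \<Longrightarrow> r i = r' i"
  shows "scales_to_rcdd (mat_diag n l) (mat_diag n r) B = scales_to_rcdd (mat_diag n l') (mat_diag n r') B"
proof -
  have "mat_diag n l = mat_diag n l'" "mat_diag n r = mat_diag n r'"
    using assms by (auto simp: mat_diag_def intro!: eq_matI)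
  then show ?thesis by simp
qed

lemma scales_measurable:
  assumes B: "B \<in> carrier_mat n n"
    and m: "\<And>i. i < n \<Longrightarrow> (\<lambda>\<omega>. l \<omega> i) \<in> borel_measurable N" "\<And>i. i < n \<Longrightarrow> (\<lambda>\<omega>. r \<omega> i) \<in> borel_measurable N"
  shows "Measurable.pred N (\<lambda>\<omega>. scales_to_rcdd (mat_diag n (l \<omega>)) (mat_diag n (r \<omega>)) B)"
proof -
  have e: "(\<lambda>\<omega>. l \<omega> i * B $$ (i, j) * r \<omega> j) \<in> borel_measurable N" if "i < n" "j < n" for i j
    using m that by (intro borel_measurable_times) auto
  have rows: "(\<lambda>\<omega>. \<Sum>j\<in>{..<n} - {i}. \<bar>l \<omega> i * B $$ (i, j) * r \<omega> j\<bar>) \<in> borel_measurable N"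
    "(\<lambda>\<omega>. \<Sum>j\<in>{..<n} - {i}. \<bar>l \<omega> j * B $$ (j, i) * r \<omega> i\<bar>) \<in> borel_measurable N" if "i < n" for i
    using e that by (auto intro!: borel_measurable_sum borel_measurable_abs)
  have "Measurable.pred N (\<lambda>\<omega>. \<forall>i\<in>{..<n}. 0 < l \<omega> i \<and> 0 < r \<omega> i \<and>
      (\<Sum>j\<in>{..<n} - {i}. \<bar>l \<omega> i * B $$ (i, j) * r \<omega> j\<bar>) \<le> l \<omega> i * B $$ (i, i) * r \<omega> i \<and>
      (\<Sum>j\<in>{..<n} - {i}. \<bar>l \<omega> j * B $$ (j, i) * r \<omega> i\<bar>) \<le> l \<omega> i * B $$ (i, i) * r \<omega> i)"
  proof (rule pred_intros_finite(3))
    fix i assume "i \<in> {..<n}"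
    then have i: "i < n" by simp
    define R C where "R \<omega> = (\<Sum>j\<in>{..<n} - {i}. \<bar>l \<omega> i * B $$ (i, j) * r \<omega> j\<bar>)"
      and "C \<omega> = (\<Sum>j\<in>{..<n} - {i}. \<bar>l \<omega> j * B $$ (j, i) * r \<omega> i\<bar>)" for \<omega>
    define d li ri where "d \<omega> = l \<omega> i * B $$ (i, i) * r \<omega> i" and "li \<omega> = l \<omega> i" and "ri \<omega> = r \<omega> i" for \<omega>
    have [measurable]: "R \<in> borel_measurable N" "C \<in> borel_measurable N" "d \<in> borel_measurable N"
        "li \<in> borel_measurable N" "ri \<in> borel_measurable N"
      unfolding R_def[abs_def] C_def[abs_def] d_def[abs_def] li_def[abs_def] ri_def[abs_def]
      using rows[OF i] e[OF i i] m[OF i] by simp_all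
    have "Measurable.pred N (\<lambda>\<omega>. 0 < li \<omega> \<and> 0 < ri \<omega> \<and> R \<omega> \<le> d \<omega> \<and> C \<omega> \<le> d \<omega>)" by measurable
    then show "Measurable.pred N (\<lambda>\<omega>. 0 < l \<omega> i \<and> 0 < r \<omega> i \<and>
        (\<Sum>j\<in>{..<n} - {i}. \<bar>l \<omega> i * B $$ (i, j) * r \<omega> j\<bar>) \<le> l \<omega> i * B $$ (i, i) * r \<omega> i \<and>
        (\<Sum>j\<in>{..<n} - {i}. \<bar>l \<omega> j * B $$ (j, i) * r \<omega> i\<bar>) \<le> l \<omega> i * B $$ (i, i) * r \<omega> i)"
      unfolding R_def C_def d_def li_def ri_def .
  qed simp
  then show ?thesis unfolding scales_iff[OF B] Ball_def lessThan_iff .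
qed

section \<open>From a certified pair to a scaling of (1 + \<epsilon>) I - A\<close>

context mmatrix
begin

text \<open>Multiplying the certificate by \<open>1 + \<alpha>\<close> shows that
  \<open>mv n a r i\<close> is at most \<open>(1 + \<alpha>) * r i - 1 / 2\<close>. Either \<alpha>
  is at most \<epsilon>, or the slack 1/2 pays for \<open>\<alpha> * r i\<close>, which is at most
  \<open>3 / 2 * K * \<alpha>\<close>: the origin of the 3 in the stopping rule.\<close>

lemma dominant_row:
  assumes \<alpha>: "0 \<le> \<alpha>" and r: "certified n a \<alpha> r" and l: "certified n (tr a) \<alpha> l"
    and small: "\<alpha> \<le> \<epsilon> \<or> 3 * K * \<alpha> \<le> 1" and \<epsilon>: "0 < \<epsilon>" and i: "i < n"
  shows "(\<Sum>j\<in>{..<n} - {i}. l i * a i j * r j) \<le> l i * (1 + \<epsilon> - a i i) * r i"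
proof -
  interpret T: mmatrix n "tr a" K ls rs by (rule transposed)
  note rb = certified_bounds[OF \<alpha> r i] and lb = T.certified_bounds[OF \<alpha> l i]
  have "1 / 2 \<le> r i - 1 / (1 + \<alpha>) * mv n a r i"
    using r[unfolded certified_def resid_def, rule_format, OF i] unfolding abs_le_iff by linarith
  then have "(1 + \<alpha>) * (1 / 2) \<le> (1 + \<alpha>) * (r i - 1 / (1 + \<alpha>) * mv n a r i)"
    using \<alpha> by (intro mult_left_mono) auto
  also have "\<dots> = (1 + \<alpha>) * r i - mv n a r i" using \<alpha> by (simp add: right_diff_distrib)
  finally have *: "1 / 2 \<le> (1 + \<alpha>) * r i - mv n a r i" using \<alpha> by simp
  have "mv n a r i \<le> (1 + \<epsilon>) * r i"
  proof (cases "\<alpha> \<le> \<epsilon>")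
    case True
    then have "\<alpha> * r i \<le> \<epsilon> * r i" using rb by (intro mult_right_mono) auto
    then show ?thesis using * by (simp add: distrib_right)
  next
    case False
    have "\<alpha> * r i \<le> \<alpha> * (3 / 2 * K)" using \<alpha> rb by (intro mult_left_mono) auto
    moreover have "0 \<le> \<epsilon> * r i" using \<epsilon> rb by (intro mult_nonneg_nonneg) auto
    moreover have "\<alpha> * (3 / 2 * K) \<le> 1 / 2" using small False by (simp add: mult_ac)
    ultimately show ?thesis using * unfolding distrib_right by linarith
  qed
  then have "l i * mv n a r i \<le> l i * ((1 + \<epsilon>) * r i)" using lb by (intro mult_left_mono) auto
  moreover have "l i * mv n a r i = l i * a i i * r i + (\<Sum>j\<in>{..<n} - {i}. l i * a i j * r j)"
    using i unfolding mv_def sum_distrib_left by (subst sum.remove[of _ i]) (simp_all add: mult.assoc)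
  ultimately show ?thesis by (simp add: algebra_simps)
qed

lemma certified_scales:
  assumes \<alpha>: "0 \<le> \<alpha>" and r: "certified n a \<alpha> r" and l: "certified n (tr a) \<alpha> l"
    and small: "\<alpha> \<le> \<epsilon> \<or> 3 * K * \<alpha> \<le> 1" and \<epsilon>: "0 < \<epsilon>"
    and A: "A \<in> carrier_mat n n" "\<And>i j. i < n \<Longrightarrow> j < n \<Longrightarrow> A $$ (i, j) = a i j"
  shows "scales_to_rcdd (mat_diag n l) (mat_diag n r) ((1 + \<epsilon>) \<cdot>\<^sub>m 1\<^sub>m n - A)"
proof -
  interpret T: mmatrix n "tr a" K ls rs by (rule transposed)
  let ?B = "(1 + \<epsilon>) \<cdot>\<^sub>m 1\<^sub>m n - A"
  have B: "?B \<in> carrier_mat n n" by (rule minus_carrier_mat[OF A(1)])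
  have Bi: "?B $$ (i, j) = (if i = j then 1 + \<epsilon> else 0) - a i j" if "i < n" "j < n" for i j
    using that A by simp
  show ?thesis
    unfolding scales_iff[OF B]
  proof (intro allI impI conjI)
    fix i assume i: "i < n"
    show "0 < l i" "0 < r i" using certified_bounds(1)[OF \<alpha> r i] T.certified_bounds(1)[OF \<alpha> l i] by auto
    have pos: "0 \<le> r j" "0 \<le> l j" if "j < n" for j
      using certified_bounds(1)[OF \<alpha> r that] T.certified_bounds(1)[OF \<alpha> l that] by auto
    have "(\<Sum>j\<in>{..<n} - {i}. \<bar>l i * ?B $$ (i, j) * r j\<bar>) = (\<Sum>j\<in>{..<n} - {i}. l i * a i j * r j)"
      using i pos nonneg by (intro sum.cong) (auto simp: Bi abs_mult)
    then show "(\<Sum>j\<in>{..<n} - {i}. \<bar>l i * ?B $$ (i, j) * r j\<bar>) \<le> l i * ?B $$ (i, i) * r i"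
      using dominant_row[OF \<alpha> r l small \<epsilon> i] by (simp only: Bi[OF i i] if_True refl)
    have "(\<Sum>j\<in>{..<n} - {i}. \<bar>l j * ?B $$ (j, i) * r i\<bar>) = (\<Sum>j\<in>{..<n} - {i}. r i * a j i * l j)"
      using i pos nonneg by (intro sum.cong) (auto simp: Bi abs_mult mult_ac)
    then show "(\<Sum>j\<in>{..<n} - {i}. \<bar>l j * ?B $$ (j, i) * r i\<bar>) \<le> l i * ?B $$ (i, i) * r i"
      using T.dominant_row[OF \<alpha> l _ small \<epsilon> i, of r] r by (simp only: Bi[OF i i] if_True refl mult_ac)
  qed
qed

end

section \<open>Timed execution\<close>

text \<open>Total correctness within a time budget, for one fixed seed sequence. That an execution
  exists includes that every \<open>Build\<close> meets an admissible matrix.\<close>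

definition runs ::
  "(nat \<Rightarrow> nat \<Rightarrow> real \<Rightarrow> real \<Rightarrow> real) \<Rightarrow> 'w solver \<Rightarrow> (nat \<Rightarrow> 'w) \<Rightarrow> com \<Rightarrow> state \<Rightarrow> real \<Rightarrow> (state \<Rightarrow> bool) \<Rightarrow> bool" where
  "runs T slv \<omega> c s \<tau> Q \<longleftrightarrow> (\<exists>t s'. exec T slv \<omega> c s t s' \<and> t \<le> \<tau> \<and> Q s')"

lemma runsI: "exec T slv \<omega> c s t s' \<Longrightarrow> t \<le> \<tau> \<Longrightarrow> Q s' \<Longrightarrow> runs T slv \<omega> c s \<tau> Q"
  unfolding runs_def by blast

lemma runs_mono:
  "runs T slv \<omega> c s \<tau> Q \<Longrightarrow> \<tau> \<le> \<tau>' \<Longrightarrow> (\<And>s'. Q s' \<Longrightarrow> Q' s') \<Longrightarrow> runs T slv \<omega> c s \<tau>' Q'"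
  unfolding runs_def by (meson order_trans)

lemma runs_Skip: "Q s \<Longrightarrow> 1 \<le> \<tau> \<Longrightarrow> runs T slv \<omega> Skip s \<tau> Q"
  by (rule runsI[OF exec.Skip])

lemma runs_NAssign:
  "Q (s\<lparr>nvar := (nvar s)(x := nval e s)\<rparr>) \<Longrightarrow> real (1 + ncost e) \<le> \<tau> \<Longrightarrow> runs T slv \<omega> (NAssign x e) s \<tau> Q"
  by (rule runsI[OF exec.NAssign])

lemma runs_RAssign:
  "Q (s\<lparr>rvar := (rvar s)(x := rval e s)\<rparr>) \<Longrightarrow> real (1 + rcost e) \<le> \<tau> \<Longrightarrow> runs T slv \<omega> (RAssign x e) s \<tau> Q"
  by (rule runsI[OF exec.RAssign])

lemma runs_NStore:
  "Q (s\<lparr>narr := (narr s)(a := (narr s a)(nval i s := nval e s))\<rparr>) \<Longrightarrow> real (1 + ncost i + ncost e) \<le> \<tau> \<Longrightarrow>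
    runs T slv \<omega> (NStore a i e) s \<tau> Q"
  by (rule runsI[OF exec.NStore])

lemma runs_RStore:
  "Q (s\<lparr>rarr := (rarr s)(a := (rarr s a)(nval i s := rval e s))\<rparr>) \<Longrightarrow> real (1 + ncost i + rcost e) \<le> \<tau> \<Longrightarrow>
    runs T slv \<omega> (RStore a i e) s \<tau> Q"
  by (rule runsI[OF exec.RStore])

lemma runs_Seq:
  "runs T slv \<omega> c1 s \<tau>1 (\<lambda>s1. runs T slv \<omega> c2 s1 \<tau>2 Q) \<Longrightarrow> runs T slv \<omega> (Seq c1 c2) s (\<tau>1 + \<tau>2) Q"
  unfolding runs_def by (meson add_mono exec.Seq)

lemma runs_Seq':
  assumes "runs T slv \<omega> c1 s \<rho> P" "\<And>s1. P s1 \<Longrightarrow> runs T slv \<omega> c2 s1 \<sigma> Q" "\<rho> + \<sigma> \<le> \<tau>"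
  shows "runs T slv \<omega> (Seq c1 c2) s \<tau> Q"
  by (rule runs_mono[OF runs_Seq[OF runs_mono[OF assms(1) order_refl assms(2)]] assms(3)])

lemma runs_If:
  assumes "bval b s \<Longrightarrow> runs T slv \<omega> c1 s \<tau> Q" "\<not> bval b s \<Longrightarrow> runs T slv \<omega> c2 s \<tau> Q" "real (1 + bcost b) + \<tau> \<le> \<tau>'"
  shows "runs T slv \<omega> (If b c1 c2) s \<tau>' Q"
proof (cases "bval b s")
  case True
  then obtain t s' where "exec T slv \<omega> c1 s t s'" "t \<le> \<tau>" "Q s'" using assms(1) unfolding runs_def by blast
  then show ?thesis using exec.IfTrue[OF True] assms(3) by (intro runsI[of _ _ _ _ _ "real (1 + bcost b) + t"]) auto
next
  case False
  then obtain t s' where "exec T slv \<omega> c2 s t s'" "t \<le> \<tau>" "Q s'" using assms(2) unfolding runs_def by blast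
  then show ?thesis using exec.IfFalse[OF False] assms(3) by (intro runsI[of _ _ _ _ _ "real (1 + bcost b) + t"]) auto
qed

text \<open>The number of rounds is fixed beforehand and the invariant carries the round index,
  which settles termination and time together.\<close>

lemma runs_While:
  assumes step: "\<And>k s. I k s \<Longrightarrow> k < N \<Longrightarrow> bval b s \<and> runs T slv \<omega> c s \<tau> (I (Suc k))"
    and stop: "\<And>s. I N s \<Longrightarrow> \<not> bval b s"
    and init: "I 0 s"
  shows "runs T slv \<omega> (While b c) s (real N * (real (1 + bcost b) + \<tau>) + real (1 + bcost b)) (I N)"
proof -
  have "runs T slv \<omega> (While b c) s (real (N - k) * (real (1 + bcost b) + \<tau>) + real (1 + bcost b)) (I N)"
    if "I k s" "k \<le> N" for k s
    using that(2,1)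
  proof (induction k arbitrary: s rule: inc_induct)
    case base
    then show ?case using exec.WhileFalse[of b s T slv \<omega> c] stop by (intro runsI) auto
  next
    case (step k)
    have b: "bval b s" and c: "runs T slv \<omega> c s \<tau> (I (Suc k))" using assms(1)[OF step.prems step.hyps(2)] by auto
    obtain t1 s1 where 1: "exec T slv \<omega> c s t1 s1" "t1 \<le> \<tau>" "I (Suc k) s1" using c unfolding runs_def by blast
    obtain t2 s2 where 2: "exec T slv \<omega> (While b c) s1 t2 s2"
        "t2 \<le> real (N - Suc k) * (real (1 + bcost b) + \<tau>) + real (1 + bcost b)" "I N s2"
      using step.IH[OF 1(3)] unfolding runs_def by blast
    have e: "real (N - k) = real (N - Suc k) + 1" using step.hyps(2) by simp
    have "real (1 + bcost b) + t1 + t2 \<le> real (N - k) * (real (1 + bcost b) + \<tau>) + real (1 + bcost b)"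
      using add_mono[OF add_left_mono[OF 1(2), of "real (1 + bcost b)"] 2(2)]
      by (simp only: e distrib_right mult_1 ac_simps)
    then show ?case using exec.WhileTrue[OF b 1(1) 2(1)] 2(3) unfolding runs_def by blast
  qed
  from this[OF init] show ?thesis by simp
qed

definition For :: "nat \<Rightarrow> nat \<Rightarrow> com \<Rightarrow> com" where
  "For i v c = Seq (NAssign i (NLit 0)) (While (NLess (NVar i) (NVar v)) (Seq c (NAssign i (NAdd (NVar i) (NLit 1)))))"

lemma runs_For:
  assumes v: "v \<noteq> i" "nvar s v = N" and \<tau>: "0 \<le> \<tau>" and init: "I 0 (s\<lparr>nvar := (nvar s)(i := 0)\<rparr>)"
    and body: "\<And>k s. I k s \<Longrightarrow> k < N \<Longrightarrow> nvar s i = k \<Longrightarrow> nvar s v = N \<Longrightarrow>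
      runs T slv \<omega> c s \<tau> (\<lambda>s'. nvar s' i = k \<and> nvar s' v = N \<and> I (Suc k) (s'\<lparr>nvar := (nvar s')(i := Suc k)\<rparr>))"
  shows "runs T slv \<omega> (For i v c) s (real (N + 1) * (\<tau> + 10)) (\<lambda>s'. I N s' \<and> nvar s' i = N \<and> nvar s' v = N)"
  unfolding For_def
proof (rule runs_Seq')
  let ?J = "\<lambda>k s. I k s \<and> nvar s i = k \<and> nvar s v = N"
  show "runs T slv \<omega> (NAssign i (NLit 0)) s 2 (?J 0)" using init v by (intro runs_NAssign) auto
next
  let ?J = "\<lambda>k s. I k s \<and> nvar s i = k \<and> nvar s v = N"
  fix s1 assume s1: "?J 0 s1"
  show "runs T slv \<omega> (While (NLess (NVar i) (NVar v)) (Seq c (NAssign i (NAdd (NVar i) (NLit 1))))) s1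
      (real N * (4 + (\<tau> + 4)) + 4) (?J N)"
  proof (rule runs_mono[OF runs_While[where I = ?J and N = N and \<tau> = "\<tau> + 4"]])
    fix k s assume "?J k s" "k < N"
    then show "bval (NLess (NVar i) (NVar v)) s \<and> runs T slv \<omega> (Seq c (NAssign i (NAdd (NVar i) (NLit 1)))) s (\<tau> + 4) (?J (Suc k))"
      using v by (auto intro!: runs_Seq'[OF body[of k s]] runs_NAssign)
  qed (use s1 in auto)
next
  \<comment> \<open>Each round adds 4 for the guard and 4 for the increment; the 2 of the
    initialisation and the 4 of the last guard fit into the extra round.\<close>
  show "2 + (real N * (4 + (\<tau> + 4)) + 4) \<le> real (N + 1) * (\<tau> + 10)" using \<tau> by (simp add: algebra_simps)
qed

text \<open>\<open>F k\<close> is the entire array after \<open>k\<close> rounds. Describing it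
  exactly, including the positions not written, allows the final state to be given by an
  equation.\<close>

lemma runs_RStore_loop:
  fixes s :: state and i x :: nat
  defines "st \<equiv> \<lambda>k f. s\<lparr>nvar := (nvar s)(i := k), rarr := (rarr s)(x := f)\<rparr>"
  assumes v: "v \<noteq> i" "nvar s v = N"
    and F: "F 0 = rarr s x" "\<And>k. k < N \<Longrightarrow> F (Suc k) = (F k)(nval ie (st k (F k)) := rval re (st k (F k)))"
  shows "runs T slv \<omega> (For i v (RStore x ie re)) s (real (N + 1) * (real (1 + ncost ie + rcost re) + 10)) (\<lambda>s'. s' = st N (F N))"
proof (rule runs_mono[OF runs_For[where I = "\<lambda>k s'. s' = st k (F k)", OF v]])
  show "s\<lparr>nvar := (nvar s)(i := 0)\<rparr> = st 0 (F 0)" by (simp add: st_def F(1))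
  fix k s' assume s': "s' = st k (F k)" and k: "k < N" "nvar s' i = k" "nvar s' v = N"
  show "runs T slv \<omega> (RStore x ie re) s' (real (1 + ncost ie + rcost re))
      (\<lambda>s'. nvar s' i = k \<and> nvar s' v = N \<and> s'\<lparr>nvar := (nvar s')(i := Suc k)\<rparr> = st (Suc k) (F (Suc k)))"
  proof (rule runs_RStore)
    have "s'\<lparr>rarr := (rarr s')(x := (rarr s' x)(nval ie s' := rval re s')), nvar := (nvar s')(i := Suc k)\<rparr> = st (Suc k) (F (Suc k))"
      unfolding F(2)[OF k(1)] s' by (simp add: st_def)
    then show "nvar (s'\<lparr>rarr := (rarr s')(x := (rarr s' x)(nval ie s' := rval re s'))\<rparr>) i = k \<and>
        nvar (s'\<lparr>rarr := (rarr s')(x := (rarr s' x)(nval ie s' := rval re s'))\<rparr>) v = N \<and>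
        s'\<lparr>rarr := (rarr s')(x := (rarr s' x)(nval ie s' := rval re s')),
          nvar := (nvar (s'\<lparr>rarr := (rarr s')(x := (rarr s' x)(nval ie s' := rval re s'))\<rparr>))(i := Suc k)\<rparr> = st (Suc k) (F (Suc k))"
      using k(2,3) by simp
  qed simp
qed auto

text \<open>Entry \<open>k\<close> may be read before it is overwritten in round \<open>k\<close>.\<close>

lemma runs_map_loop:
  fixes s :: state
  assumes v: "v \<noteq> i" "nvar s v = N"
    and h: "\<And>k f. k < N \<Longrightarrow> rval re (s\<lparr>nvar := (nvar s)(i := k), rarr := (rarr s)(x := f)\<rparr>) = h k (f k)"
  shows "runs T slv \<omega> (For i v (RStore x (NVar i) re)) s (real (N + 1) * (real (2 + rcost re) + 10))
    (\<lambda>s'. s' = s\<lparr>nvar := (nvar s)(i := N), rarr := (rarr s)(x := (\<lambda>j. if j < N then h j (rarr s x j) else rarr s x j))\<rparr>)"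
  by (rule runs_mono[OF runs_RStore_loop[OF v, where F = "\<lambda>k j. if j < k then h j (rarr s x j) else rarr s x j"]])
    (auto simp: h fun_eq_iff less_Suc_eq)

text \<open>Every listed entry subtracts its contribution in the slot of its row: a sparse
  matrix-vector product in time linear in the length of the list.\<close>

lemma runs_scatter_loop:
  fixes s :: state
  assumes v: "v \<noteq> i" "nvar s v = N"
    and g: "\<And>k f. k < N \<Longrightarrow> rval ge (s\<lparr>nvar := (nvar s)(i := k), rarr := (rarr s)(x := f)\<rparr>) = g k"
  shows "runs T slv \<omega> (For i v (RStore x (NGet R (NVar i)) (RSub (RGet x (NGet R (NVar i))) ge))) s
      (real (N + 1) * (real (7 + rcost ge) + 10))
    (\<lambda>s'. s' = s\<lparr>nvar := (nvar s)(i := N), rarr := (rarr s)(x := (\<lambda>j. rarr s x j - (\<Sum>k<N. if narr s R k = j then g k else 0)))\<rparr>)"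
  by (rule runs_mono[OF runs_RStore_loop[OF v, where F = "\<lambda>K j. rarr s x j - (\<Sum>k<K. if narr s R k = j then g k else 0)"]])
    (auto simp: g fun_eq_iff)

lemma runs_NStore_iota_loop:
  fixes s :: state
  assumes v: "v \<noteq> i" "nvar s v = N"
  shows "runs T slv \<omega> (For i v (NStore x (NVar i) (NVar i))) s (real (N + 1) * 13)
    (\<lambda>s'. s' = s\<lparr>nvar := (nvar s)(i := N), narr := (narr s)(x := (\<lambda>j. if j < N then j else narr s x j))\<rparr>)"
proof (rule runs_mono[OF runs_For[where \<tau> = 3 and I = "\<lambda>k s'. s' =
    s\<lparr>nvar := (nvar s)(i := k), narr := (narr s)(x := (\<lambda>j. if j < k then j else narr s x j))\<rparr>", OF v]])
  fix k s'
  assume s': "s' = s\<lparr>nvar := (nvar s)(i := k), narr := (narr s)(x := (\<lambda>j. if j < k then j else narr s x j))\<rparr>"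
    and k: "k < N" "nvar s' i = k" "nvar s' v = N"
  show "runs T slv \<omega> (NStore x (NVar i) (NVar i)) s' 3 (\<lambda>s'. nvar s' i = k \<and> nvar s' v = N \<and>
      s'\<lparr>nvar := (nvar s')(i := Suc k)\<rparr> =
      s\<lparr>nvar := (nvar s)(i := Suc k), narr := (narr s)(x := (\<lambda>j. if j < Suc k then j else narr s x j))\<rparr>)"
    using k v by (intro runs_NStore) (auto simp: s' fun_eq_iff less_Suc_eq)
qed auto

section \<open>Sparse matrices with explicit diagonal\<close>

text \<open>\<open>R\<close>, \<open>C\<close> list the diagonal and all nonzero positions of \<open>a\<close>; \<open>V\<close> and \<open>E\<close> hold the entries
  of \<open>a\<close> and of the identity there.\<close>

definition padded :: "nat \<Rightarrow> nat \<Rightarrow> (nat \<Rightarrow> nat) \<Rightarrow> (nat \<Rightarrow> nat) \<Rightarrow> (nat \<Rightarrow> real) \<Rightarrow> (nat \<Rightarrow> real) \<Rightarrow> (nat \<Rightarrow> nat \<Rightarrow> real) \<Rightarrow> bool" where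
  "padded n p R C V E a \<longleftrightarrow>
     bij_betw (\<lambda>k. (R k, C k)) {..<p} {(i, j). i < n \<and> j < n \<and> (i = j \<or> a i j \<noteq> 0)} \<and>
     (\<forall>k<p. V k = a (R k) (C k) \<and> E k = (if R k = C k then 1 else 0))"

lemma padded_tr: "padded n p R C V E a \<Longrightarrow> padded n p C R V E (tr a)"
proof -
  assume p: "padded n p R C V E a"
  have "bij_betw (prod.swap \<circ> (\<lambda>k. (R k, C k))) {..<p} {(i, j). i < n \<and> j < n \<and> (i = j \<or> a j i \<noteq> 0)}"
  proof (rule bij_betw_trans)
    show "bij_betw (\<lambda>k. (R k, C k)) {..<p} {(i, j). i < n \<and> j < n \<and> (i = j \<or> a i j \<noteq> 0)}"
      using p unfolding padded_def by blast
    show "bij_betw prod.swap {(i, j). i < n \<and> j < n \<and> (i = j \<or> a i j \<noteq> 0)} {(i, j). i < n \<and> j < n \<and> (i = j \<or> a j i \<noteq> 0)}"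
      by (rule bij_betw_byWitness[where f' = prod.swap]) auto
  qed
  then have "bij_betw (\<lambda>k. (C k, R k)) {..<p} {(i, j). i < n \<and> j < n \<and> (i = j \<or> a j i \<noteq> 0)}"
    by (simp only: comp_def swap_simp)
  moreover have "V k = a (R k) (C k) \<and> E k = (if C k = R k then 1 else 0)" if "k < p" for k
    using p that unfolding padded_def by metis
  ultimately show ?thesis unfolding padded_def by blast
qed

lemma padded_bounds: "padded n p R C V E a \<Longrightarrow> k < p \<Longrightarrow> R k < n \<and> C k < n"
  unfolding padded_def by (auto dest!: bij_betw_apply)

text \<open>The sum over the list is reindexed by matrix positions. Positions off the list
  contribute 0, because the diagonal, where the identity is nonzero, is always listed.\<close>

lemma padded_sum:
  assumes p: "padded n p R C V E a" and i: "i < n"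
  shows "(\<Sum>k<p. if R k = i then (E k - \<beta> * V k) * x (C k) else 0) = x i - \<beta> * mv n a x i"
proof -
  let ?S = "{(i, j). i < n \<and> j < n \<and> (i = j \<or> a i j \<noteq> 0)}"
  let ?g = "\<lambda>(q, j). if q = i then ((if q = j then 1 else 0) - \<beta> * a q j) * x j else 0"
  have "(\<Sum>k<p. if R k = i then (E k - \<beta> * V k) * x (C k) else 0) = (\<Sum>k<p. ?g (R k, C k))"
    using p unfolding padded_def by (intro sum.cong) auto
  also have "\<dots> = sum ?g ?S"
    using p unfolding padded_def by (intro sum.reindex_bij_betw[where h = "\<lambda>k. (R k, C k)" and g = ?g]) auto
  also have "\<dots> = sum ?g ({..<n} \<times> {..<n})" by (intro sum.mono_neutral_left) (auto split: if_splits)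
  also have "\<dots> = (\<Sum>q<n. \<Sum>j<n. ?g (q, j))" by (rule sum.cartesian_product')
  also have "\<dots> = (\<Sum>j<n. ?g (i, j))" using i by (subst sum.remove[of _ i]) simp_all
  also have "\<dots> = (\<Sum>j<n. ((if i = j then 1 else 0) - \<beta> * a i j) * x j)" by simp
  finally show ?thesis by (simp only: sum_kronecker[OF i])
qed

text \<open>Allocation: natural variable 2 is the loop counter and 3 the number of padded entries;
  real variable 2 is the certified \<open>\<alpha>\<close>, 3 the scheduled one, 4 the step counter, 5 the rejection
  flag. Index arrays 2, 3 and arrays 3, 4 hold the padded matrix, arrays 1, 2 the certified \<open>l\<close>, \<open>r\<close>,
  array 5 the entries of the scaled matrix, 6 and 7 the candidates for \<open>r\<close> and \<open>l\<close>, 8 the residual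
  and 9 the answer of the oracle. The transposed iteration swaps the index arrays.\<close>

definition residual :: "nat \<Rightarrow> nat \<Rightarrow> nat \<Rightarrow> com" where
  "residual R C x = Seq
     (For 2 0 (RStore 8 (NVar 2) (RLit 1)))
     (For 2 3 (RStore 8 (NGet R (NVar 2)) (RSub (RGet 8 (NGet R (NVar 2)))
        (RMul (RSub (RGet 4 (NVar 2))
            (RMul (RDiv (RLit 1) (RAdd (RLit 1) (RDiv (RVar 2) (RLit 2)))) (RGet 3 (NVar 2))))
          (RGet x (NGet C (NVar 2)))))))"

lemma runs_residual:
  assumes n: "nvar s 0 = n" and p: "nvar s 3 = p" and x: "x \<noteq> 8"
    and pad: "padded n p (narr s R) (narr s C) (rarr s 3) (rarr s 4) a"
    and B: "real n \<le> B" "real p \<le> B" "1 \<le> B"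
    and Q: "\<And>f. (\<And>i. i < n \<Longrightarrow> f i = resid n a (1 / (1 + rvar s 2 / 2)) (rarr s x) i) \<Longrightarrow>
      Q (s\<lparr>nvar := (nvar s)(2 := p), rarr := (rarr s)(8 := f)\<rparr>)"
  shows "runs T slv \<omega> (residual R C x) s (200 * B) Q"
  unfolding residual_def
proof (rule runs_Seq'[OF runs_map_loop[where h = "\<lambda>_ _. 1" and N = n]])
  let ?b = "1 / (1 + rvar s 2 / 2)"
  let ?s1 = "s\<lparr>nvar := (nvar s)(2 := n), rarr := (rarr s)(8 := (\<lambda>j. if j < n then 1 else rarr s 8 j))\<rparr>"
  fix s1 assume s1: "s1 = ?s1"
  show "runs T slv \<omega> (For 2 3 (RStore 8 (NGet R (NVar 2)) (RSub (RGet 8 (NGet R (NVar 2)))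
        (RMul (RSub (RGet 4 (NVar 2))
            (RMul (RDiv (RLit 1) (RAdd (RLit 1) (RDiv (RVar 2) (RLit 2)))) (RGet 3 (NVar 2))))
          (RGet x (NGet C (NVar 2))))))) s1 (real (p + 1) * 40) Q"
  proof (rule runs_mono[OF runs_scatter_loop[where N = p and g = "\<lambda>k. (rarr s 4 k - ?b * rarr s 3 k) * rarr s x (narr s C k)"]])
    fix s' assume s': "s' = s1\<lparr>nvar := (nvar s1)(2 := p), rarr := (rarr s1)(8 := (\<lambda>j. rarr s1 8 j -
      (\<Sum>k<p. if narr s1 R k = j then (rarr s 4 k - ?b * rarr s 3 k) * rarr s x (narr s C k) else 0)))\<rparr>"
    let ?f = "\<lambda>j. (if j < n then 1 else rarr s 8 j) -
        (\<Sum>k<p. if narr s R k = j then (rarr s 4 k - ?b * rarr s 3 k) * rarr s x (narr s C k) else 0)"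
    have "Q (s\<lparr>nvar := (nvar s)(2 := p), rarr := (rarr s)(8 := ?f)\<rparr>)"
    proof (rule Q)
      fix i assume i: "i < n"
      then show "?f i = resid n a ?b (rarr s x) i" unfolding padded_sum[OF pad i] by (simp add: resid_def)
    qed
    then show "Q s'" unfolding s' s1 by simp
  qed (use p x s1 in auto)
qed (use n B in \<open>auto simp: algebra_simps\<close>)

section \<open>One Richardson step and the check of a certificate as programs\<close>

definition accuracy_exp :: rexp where
  "accuracy_exp = RDiv (RLit 1) (RMul (RLit 216) (RMul (RVar 1) (RMul (RVar 1) (RVar 1))))"

text \<open>The operator is rebuilt in every step although the matrix stays the same during a phase:
  only \<open>Build\<close> consumes a seed, and the contraction holds in expectation over a seed
  that the current iterate has not seen.\<close>

definition richardson :: "nat \<Rightarrow> nat \<Rightarrow> nat \<Rightarrow> nat \<Rightarrow> nat \<Rightarrow> com" where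
  "richardson R C l r x = Seq (residual R C x) (Seq
     (For 2 0 (RStore 8 (NVar 2) (RMul (RGet l (NVar 2)) (RGet 8 (NVar 2))))) (Seq
     (For 2 3 (RStore 5 (NVar 2) (RMul (RMul (RGet l (NGet R (NVar 2)))
        (RSub (RGet 4 (NVar 2)) (RMul (RDiv (RLit 1) (RAdd (RLit 1) (RVar 2))) (RGet 3 (NVar 2)))))
        (RGet r (NGet C (NVar 2)))))) (Seq
     (Build 0 (NVar 0) (NVar 3) R C 5 accuracy_exp) (Seq
     (Apply 0 8 9)
     (For 2 0 (RStore x (NVar 2) (RAdd (RGet x (NVar 2)) (RMul (RGet r (NVar 2)) (RGet 9 (NVar 2))))))))))"

lemma rstep_cong:
  assumes "\<And>i. i < n \<Longrightarrow> l i = l' i" "\<And>i. i < n \<Longrightarrow> r i = r' i" "\<And>i. i < n \<Longrightarrow> x i = x' i" and i: "i < n"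
  shows "rstep slv \<delta> n a \<alpha> l r x w i = rstep slv \<delta> n a \<alpha> l' r' x' w i"
proof -
  have 1: "Matrix.mat n n (\<lambda>(i, j). scaled a \<alpha> l r i j) = Matrix.mat n n (\<lambda>(i, j). scaled a \<alpha> l' r' i j)"
    using assms by (intro eq_matI) (auto simp: scaled_def)
  have 2: "Matrix.vec n (\<lambda>i. l i * resid n a (1 / (1 + \<alpha> / 2)) x i) = Matrix.vec n (\<lambda>i. l' i * resid n a (1 / (1 + \<alpha> / 2)) x' i)"
    using assms by (intro eq_vecI) (auto intro: resid_cong)
  show ?thesis unfolding rstep_def 1 2 using assms by simp
qed

text \<open>A frame condition. Natural variable 2 is exempt as the common loop counter, and
  \<open>handle\<close> is left free because each \<open>Apply\<close> follows its own
  \<open>Build\<close>.\<close>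

definition same :: "nat set \<Rightarrow> state \<Rightarrow> state \<Rightarrow> bool" where
  "same A s s' \<longleftrightarrow> narr s' = narr s \<and> rvar s' = rvar s \<and> (\<forall>v. v \<noteq> 2 \<longrightarrow> nvar s' v = nvar s v) \<and>
     (\<forall>b. b \<notin> A \<longrightarrow> rarr s' b = rarr s b)"

text \<open>Variable 5 is only ever raised, so two checks in a row record whether both passed.
  Non-strict comparisons are negated strict ones, the only kind that \<open>bexp\<close>
  offers.\<close>

definition check :: "nat \<Rightarrow> nat \<Rightarrow> nat \<Rightarrow> com" where
  "check R C x = Seq (residual R C x)
     (For 2 0 (If (BAnd (BNot (RLess (RDiv (RLit 1) (RLit 2)) (RGet 8 (NVar 2))))
                        (BNot (RLess (RGet 8 (NVar 2)) (RDiv (RLit (- 1)) (RLit 2)))))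
                 Skip (RAssign 5 (RLit 1))))"

text \<open>\<open>B\<close> bounds linear work and \<open>D\<close> one use of the oracle. With the
  diagonal added, the matrices passed to it have up to \<open>m + n\<close> entries, so
  \<open>D\<close> covers all these sizes and all condition numbers that certified pairs can
  produce.\<close>

locale execution = scaling n a K rs ls M slv for n a K rs ls and M :: "'w measure" and slv +
  fixes T :: "nat \<Rightarrow> nat \<Rightarrow> real \<Rightarrow> real \<Rightarrow> real" and m :: nat and B D :: real
  assumes B: "real (m + n) \<le> B"
    and D: "q \<le> m + n \<Longrightarrow> 1 \<le> \<kappa> \<Longrightarrow> \<kappa> \<le> 18 * K\<^sup>2 \<Longrightarrow> T q n \<kappa> (accuracy K) \<le> D" and D0: "0 \<le> D"
begin

lemma transposed_execution: "execution n (tr a) K ls rs M slv T m B D"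
  using transposed_scaling B D D0 by (simp add: execution_def execution_axioms_def)

lemma B1: "1 \<le> B" using B n_pos by simp

lemma loop_time: "q \<le> m + n \<Longrightarrow> 0 \<le> c \<Longrightarrow> 2 * c \<le> d \<Longrightarrow> real (q + 1) * c \<le> d * B"
proof -
  assume q: "q \<le> m + n" and c: "0 \<le> c" "2 * c \<le> d"
  \<comment> \<open>\<open>q + 1\<close> is at most \<open>2 * B\<close>; the extra round is paid
    for by doubling the constant.\<close>
  have "real (q + 1) * c \<le> 2 * B * c" using q B B1 c by (intro mult_right_mono) auto
  also have "\<dots> = 2 * c * B" by simp
  also have "\<dots> \<le> d * B" using c B1 by (intro mult_right_mono) auto
  finally show ?thesis .
qed

text \<open>The premises of the \<open>Build\<close> rule hold whatever the earlier answers were: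
  certification makes the matrix admissible and bounds its condition number, and its support is
  exactly the padded list, so \<open>p\<close> is its number of nonzeros.\<close>

lemma runs_build:
  assumes n: "nvar s 0 = n" and p: "nvar s 3 = p" and K: "rvar s 1 = K" and pm: "p \<le> m + n"
    and \<alpha>: "0 \<le> \<alpha>" and r: "certified n a \<alpha> r" and l: "certified n (tr a) \<alpha> l"
    and pad: "padded n p (narr s R) (narr s C) V E a"
    and W: "\<And>k. k < p \<Longrightarrow> rarr s 5 k = scaled a \<alpha> l r (narr s R k) (narr s C k)"
    and Q: "\<And>t. t \<le> D \<Longrightarrow> Q (s\<lparr>handle := (handle s)(0 := Some (n, t,
        slv (\<omega> (calls s)) (Matrix.mat n n (\<lambda>(i, j). scaled a \<alpha> l r i j)) \<delta>)), calls := Suc (calls s)\<rparr>)"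
  shows "runs T slv \<omega> (Build 0 (NVar 0) (NVar 3) R C 5 accuracy_exp) s (20 * B + D) Q"
proof -
  let ?S = "Matrix.mat n n (\<lambda>(i, j). scaled a \<alpha> l r i j)"
  have supp: "{(i, j). i < n \<and> j < n \<and> ?S $$ (i, j) \<noteq> 0} = {(i, j). i < n \<and> j < n \<and> (i = j \<or> a i j \<noteq> 0)}"
    using scaled_nonzero_iff[OF \<alpha> r l] by (intro Collect_cong) (simp add: split_beta cong: conj_cong)
  have bij: "bij_betw (\<lambda>k. (narr s R k, narr s C k)) {..<p} {(i, j). i < n \<and> j < n \<and> (i = j \<or> a i j \<noteq> 0)}"
    using pad unfolding padded_def by blast
  have acc: "rval accuracy_exp s = \<delta>"
    using K by (simp add: accuracy_exp_def accuracy_def power3_eq_cube mult.assoc)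
  have sp: "sparse_rep n p (narr s R) (narr s C) (rarr s 5) ?S"
    unfolding sparse_rep_def supp
    using bij W padded_bounds[OF pad] by auto
  have nnz: "nnz ?S = p"
    using bij_betw_same_card[OF bij] unfolding nnz_def using supp by simp
  note adm = scaled_admissible[OF \<alpha> r l]
  have t: "T (nnz ?S) n (cond_number ?S) \<delta> \<le> D" unfolding nnz by (rule D[OF pm adm(2,3)])
  have ex: "exec T slv \<omega> (Build 0 (NVar 0) (NVar 3) R C 5 accuracy_exp) s
      (real (1 + ncost (NVar 0) + ncost (NVar 3) + rcost accuracy_exp) + T (nnz ?S) n (cond_number ?S) \<delta>)
      (s\<lparr>handle := (handle s)(0 := Some (n, T (nnz ?S) n (cond_number ?S) \<delta>, slv (\<omega> (calls s)) ?S \<delta>)), calls := Suc (calls s)\<rparr>)"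
    by (rule exec.Build) (use n p acc delta_pos sp adm(1) in auto)
  show ?thesis
    by (rule runsI[OF ex]) (use t B1 Q[OF t] in \<open>auto simp: accuracy_exp_def\<close>)
qed

lemma runs_richardson:
  assumes n: "nvar s 0 = n" and p: "nvar s 3 = p" and K: "rvar s 1 = K" and pm: "p \<le> m + n"
    and \<alpha>: "0 \<le> rvar s 2" and r: "certified n a (rvar s 2) (rarr s r)" and l: "certified n (tr a) (rvar s 2) (rarr s l)"
    and pad: "padded n p (narr s R) (narr s C) (rarr s 3) (rarr s 4) a"
    and d: "r \<notin> {5, 8, 9, x}" "l \<notin> {5, 8, 9, x}" "x \<notin> {3, 4, 5, 8, 9}"
  shows "runs T slv \<omega> (richardson R C l r x) s (500 * B + 2 * D) (\<lambda>s'. same {5, 8, 9, x} s s' \<and> calls s' = Suc (calls s) \<and>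
    (\<forall>i<n. rarr s' x i = rstep slv \<delta> n a (rvar s 2) (rarr s l) (rarr s r) (rarr s x) (\<omega> (calls s)) i))"
    (is "runs _ _ _ _ _ _ ?Q")
proof -
  let ?c6 = "For 2 0 (RStore x (NVar 2) (RAdd (RGet x (NVar 2)) (RMul (RGet r (NVar 2)) (RGet 9 (NVar 2)))))"
  let ?c5 = "Seq (Apply 0 8 9) ?c6"
  let ?c4 = "Seq (Build 0 (NVar 0) (NVar 3) R C 5 accuracy_exp) ?c5"
  let ?c3 = "Seq (For 2 3 (RStore 5 (NVar 2) (RMul (RMul (RGet l (NGet R (NVar 2))) (RSub (RGet 4 (NVar 2)) (RMul (RDiv (RLit 1) (RAdd (RLit 1) (RVar 2))) (RGet 3 (NVar 2))))) (RGet r (NGet C (NVar 2)))))) ?c4"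
  let ?c2 = "Seq (For 2 0 (RStore 8 (NVar 2) (RMul (RGet l (NVar 2)) (RGet 8 (NVar 2))))) ?c3"
  have nB: "real n \<le> B" and pB: "real p \<le> B" using B pm by auto
  let ?res = "resid n a (1 / (1 + rvar s 2 / 2)) (rarr s x)"
  let ?S = "Matrix.mat n n (\<lambda>(i, j). scaled a (rvar s 2) (rarr s l) (rarr s r) i j)"
  \<comment> \<open>\<open>residual\<close> determines array 8 only below \<open>n\<close>;
    \<open>f\<close> stands for whatever it contains.\<close>
  let ?s1 = "\<lambda>f. s\<lparr>nvar := (nvar s)(2 := p), rarr := (rarr s)(8 := f)\<rparr>"
  let ?f2 = "\<lambda>f j. if j < n then rarr s l j * f j else f j"
  let ?s2 = "\<lambda>f. s\<lparr>nvar := (nvar s)(2 := n), rarr := (rarr s)(8 := ?f2 f)\<rparr>"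
  let ?W = "\<lambda>k. if k < p then scaled a (rvar s 2) (rarr s l) (rarr s r) (narr s R k) (narr s C k) else rarr s 5 k"
  let ?s3 = "\<lambda>f. s\<lparr>nvar := (nvar s)(2 := p), rarr := (rarr s)(8 := ?f2 f, 5 := ?W)\<rparr>"
  let ?Z = "slv (\<omega> (calls s)) ?S \<delta>"
  let ?s4 = "\<lambda>f t. (?s3 f)\<lparr>handle := (handle s)(0 := Some (n, t, ?Z)), calls := Suc (calls s)\<rparr>"
  let ?f5 = "\<lambda>f i. if i < n then vec_index (?Z (Matrix.vec n (?f2 f))) i else rarr s 9 i"
  let ?s5 = "\<lambda>f t. (?s4 f t)\<lparr>rarr := (rarr s)(8 := ?f2 f, 5 := ?W, 9 := ?f5 f)\<rparr>"
  show ?thesis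
    unfolding richardson_def
  proof (rule runs_Seq'[where \<rho> = "200 * B" and \<sigma> = "300 * B + 2 * D" and P = "\<lambda>s1. \<exists>f. (\<forall>i<n. f i = ?res i) \<and> s1 = ?s1 f"])
    show "runs T slv \<omega> (residual R C x) s (200 * B) (\<lambda>s1. \<exists>f. (\<forall>i<n. f i = ?res i) \<and> s1 = ?s1 f)"
      by (rule runs_residual[OF n p _ pad nB pB B1]) (use d in auto)
  next
    fix s1 assume "\<exists>f. (\<forall>i<n. f i = ?res i) \<and> s1 = ?s1 f"
    then obtain f where f: "\<And>i. i < n \<Longrightarrow> f i = ?res i" and s1: "s1 = ?s1 f" by blast
    have vec: "Matrix.vec n (?f2 f) = Matrix.vec n (\<lambda>i. rarr s l i * ?res i)" by (rule eq_vecI) (auto simp: f)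
    show "runs T slv \<omega> ?c2 s1
      (300 * B + 2 * D) ?Q"
    proof (rule runs_Seq'[where \<rho> = "50 * B" and \<sigma> = "250 * B + 2 * D" and P = "\<lambda>s2. s2 = ?s2 f"])
      show "runs T slv \<omega> (For 2 0 (RStore 8 (NVar 2) (RMul (RGet l (NVar 2)) (RGet 8 (NVar 2))))) s1 (50 * B) (\<lambda>s2. s2 = ?s2 f)"
        by (rule runs_mono[OF runs_map_loop[where N = n and h = "\<lambda>k y. rarr s l k * y"] loop_time])
          (use n d in \<open>auto simp: s1 fun_eq_iff\<close>)
    next
      fix s2 assume s2: "s2 = ?s2 f"
      show "runs T slv \<omega> ?c3 s2 (250 * B + 2 * D) ?Q"
      proof (rule runs_Seq'[where \<rho> = "100 * B" and \<sigma> = "150 * B + 2 * D" and P = "\<lambda>s3. s3 = ?s3 f"])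
        let ?e = "RMul (RMul (RGet l (NGet R (NVar 2)))
          (RSub (RGet 4 (NVar 2)) (RMul (RDiv (RLit 1) (RAdd (RLit 1) (RVar 2))) (RGet 3 (NVar 2)))))
          (RGet r (NGet C (NVar 2)))"
        have val: "rval ?e (s2\<lparr>nvar := (nvar s2)(2 := k), rarr := (rarr s2)(5 := g)\<rparr>) = ?W k" if k: "k < p" for k g
        proof -
          have "rarr s 3 k = a (narr s R k) (narr s C k)" "rarr s 4 k = (if narr s R k = narr s C k then 1 else 0)"
            using pad k unfolding padded_def by blast+
          then show ?thesis using k d by (simp add: s2 scaled_def)
        qed
        show "runs T slv \<omega> (For 2 3 (RStore 5 (NVar 2) ?e)) s2 (100 * B) (\<lambda>s3. s3 = ?s3 f)"
          by (rule runs_mono[OF runs_map_loop[where N = p and h = "\<lambda>k _. ?W k", OF _ _ val] loop_time])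
            (use p pm in \<open>auto simp: s2 fun_eq_iff\<close>)
      next
        fix s3 assume s3: "s3 = ?s3 f"
        show "runs T slv \<omega> ?c4 s3 (150 * B + 2 * D) ?Q"
        proof (rule runs_Seq'[where \<rho> = "20 * B + D" and \<sigma> = "130 * B + D" and P = "\<lambda>s4. \<exists>t\<le>D. s4 = ?s4 f t"])
          show "runs T slv \<omega> (Build 0 (NVar 0) (NVar 3) R C 5 accuracy_exp) s3 (20 * B + D) (\<lambda>s4. \<exists>t\<le>D. s4 = ?s4 f t)"
            by (rule runs_build[OF _ _ _ pm \<alpha> r l, where V = "rarr s 3" and E = "rarr s 4"])
              (use n p K pad in \<open>auto simp: s3\<close>)
        next
          fix s4 assume "\<exists>t\<le>D. s4 = ?s4 f t"
          then obtain t where t: "t \<le> D" and s4: "s4 = ?s4 f t" by blast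
          show "runs T slv \<omega> ?c5 s4 (130 * B + D) ?Q"
          proof (rule runs_Seq'[where \<rho> = "B + D" and \<sigma> = "100 * B" and P = "\<lambda>s5. s5 = ?s5 f t"])
            show "runs T slv \<omega> (Apply 0 8 9) s4 (B + D) (\<lambda>s5. s5 = ?s5 f t)"
              by (rule runsI[OF exec.Apply[where n = n and t = t and Z = ?Z]]) (use t B1 in \<open>simp_all add: s4 cong: if_cong\<close>)
          next
            fix s5 assume s5: "s5 = ?s5 f t"
            show "runs T slv \<omega> ?c6 s5 (100 * B) ?Q"
              by (rule runs_mono[OF runs_map_loop[where N = n and h = "\<lambda>k y. y + rarr s r k * ?f5 f k"] loop_time])
                (use n d in \<open>auto simp: s5 same_def rstep_def vec\<close>)
          qed (use B1 in simp)
        qed (use B1 in simp)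
      qed (use B1 in simp)
    qed (use B1 in simp)
  qed (use B1 in simp)
qed

lemma runs_check:
  assumes n: "nvar s 0 = n" and p: "nvar s 3 = p" and pm: "p \<le> m + n"
    and pad: "padded n p (narr s R) (narr s C) (rarr s 3) (rarr s 4) a" and x: "x \<noteq> 8"
  shows "runs T slv \<omega> (check R C x) s (300 * B) (\<lambda>s'. same {8} s (s'\<lparr>rvar := rvar s\<rparr>) \<and> calls s' = calls s \<and>
    rvar s' = (rvar s)(5 := if certified n a (rvar s 2 / 2) (rarr s x) then rvar s 5 else 1))"
    (is "runs _ _ _ _ _ _ ?Q")
  unfolding check_def
proof (rule runs_Seq'[where \<rho> = "200 * B" and \<sigma> = "100 * B" and P = "\<lambda>s1. \<exists>f.
      (\<forall>i<n. f i = resid n a (1 / (1 + rvar s 2 / 2)) (rarr s x) i) \<and> s1 = s\<lparr>nvar := (nvar s)(2 := p), rarr := (rarr s)(8 := f)\<rparr>"])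
  show "runs T slv \<omega> (residual R C x) s (200 * B) (\<lambda>s1. \<exists>f.
      (\<forall>i<n. f i = resid n a (1 / (1 + rvar s 2 / 2)) (rarr s x) i) \<and> s1 = s\<lparr>nvar := (nvar s)(2 := p), rarr := (rarr s)(8 := f)\<rparr>)"
    by (rule runs_residual[OF n p x pad _ _ B1]) (use B pm in auto)
next
  fix s1 assume "\<exists>f. (\<forall>i<n. f i = resid n a (1 / (1 + rvar s 2 / 2)) (rarr s x) i) \<and> s1 = s\<lparr>nvar := (nvar s)(2 := p), rarr := (rarr s)(8 := f)\<rparr>"
  then obtain f where f: "\<And>i. i < n \<Longrightarrow> f i = resid n a (1 / (1 + rvar s 2 / 2)) (rarr s x) i"
    and s1: "s1 = s\<lparr>nvar := (nvar s)(2 := p), rarr := (rarr s)(8 := f)\<rparr>" by blast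
  define G where "G k \<longleftrightarrow> (\<forall>i<k. \<bar>f i\<bar> \<le> 1 / 2)" for k
  have G: "G 0" "G (Suc k) \<longleftrightarrow> G k \<and> \<bar>f k\<bar> \<le> 1 / 2" "G n \<longleftrightarrow> certified n a (rvar s 2 / 2) (rarr s x)" for k
    using f by (auto simp: G_def certified_def less_Suc_eq)
  let ?st = "\<lambda>k. s\<lparr>nvar := (nvar s)(2 := k), rarr := (rarr s)(8 := f), rvar := (rvar s)(5 := if G k then rvar s 5 else 1)\<rparr>"
  let ?c = "If (BAnd (BNot (RLess (RDiv (RLit 1) (RLit 2)) (RGet 8 (NVar 2))))
                     (BNot (RLess (RGet 8 (NVar 2)) (RDiv (RLit (- 1)) (RLit 2)))))
              Skip (RAssign 5 (RLit 1))"
  show "runs T slv \<omega> (For 2 0 ?c) s1 (100 * B) ?Q"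
  proof (rule runs_mono[OF runs_For[where N = n and \<tau> = 30 and I = "\<lambda>k s'. s' = ?st k"] loop_time])
    fix k s' assume s': "s' = ?st k" and k: "k < n"
    show "runs T slv \<omega> ?c s' 30 (\<lambda>s'. nvar s' 2 = k \<and> nvar s' 0 = n \<and> s'\<lparr>nvar := (nvar s')(2 := Suc k)\<rparr> = ?st (Suc k))"
    proof (rule runs_If[where \<tau> = 2])
      assume "bval (BAnd (BNot (RLess (RDiv (RLit 1) (RLit 2)) (RGet 8 (NVar 2))))
                     (BNot (RLess (RGet 8 (NVar 2)) (RDiv (RLit (- 1)) (RLit 2))))) s'"
      then have "\<not> 1 / 2 < f k \<and> \<not> f k < - 1 / 2" by (simp add: s')
      then have "\<bar>f k\<bar> \<le> 1 / 2" by linarith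
      then have "G (Suc k) = G k" by (simp only: G simp_thms)
      then show "runs T slv \<omega> Skip s' 2 (\<lambda>s'. nvar s' 2 = k \<and> nvar s' 0 = n \<and> s'\<lparr>nvar := (nvar s')(2 := Suc k)\<rparr> = ?st (Suc k))"
        using n by (intro runs_Skip) (simp_all add: s')
    next
      assume "\<not> bval (BAnd (BNot (RLess (RDiv (RLit 1) (RLit 2)) (RGet 8 (NVar 2))))
                     (BNot (RLess (RGet 8 (NVar 2)) (RDiv (RLit (- 1)) (RLit 2))))) s'"
      then have "\<not> (\<not> 1 / 2 < f k \<and> \<not> f k < - 1 / 2)" by (simp add: s')
      then have "\<not> \<bar>f k\<bar> \<le> 1 / 2" by linarith
      then have "\<not> G (Suc k)" by (simp only: G simp_thms not_False_eq_True)
      then show "runs T slv \<omega> (RAssign 5 (RLit 1)) s' 2 (\<lambda>s'. nvar s' 2 = k \<and> nvar s' 0 = n \<and> s'\<lparr>nvar := (nvar s')(2 := Suc k)\<rparr> = ?st (Suc k))"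
        using n by (intro runs_RAssign) (simp_all add: s')
    qed simp
  next
    fix s' assume "s' = ?st n \<and> nvar s' 2 = n \<and> nvar s' 0 = n"
    then show "?Q s'" using G(3) by (auto simp: same_def)
  qed (use n G(1) in \<open>auto simp: s1\<close>)
qed (use B1 in simp)

end

section \<open>One phase of the algorithm as a program\<close>

fun rpow :: "rexp \<Rightarrow> nat \<Rightarrow> rexp" where
  "rpow e 0 = RLit 1"
| "rpow e (Suc k) = RMul e (rpow e k)"

lemma rval_rpow: "rval (rpow e k) s = rval e s ^ k"
  by (induction k) auto

text \<open>\<open>P\<close> is fixed with the program, so the unrolled power has constant cost. The
  factor 24 is 6 times 4: the number of phases is at most \<open>6 * K\<^sup>2\<close>, and each
  fails with probability at most \<open>4 * K * sqrt n * (2 / 3) ^ k\<close>.\<close>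

definition budget_exp :: "nat \<Rightarrow> rexp" where
  "budget_exp P = RMul (RLit 24) (rpow (RMul (RNat (NVar 0)) (RVar 1)) P)"

text \<open>After \<open>k\<close> steps per phase, the algorithm fails with probability at most
  \<open>24 K\<^sup>3 n (2 / 3)\<^sup>k\<close>; variable 4 makes this at most \<open>n\<^sup>-\<^sup>c\<close> for \<open>P \<ge> c + 3\<close>.\<close>

definition refine :: "nat \<Rightarrow> com" where
  "refine P = Seq (For 2 0 (RStore 6 (NVar 2) (RLit 0))) (Seq (For 2 0 (RStore 7 (NVar 2) (RLit 0)))
     (Seq (RAssign 4 (budget_exp P))
       (While (RLess (RLit 1) (RVar 4))
         (Seq (richardson 2 3 1 2 6) (Seq (richardson 3 2 2 1 7) (RAssign 4 (RDiv (RMul (RVar 4) (RLit 2)) (RLit 3))))))))"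

definition accept :: com where
  "accept = Seq (RAssign 5 (RLit 0)) (Seq (check 2 3 6) (Seq (check 3 2 7)
     (If (RLess (RVar 5) (RLit 1))
       (Seq (RAssign 2 (RDiv (RVar 2) (RLit 2))) (Seq (For 2 0 (RStore 1 (NVar 2) (RGet 7 (NVar 2))))
         (For 2 0 (RStore 2 (NVar 2) (RGet 6 (NVar 2))))))
       Skip)))"

text \<open>Variable 3 is halved whether or not the candidates were accepted. The guard of the main
  loop looks at this schedule only, so the number of rounds is the same for every seed
  sequence.\<close>

definition attempt :: "nat \<Rightarrow> com" where
  "attempt P = Seq (refine P) (Seq accept (RAssign 3 (RDiv (RVar 3) (RLit 2))))"

text \<open>The number of rounds of the loop in \<open>refine\<close>. The language has no
  logarithm; shrinking the budget by 2/3 until it is at most 1 counts the steps by exact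
  comparison.\<close>

definition steps :: "real \<Rightarrow> nat" where
  "steps W = (LEAST k. \<not> 1 < W * (2 / 3) ^ k)"

lemma steps_stop: "\<not> 1 < W * (2 / 3) ^ steps W"
  unfolding steps_def
proof (rule LeastI_ex)
  have "(\<lambda>k. W * (2 / 3) ^ k) \<longlonglongrightarrow> W * 0" by (intro tendsto_mult tendsto_const LIMSEQ_power_zero) auto
  then have "eventually (\<lambda>k. W * (2 / 3) ^ k < 1) sequentially" by (rule order_tendstoD(2)) simp
  then show "\<exists>k. \<not> 1 < W * (2 / 3) ^ k" by (auto simp: eventually_sequentially intro: less_asym)
qed

lemma steps_continue: "k < steps W \<Longrightarrow> 1 < W * (2 / 3) ^ k"
  unfolding steps_def using not_less_Least by blast

lemma riter_cong_scalings:
  assumes "\<And>i. i < n \<Longrightarrow> l i = l' i" "\<And>i. i < n \<Longrightarrow> r i = r' i" "i < n"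
  shows "riter slv \<delta> n a \<alpha> l r \<sigma> k i = riter slv \<delta> n a \<alpha> l' r' \<sigma> k i"
  using assms(3)
proof (induction k arbitrary: i)
  case (Suc k) then show ?case using assms(1,2) by (simp only: riter.simps) (intro rstep_cong)
qed simp

context execution
begin

definition inputs :: "nat \<Rightarrow> state \<Rightarrow> bool" where
  "inputs p s \<longleftrightarrow> nvar s 0 = n \<and> nvar s 3 = p \<and> p \<le> m + n \<and> rvar s 1 = K \<and>
     padded n p (narr s 2) (narr s 3) (rarr s 3) (rarr s 4) a"

definition keeps :: "state \<Rightarrow> state \<Rightarrow> bool" where
  "keeps s s' \<longleftrightarrow> narr s' = narr s \<and> nvar s' 0 = nvar s 0 \<and> nvar s' 3 = nvar s 3 \<and>
     rarr s' 3 = rarr s 3 \<and> rarr s' 4 = rarr s 4 \<and> rvar s' 0 = rvar s 0 \<and> rvar s' 1 = rvar s 1"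

lemma keeps_inputs: "keeps s s' \<Longrightarrow> inputs p s \<Longrightarrow> inputs p s'"
  by (simp add: keeps_def inputs_def)

lemma runs_refine:
  fixes P :: nat
  defines "k \<equiv> steps (24 * (real n * K) ^ P)"
  assumes I: "inputs p s" and \<alpha>: "0 \<le> rvar s 2" and r: "certified n a (rvar s 2) (rarr s 2)" and l: "certified n (tr a) (rvar s 2) (rarr s 1)"
  shows "runs T slv \<omega> (refine P) s (real k * (1100 * B + 4 * D) + (110 + real (rcost (budget_exp P))) * B) (\<lambda>s'.
    keeps s s' \<and> rvar s' 2 = rvar s 2 \<and> rvar s' 3 = rvar s 3 \<and> rarr s' 1 = rarr s 1 \<and> rarr s' 2 = rarr s 2 \<and> calls s' = calls s + 2 * k \<and>
    (\<forall>i<n. rarr s' 6 i = riter slv \<delta> n a (rvar s 2) (rarr s 1) (rarr s 2) (\<lambda>i. \<omega> (calls s + 2 * i)) k i) \<and>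
    (\<forall>i<n. rarr s' 7 i = riter slv \<delta> n (tr a) (rvar s 2) (rarr s 2) (rarr s 1) (\<lambda>i. \<omega> (calls s + 2 * i + 1)) k i))"
proof -
  interpret X: execution n "tr a" K ls rs M slv T m B D by (rule transposed_execution)
  define W where "W = 24 * (real n * K) ^ P"
  let ?x = "\<lambda>q. riter slv \<delta> n a (rvar s 2) (rarr s 1) (rarr s 2) (\<lambda>i. \<omega> (calls s + 2 * i)) q"
  let ?y = "\<lambda>q. riter slv \<delta> n (tr a) (rvar s 2) (rarr s 2) (rarr s 1) (\<lambda>i. \<omega> (calls s + 2 * i + 1)) q"
  \<comment> \<open>Two seeds per round, counted from \<open>calls s\<close>: the even ones drive
    array 6, the odd ones array 7. Arrays 1 and 2 stay fixed, so all builds of a phase use the same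
    scalings.\<close>
  let ?J = "\<lambda>q s'. keeps s s' \<and> rvar s' 2 = rvar s 2 \<and> rvar s' 3 = rvar s 3 \<and> rvar s' 4 = W * (2 / 3) ^ q \<and>
     rarr s' 1 = rarr s 1 \<and> rarr s' 2 = rarr s 2 \<and> calls s' = calls s + 2 * q \<and>
    (\<forall>i<n. rarr s' 6 i = ?x q i) \<and> (\<forall>i<n. rarr s' 7 i = ?y q i)"
  let ?body = "Seq (richardson 2 3 1 2 6) (Seq (richardson 3 2 2 1 7) (RAssign 4 (RDiv (RMul (RVar 4) (RLit 2)) (RLit 3))))"
  have n: "nvar s 0 = n" and K: "rvar s 1 = K" using I by (auto simp: inputs_def)
  have body: "runs T slv \<omega> ?body s1 (1010 * B + 4 * D) (?J (Suc q))" if J: "?J q s1" for q s1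
  proof (rule runs_Seq'[OF runs_richardson])
    have I1: "inputs p s1" using keeps_inputs I J by blast
    show "nvar s1 0 = n" "nvar s1 3 = p" "rvar s1 1 = K" "p \<le> m + n" "0 \<le> rvar s1 2"
      "padded n p (narr s1 2) (narr s1 3) (rarr s1 3) (rarr s1 4) a"
      "certified n a (rvar s1 2) (rarr s1 2)" "certified n (tr a) (rvar s1 2) (rarr s1 1)"
      using I1 J \<alpha> r l by (auto simp: inputs_def)
    fix s2 assume s2: "same {5, 8, 9, 6} s1 s2 \<and> calls s2 = Suc (calls s1) \<and>
      (\<forall>i<n. rarr s2 6 i = rstep slv \<delta> n a (rvar s1 2) (rarr s1 1) (rarr s1 2) (rarr s1 6) (\<omega> (calls s1)) i)"
    have k2: "keeps s1 s2" using s2 by (simp add: same_def keeps_def)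
    have I2: "inputs p s2" using keeps_inputs k2 I1 by blast
    have a2: "rarr s2 1 = rarr s 1" "rarr s2 2 = rarr s 2" "rarr s2 7 = rarr s1 7" "rvar s2 = rvar s1"
      using s2 J by (auto simp: same_def)
    have x2: "rarr s2 6 i = ?x (Suc q) i" if i: "i < n" for i
    proof -
      have "rarr s2 6 i = rstep slv \<delta> n a (rvar s 2) (rarr s 1) (rarr s 2) (rarr s1 6) (\<omega> (calls s + 2 * q)) i"
        using s2 J i by simp
      also have "\<dots> = rstep slv \<delta> n a (rvar s 2) (rarr s 1) (rarr s 2) (?x q) (\<omega> (calls s + 2 * q)) i"
        using J i by (intro rstep_cong) auto
      finally show ?thesis by simp
    qed
    show "runs T slv \<omega> (Seq (richardson 3 2 2 1 7) (RAssign 4 (RDiv (RMul (RVar 4) (RLit 2)) (RLit 3)))) s2 (510 * B + 2 * D) (?J (Suc q))"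
    proof (rule runs_Seq'[OF X.runs_richardson])
      show "nvar s2 0 = n" "nvar s2 3 = p" "rvar s2 1 = K" "p \<le> m + n" "0 \<le> rvar s2 2"
        "certified n a (rvar s2 2) (rarr s2 2)" "certified n (tr a) (rvar s2 2) (rarr s2 1)"
        using I2 J \<alpha> r l a2 by (auto simp: inputs_def)
      show "padded n p (narr s2 3) (narr s2 2) (rarr s2 3) (rarr s2 4) (tr a)"
        using I2 by - (rule padded_tr, simp add: inputs_def)
      fix s3 assume s3: "same {5, 8, 9, 7} s2 s3 \<and> calls s3 = Suc (calls s2) \<and>
        (\<forall>i<n. rarr s3 7 i = rstep slv \<delta> n (tr a) (rvar s2 2) (rarr s2 2) (rarr s2 1) (rarr s2 7) (\<omega> (calls s2)) i)"
      have k3: "keeps s2 s3" using s3 by (simp add: same_def keeps_def)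
      have a3: "rarr s3 1 = rarr s 1" "rarr s3 2 = rarr s 2" "rarr s3 6 = rarr s2 6" "rvar s3 = rvar s1"
        using s3 a2 by (auto simp: same_def)
      have y3: "rarr s3 7 i = ?y (Suc q) i" if i: "i < n" for i
      proof -
        have "rarr s3 7 i = rstep slv \<delta> n (tr a) (rvar s 2) (rarr s 2) (rarr s 1) (rarr s1 7) (\<omega> (calls s + 2 * q + 1)) i"
          using s2 s3 J i a2 by simp
        also have "\<dots> = rstep slv \<delta> n (tr a) (rvar s 2) (rarr s 2) (rarr s 1) (?y q) (\<omega> (calls s + 2 * q + 1)) i"
          using J i by (intro rstep_cong) auto
        finally show ?thesis by simp
      qed
      have kk: "keeps s s3" using J k2 k3 by (simp add: keeps_def)
      show "runs T slv \<omega> (RAssign 4 (RDiv (RMul (RVar 4) (RLit 2)) (RLit 3))) s3 (10 * B) (?J (Suc q))"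
      proof (rule runs_RAssign)
        show "?J (Suc q) (s3\<lparr>rvar := (rvar s3)(4 := rval (RDiv (RMul (RVar 4) (RLit 2)) (RLit 3)) s3)\<rparr>)"
          using kk x2 y3 a3 J s2 s3 by (simp add: keeps_def del: riter.simps)
      qed (use B1 in simp)
    qed auto
  qed auto
  have loop: "runs T slv \<omega> (While (RLess (RLit 1) (RVar 4)) ?body) s1 (real k * (1100 * B + 4 * D) + 4 * B) (?J k)"
    if J: "?J 0 s1" for s1
  proof (rule runs_mono[OF runs_While[where I = ?J and N = k and \<tau> = "1010 * B + 4 * D"]])
    fix q t assume t: "?J q t" "q < k"
    have "bval (RLess (RLit 1) (RVar 4)) t" using t steps_continue[of q W] by (simp add: k_def W_def)
    then show "bval (RLess (RLit 1) (RVar 4)) t \<and> runs T slv \<omega> ?body t (1010 * B + 4 * D) (?J (Suc q))"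
      using body[OF t(1)] by (rule conjI)
  next
    fix s' assume "?J k s'"
    then show "\<not> bval (RLess (RLit 1) (RVar 4)) s'" using steps_stop[of W] by (simp add: k_def W_def)
  next
    have "real (1 + bcost (RLess (RLit 1) (RVar 4))) + (1010 * B + 4 * D) \<le> 1100 * B + 4 * D" using B1 by simp
    then have "real k * (real (1 + bcost (RLess (RLit 1) (RVar 4))) + (1010 * B + 4 * D)) \<le> real k * (1100 * B + 4 * D)"
      by (rule mult_left_mono) simp
    then show "real k * (real (1 + bcost (RLess (RLit 1) (RVar 4))) + (1010 * B + 4 * D)) +
        real (1 + bcost (RLess (RLit 1) (RVar 4))) \<le> real k * (1100 * B + 4 * D) + 4 * B"
      using B1 by simp
  qed (use J in auto)
  let ?s1 = "s\<lparr>nvar := (nvar s)(2 := n), rarr := (rarr s)(6 := (\<lambda>j. if j < n then 0 else rarr s 6 j))\<rparr>"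
  let ?s2 = "s\<lparr>nvar := (nvar s)(2 := n), rarr := (rarr s)(6 := (\<lambda>j. if j < n then 0 else rarr s 6 j),
     7 := (\<lambda>j. if j < n then 0 else rarr s 7 j))\<rparr>"
  show ?thesis
    unfolding refine_def
  proof (rule runs_Seq'[where \<rho> = "50 * B" and P = "\<lambda>s1. s1 = ?s1"])
    show "runs T slv \<omega> (For 2 0 (RStore 6 (NVar 2) (RLit 0))) s (50 * B) (\<lambda>s1. s1 = ?s1)"
      by (rule runs_mono[OF runs_map_loop[where N = n and h = "\<lambda>_ _. 0"] loop_time]) (use n in \<open>auto simp: fun_eq_iff\<close>)
  next
    fix s1 assume s1: "s1 = ?s1"
    show "runs T slv \<omega> (Seq (For 2 0 (RStore 7 (NVar 2) (RLit 0))) (Seq (RAssign 4 (budget_exp P)) (While (RLess (RLit 1) (RVar 4)) ?body)))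
      s1 (real k * (1100 * B + 4 * D) + (60 + real (rcost (budget_exp P))) * B) (\<lambda>s'.
    keeps s s' \<and> rvar s' 2 = rvar s 2 \<and> rvar s' 3 = rvar s 3 \<and> rarr s' 1 = rarr s 1 \<and> rarr s' 2 = rarr s 2 \<and> calls s' = calls s + 2 * k \<and>
    (\<forall>i<n. rarr s' 6 i = ?x k i) \<and> (\<forall>i<n. rarr s' 7 i = ?y k i))"
    proof (rule runs_Seq'[where \<rho> = "50 * B" and P = "\<lambda>s2. s2 = ?s2"])
      show "runs T slv \<omega> (For 2 0 (RStore 7 (NVar 2) (RLit 0))) s1 (50 * B) (\<lambda>s2. s2 = ?s2)"
        by (rule runs_mono[OF runs_map_loop[where N = n and h = "\<lambda>_ _. 0"] loop_time]) (use n in \<open>auto simp: s1 fun_eq_iff\<close>)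
    next
      fix s2 assume s2: "s2 = ?s2"
      show "runs T slv \<omega> (Seq (RAssign 4 (budget_exp P)) (While (RLess (RLit 1) (RVar 4)) ?body))
        s2 (real k * (1100 * B + 4 * D) + (5 + real (rcost (budget_exp P))) * B) (\<lambda>s'.
          keeps s s' \<and> rvar s' 2 = rvar s 2 \<and> rvar s' 3 = rvar s 3 \<and> rarr s' 1 = rarr s 1 \<and> rarr s' 2 = rarr s 2 \<and> calls s' = calls s + 2 * k \<and>
          (\<forall>i<n. rarr s' 6 i = ?x k i) \<and> (\<forall>i<n. rarr s' 7 i = ?y k i))"
      proof (rule runs_Seq'[where P = "?J 0"])
        have "(1 + real (rcost (budget_exp P))) * 1 \<le> (1 + real (rcost (budget_exp P))) * B" using B1 by (intro mult_left_mono) auto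
        then show "runs T slv \<omega> (RAssign 4 (budget_exp P)) s2 ((1 + real (rcost (budget_exp P))) * B) (?J 0)"
          by (intro runs_RAssign) (simp_all add: s2 keeps_def budget_exp_def rval_rpow W_def n K[unfolded One_nat_def])
        fix s3 assume "?J 0 s3"
        from loop[OF this] show "runs T slv \<omega> (While (RLess (RLit 1) (RVar 4)) ?body) s3 (real k * (1100 * B + 4 * D) + 4 * B) (\<lambda>s'.
          keeps s s' \<and> rvar s' 2 = rvar s 2 \<and> rvar s' 3 = rvar s 3 \<and> rarr s' 1 = rarr s 1 \<and> rarr s' 2 = rarr s 2 \<and> calls s' = calls s + 2 * k \<and>
          (\<forall>i<n. rarr s' 6 i = ?x k i) \<and> (\<forall>i<n. rarr s' 7 i = ?y k i))"
          by (rule runs_mono) auto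
      qed (simp add: algebra_simps)
    qed (use B1 in \<open>simp add: algebra_simps\<close>)
  qed (use B1 in \<open>simp add: algebra_simps\<close>)
qed

lemma runs_accept:
  assumes I: "inputs p s"
  defines "good \<equiv> certified n a (rvar s 2 / 2) (rarr s 6) \<and> certified n (tr a) (rvar s 2 / 2) (rarr s 7)"
  shows "runs T slv \<omega> accept s (800 * B) (\<lambda>s'. keeps s s' \<and> calls s' = calls s \<and> rvar s' 3 = rvar s 3 \<and>
    rvar s' 2 = (if good then rvar s 2 / 2 else rvar s 2) \<and>
    (\<forall>i<n. rarr s' 1 i = (if good then rarr s 7 i else rarr s 1 i)) \<and>
    (\<forall>i<n. rarr s' 2 i = (if good then rarr s 6 i else rarr s 2 i)))" (is "runs _ _ _ _ _ _ ?Q")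
proof -
  let ?c4 = "If (RLess (RVar 5) (RLit 1)) (Seq (RAssign 2 (RDiv (RVar 2) (RLit 2))) (Seq (For 2 0 (RStore 1 (NVar 2) (RGet 7 (NVar 2)))) (For 2 0 (RStore 2 (NVar 2) (RGet 6 (NVar 2)))))) Skip"
  let ?c3 = "Seq (check 3 2 7) ?c4"
  let ?c2 = "Seq (check 2 3 6) ?c3"
  interpret X: execution n "tr a" K ls rs M slv T m B D by (rule transposed_execution)
  show ?thesis
    unfolding accept_def
  proof (rule runs_Seq'[where \<rho> = "2 * B" and \<sigma> = "790 * B" and P = "\<lambda>s1. s1 = s\<lparr>rvar := (rvar s)(5 := 0)\<rparr>"])
    show "runs T slv \<omega> (RAssign 5 (RLit 0)) s (2 * B) (\<lambda>s1. s1 = s\<lparr>rvar := (rvar s)(5 := 0)\<rparr>)"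
      using B1 by (intro runs_RAssign) auto
  next
    fix s1 assume s1: "s1 = s\<lparr>rvar := (rvar s)(5 := 0)\<rparr>"
    show "runs T slv \<omega> ?c2 s1 (790 * B) ?Q"
    proof (rule runs_Seq'[OF runs_check[where p = p]])
      show "nvar s1 0 = n" "nvar s1 3 = p" "p \<le> m + n" "padded n p (narr s1 2) (narr s1 3) (rarr s1 3) (rarr s1 4) a"
        using I by (auto simp: s1 inputs_def)
      fix s2 assume s2: "same {8} s1 (s2\<lparr>rvar := rvar s1\<rparr>) \<and> calls s2 = calls s1 \<and>
        rvar s2 = (rvar s1)(5 := if certified n a (rvar s1 2 / 2) (rarr s1 6) then rvar s1 5 else 1)"
      show "runs T slv \<omega> ?c3 s2 (490 * B) ?Q"
      proof (rule runs_Seq'[OF X.runs_check[where p = p]])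
        have "padded n p (narr s 2) (narr s 3) (rarr s 3) (rarr s 4) a" using I by (simp add: inputs_def)
        then show "padded n p (narr s2 3) (narr s2 2) (rarr s2 3) (rarr s2 4) (tr a)"
          using s2 s1 by - (rule padded_tr, simp add: same_def)
        show "nvar s2 0 = n" "nvar s2 3 = p" "p \<le> m + n"
          using I s2 by (auto simp: s1 inputs_def same_def)
        fix s3 assume s3: "same {8} s2 (s3\<lparr>rvar := rvar s2\<rparr>) \<and> calls s3 = calls s2 \<and>
          rvar s3 = (rvar s2)(5 := if certified n (tr a) (rvar s2 2 / 2) (rarr s2 7) then rvar s2 5 else 1)"
        \<comment> \<open>Variable 2 keeps its old value until both checks are done, since
          \<open>residual\<close> tests at half of it.\<close>
        have r3: "rvar s3 = (rvar s)(5 := if good then 0 else 1)"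
          using s2 s3 by (auto simp: s1 good_def same_def)
        have a3: "rarr s3 b = rarr s b" if "b \<noteq> 8" for b using s2 s3 that by (auto simp: s1 same_def)
        have o3: "narr s3 = narr s" "calls s3 = calls s" "nvar s3 0 = n" "nvar s3 3 = nvar s 3" "nvar s 0 = n"
          using s2 s3 I by (auto simp: s1 same_def inputs_def)
        show "runs T slv \<omega> ?c4 s3 (190 * B) ?Q"
        proof (rule runs_If[where \<tau> = "180 * B"])
          assume "\<not> bval (RLess (RVar 5) (RLit 1)) s3"
          then have "\<not> good" by (auto simp: r3)
          then show "runs T slv \<omega> Skip s3 (180 * B) ?Q" using B1 a3 o3 by (intro runs_Skip) (simp_all add: keeps_def r3)
        next
          assume "bval (RLess (RVar 5) (RLit 1)) s3"
          then have g: good by (auto simp: r3 split: if_splits)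
          let ?s4 = "s3\<lparr>rvar := (rvar s3)(2 := rvar s 2 / 2)\<rparr>"
          let ?s5 = "?s4\<lparr>nvar := (nvar s3)(2 := n), rarr := (rarr s3)(1 := (\<lambda>j. if j < n then rarr s 7 j else rarr s3 1 j))\<rparr>"
          show "runs T slv \<omega> (Seq (RAssign 2 (RDiv (RVar 2) (RLit 2))) (Seq (For 2 0 (RStore 1 (NVar 2) (RGet 7 (NVar 2))))
            (For 2 0 (RStore 2 (NVar 2) (RGet 6 (NVar 2)))))) s3 (180 * B) ?Q"
          proof (rule runs_Seq'[where \<rho> = "5 * B" and \<sigma> = "100 * B" and P = "\<lambda>s4. s4 = ?s4"])
            show "runs T slv \<omega> (RAssign 2 (RDiv (RVar 2) (RLit 2))) s3 (5 * B) (\<lambda>s4. s4 = ?s4)"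
              using B1 by (intro runs_RAssign) (simp_all add: r3)
          next
            fix s4 assume s4: "s4 = ?s4"
            show "runs T slv \<omega> (Seq (For 2 0 (RStore 1 (NVar 2) (RGet 7 (NVar 2)))) (For 2 0 (RStore 2 (NVar 2) (RGet 6 (NVar 2))))) s4 (100 * B) ?Q"
            proof (rule runs_Seq'[where \<rho> = "50 * B" and \<sigma> = "50 * B" and P = "\<lambda>s5. s5 = ?s5"])
              show "runs T slv \<omega> (For 2 0 (RStore 1 (NVar 2) (RGet 7 (NVar 2)))) s4 (50 * B) (\<lambda>s5. s5 = ?s5)"
                by (rule runs_mono[OF runs_map_loop[where N = n and h = "\<lambda>i _. rarr s 7 i"] loop_time])
                  (use o3 a3 in \<open>simp_all add: s4 cong: if_cong\<close>)
            next
              fix s5 assume s5: "s5 = ?s5"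
              show "runs T slv \<omega> (For 2 0 (RStore 2 (NVar 2) (RGet 6 (NVar 2)))) s5 (50 * B) ?Q"
                by (rule runs_mono[OF runs_map_loop[where N = n and h = "\<lambda>i _. rarr s 6 i"] loop_time])
                  (use o3 a3 g in \<open>simp_all add: s5 r3 keeps_def\<close>)
            qed simp
          qed (use B1 in simp)
        qed (use B1 in simp)
      qed simp_all
    qed simp_all
  qed (use B1 in simp)
qed

text \<open>After \<open>j\<close> attempts the state mirrors \<open>phases\<close> on the same
  seeds. Variable 2 follows the certified \<alpha>, which may lag behind the schedule in variable 3;
  \<open>calls\<close> locates the next block of seeds.\<close>

definition phase_inv :: "real \<Rightarrow> nat \<Rightarrow> nat \<Rightarrow> real \<Rightarrow> (nat \<Rightarrow> 'w) \<Rightarrow> nat \<Rightarrow> state \<Rightarrow> bool" where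
  "phase_inv \<epsilon> p k \<alpha>\<^sub>0 \<omega> j s \<longleftrightarrow> inputs p s \<and> rvar s 0 = \<epsilon> \<and> rvar s 2 = alpha_at \<alpha>\<^sub>0 k j \<omega> \<and> rvar s 3 = \<alpha>\<^sub>0 / 2 ^ j \<and>
     calls s = 2 * k * j \<and> (\<forall>i<n. rarr s 1 i = left_at \<alpha>\<^sub>0 k j \<omega> i) \<and> (\<forall>i<n. rarr s 2 i = right_at \<alpha>\<^sub>0 k j \<omega> i)"

lemma runs_attempt:
  fixes P :: nat
  defines "k \<equiv> steps (24 * (real n * K) ^ P)"
  assumes start: "0 < \<alpha>\<^sub>0" "certified n a \<alpha>\<^sub>0 (\<lambda>_. 1)" "certified n (tr a) \<alpha>\<^sub>0 (\<lambda>_. 1)"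
    and I: "phase_inv \<epsilon> p k \<alpha>\<^sub>0 \<omega> j s"
  shows "runs T slv \<omega> (attempt P) s (real k * (1100 * B + 4 * D) + (920 + real (rcost (budget_exp P))) * B) (phase_inv \<epsilon> p k \<alpha>\<^sub>0 \<omega> (Suc j))"
proof -
  have inp: "inputs p s" using I by (simp add: phase_inv_def)
  have \<alpha>: "rvar s 2 = alpha_at \<alpha>\<^sub>0 k j \<omega>" and c: "calls s = 2 * k * j" using I by (auto simp: phase_inv_def)
  have li: "rarr s 1 i = left_at \<alpha>\<^sub>0 k j \<omega> i" and ri: "rarr s 2 i = right_at \<alpha>\<^sub>0 k j \<omega> i" if "i < n" for i
    using I that by (auto simp: phase_inv_def)
  note inv = phase_at_invariant[OF start, where k = k and j = j and \<omega> = \<omega>]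
  have pos: "0 \<le> rvar s 2" using inv(1) \<alpha> by simp
  have r: "certified n a (rvar s 2) (rarr s 2)" using inv(2) certified_cong[of n "rarr s 2" "right_at \<alpha>\<^sub>0 k j \<omega>"] ri unfolding \<alpha> by blast
  have l: "certified n (tr a) (rvar s 2) (rarr s 1)" using inv(3) certified_cong[of n "rarr s 1" "left_at \<alpha>\<^sub>0 k j \<omega>"] li unfolding \<alpha> by blast
  show ?thesis
    unfolding attempt_def
  proof (rule runs_Seq'[OF runs_refine[OF inp pos r l, where P = P, folded k_def]])
    fix s1 assume s1: "keeps s s1 \<and> rvar s1 2 = rvar s 2 \<and> rvar s1 3 = rvar s 3 \<and> rarr s1 1 = rarr s 1 \<and> rarr s1 2 = rarr s 2 \<and>
       calls s1 = calls s + 2 * k \<and>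
      (\<forall>i<n. rarr s1 6 i = riter slv \<delta> n a (rvar s 2) (rarr s 1) (rarr s 2) (\<lambda>i. \<omega> (calls s + 2 * i)) k i) \<and>
      (\<forall>i<n. rarr s1 7 i = riter slv \<delta> n (tr a) (rvar s 2) (rarr s 2) (rarr s 1) (\<lambda>i. \<omega> (calls s + 2 * i + 1)) k i)"
    have inp1: "inputs p s1" using keeps_inputs s1 inp by blast
    have x: "rarr s1 6 i = right_candidate \<alpha>\<^sub>0 k j \<omega> i" if i: "i < n" for i
    proof -
      have "rarr s1 6 i = riter slv \<delta> n a (rvar s 2) (rarr s 1) (rarr s 2) (\<lambda>i. \<omega> (calls s + 2 * i)) k i"
        using s1 i by blast
      also have "\<dots> = riter slv \<delta> n a (rvar s 2) (left_at \<alpha>\<^sub>0 k j \<omega>) (right_at \<alpha>\<^sub>0 k j \<omega>) (\<lambda>i. \<omega> (calls s + 2 * i)) k i"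
        by (rule riter_cong_scalings[OF li ri i])
      finally show ?thesis by (simp only: right_candidate_def \<alpha> c)
    qed
    have y: "rarr s1 7 i = left_candidate \<alpha>\<^sub>0 k j \<omega> i" if i: "i < n" for i
    proof -
      have "rarr s1 7 i = riter slv \<delta> n (tr a) (rvar s 2) (rarr s 2) (rarr s 1) (\<lambda>i. \<omega> (calls s + 2 * i + 1)) k i"
        using s1 i by blast
      also have "\<dots> = riter slv \<delta> n (tr a) (rvar s 2) (right_at \<alpha>\<^sub>0 k j \<omega>) (left_at \<alpha>\<^sub>0 k j \<omega>) (\<lambda>i. \<omega> (calls s + 2 * i + 1)) k i"
        by (rule riter_cong_scalings[OF ri li i])
      finally show ?thesis by (simp only: left_candidate_def \<alpha> c)
    qed
    define good where "good \<longleftrightarrow> certified n a (rvar s1 2 / 2) (rarr s1 6) \<and> certified n (tr a) (rvar s1 2 / 2) (rarr s1 7)"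
    have good: "good \<longleftrightarrow> certified n a (alpha_at \<alpha>\<^sub>0 k j \<omega> / 2) (right_candidate \<alpha>\<^sub>0 k j \<omega>) \<and> certified n (tr a) (alpha_at \<alpha>\<^sub>0 k j \<omega> / 2) (left_candidate \<alpha>\<^sub>0 k j \<omega>)"
      using certified_cong[of n "rarr s1 6" "right_candidate \<alpha>\<^sub>0 k j \<omega>"] certified_cong[of n "rarr s1 7" "left_candidate \<alpha>\<^sub>0 k j \<omega>"] x y s1 unfolding good_def \<alpha>[symmetric] by simp
    show "runs T slv \<omega> (Seq accept (RAssign 3 (RDiv (RVar 3) (RLit 2)))) s1 (810 * B) (phase_inv \<epsilon> p k \<alpha>\<^sub>0 \<omega> (Suc j))"
    proof (rule runs_Seq'[OF runs_accept[OF inp1, folded good_def]])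
      fix s2 assume s2: "keeps s1 s2 \<and> calls s2 = calls s1 \<and> rvar s2 3 = rvar s1 3 \<and>
        rvar s2 2 = (if good then rvar s1 2 / 2 else rvar s1 2) \<and>
        (\<forall>i<n. rarr s2 1 i = (if good then rarr s1 7 i else rarr s1 1 i)) \<and>
        (\<forall>i<n. rarr s2 2 i = (if good then rarr s1 6 i else rarr s1 2 i))"
      have inp2: "inputs p s2" using keeps_inputs s2 inp1 by blast
      have "rvar s2 0 = \<epsilon>" using s1 s2 I by (simp add: keeps_def phase_inv_def)
      moreover have "rvar s2 2 = alpha_at \<alpha>\<^sub>0 k (Suc j) \<omega>" using s1 s2 \<alpha> by (simp add: phase_at_Suc[OF start] flip: good)
      moreover have "rarr s2 1 i = left_at \<alpha>\<^sub>0 k (Suc j) \<omega> i" "rarr s2 2 i = right_at \<alpha>\<^sub>0 k (Suc j) \<omega> i" if "i < n" for i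
        using s1 s2 that x y li ri by (simp_all add: phase_at_Suc[OF start] flip: good)
      moreover have "rvar s2 3 = \<alpha>\<^sub>0 / 2 ^ j" "calls s2 = 2 * k * Suc j" using s1 s2 I by (simp_all add: phase_inv_def)
      ultimately show "runs T slv \<omega> (RAssign 3 (RDiv (RVar 3) (RLit 2))) s2 (5 * B) (phase_inv \<epsilon> p k \<alpha>\<^sub>0 \<omega> (Suc j))"
        using inp2 B1 by (intro runs_RAssign) (simp_all add: phase_inv_def inputs_def)
    qed (use B1 in simp)
  qed (simp add: algebra_simps)
qed

end

section \<open>Building the padded matrix, the starting value and the whole program\<close>

definition upd2 :: "(nat \<Rightarrow> nat \<Rightarrow> real) \<Rightarrow> nat \<Rightarrow> nat \<Rightarrow> real \<Rightarrow> nat \<Rightarrow> nat \<Rightarrow> real" where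
  "upd2 b i j x = (\<lambda>i' j'. if i' = i \<and> j' = j then x else b i' j')"

lemma padded_cong:
  assumes "padded n p R C V E b" "\<And>i j. i < n \<Longrightarrow> j < n \<Longrightarrow> b i j = b' i j"
  shows "padded n p R C V E b'"
proof -
  have "{(i, j). i < n \<and> j < n \<and> (i = j \<or> b i j \<noteq> 0)} = {(i, j). i < n \<and> j < n \<and> (i = j \<or> b' i j \<noteq> 0)}"
    using assms(2) by auto
  then show ?thesis using assms padded_bounds[OF assms(1)] unfolding padded_def by simp
qed

lemma padded_update_diagonal:
  assumes p: "padded n p R C V E b" and d: "d < p" "R d = d" "C d = d"
  shows "padded n p R C (V(d := x)) E (upd2 b d d x)"
proof -
  let ?S = "{(i, j). i < n \<and> j < n \<and> (i = j \<or> b i j \<noteq> 0)}"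
  have bij: "bij_betw (\<lambda>k. (R k, C k)) {..<p} ?S" using p unfolding padded_def by blast
  have "?S = {(i, j). i < n \<and> j < n \<and> (i = j \<or> upd2 b d d x i j \<noteq> 0)}" by (auto simp: upd2_def)
  moreover have "k = d" if "k < p" "R k = d" "C k = d" for k
    using inj_onD[OF bij_betw_imp_inj_on[OF bij], of k d] that d by simp
  ultimately show ?thesis using p bij d unfolding padded_def by (auto simp: upd2_def)
qed

text \<open>The identity array needs no store here: the preparation writes ones below
  \<open>n\<close> only, so it already vanishes at the new slot.\<close>

lemma padded_insert:
  assumes p: "padded n p R C V E b" and ij: "i < n" "j < n" "i \<noteq> j" "b i j = 0" and x: "x \<noteq> 0" and E: "E p = 0"
  shows "padded n (Suc p) (R(p := i)) (C(p := j)) (V(p := x)) E (upd2 b i j x)"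
proof -
  let ?S = "{(i, j). i < n \<and> j < n \<and> (i = j \<or> b i j \<noteq> 0)}"
  have bij: "bij_betw (\<lambda>k. (R k, C k)) {..<p} ?S" using p unfolding padded_def by blast
  have "bij_betw (\<lambda>k. ((R(p := i)) k, (C(p := j)) k)) {..<p} ?S"
    using bij by (subst bij_betw_cong[where g = "\<lambda>k. (R k, C k)"]) auto
  then have "bij_betw (\<lambda>k. ((R(p := i)) k, (C(p := j)) k)) ({..<p} \<union> {p}) (?S \<union> {((R(p := i)) p, (C(p := j)) p)})"
    by (rule notIn_Un_bij_betw[rotated 2]) (use ij in auto)
  moreover have "{..<p} \<union> {p} = {..<Suc p}" by auto
  moreover have "?S \<union> {((R(p := i)) p, (C(p := j)) p)} = {(i', j'). i' < n \<and> j' < n \<and> (i' = j' \<or> upd2 b i j x i' j' \<noteq> 0)}"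
    using ij x by (auto simp: upd2_def)
  ultimately have B: "bij_betw (\<lambda>k. ((R(p := i)) k, (C(p := j)) k)) {..<Suc p}
      {(i', j'). i' < n \<and> j' < n \<and> (i' = j' \<or> upd2 b i j x i' j' \<noteq> 0)}" by (simp only:)
  have old: "\<not> (R k = i \<and> C k = j)" if "k < p" for k
    using bij_betw_apply[OF bij, of k] that ij by auto
  show ?thesis unfolding padded_def
  proof (intro conjI allI impI)
    fix k assume k: "k < Suc p"
    have *: "(V(p := x)) k = upd2 b i j x ((R(p := i)) k) ((C(p := j)) k) \<and> E k = (if (R(p := i)) k = (C(p := j)) k then 1 else 0)"
    proof (cases "k = p")
      case True then show ?thesis using ij E by (simp add: upd2_def)
    next
      case False
      then have kp: "k < p" using k by simp
      have "upd2 b i j x (R k) (C k) = b (R k) (C k)" unfolding upd2_def by (rule if_not_P[OF old[OF kp]])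
      moreover have "V k = b (R k) (C k) \<and> E k = (if R k = C k then 1 else 0)"
        using p kp unfolding padded_def by blast
      ultimately show ?thesis using False by (simp only: fun_upd_other not_False_eq_True simp_thms)
    qed
    show "(V(p := x)) k = upd2 b i j x ((R(p := i)) k) ((C(p := j)) k)" using * ..
    show "E k = (if (R(p := i)) k = (C(p := j)) k then 1 else 0)" using * ..
  qed (rule B)
qed

text \<open>Slot \<open>i\<close> below \<open>n\<close> is reserved for position
  \<open>(i, i)\<close>, so a diagonal entry overwrites its slot without any search, and every other
  entry is appended.\<close>

definition insert_entry :: com where
  "insert_entry = If (BAnd (BNot (NLess (NGet 0 (NVar 2)) (NGet 1 (NVar 2)))) (BNot (NLess (NGet 1 (NVar 2)) (NGet 0 (NVar 2)))))
     (RStore 3 (NGet 0 (NVar 2)) (RGet 0 (NVar 2)))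
     (Seq (NStore 2 (NVar 3) (NGet 0 (NVar 2))) (Seq (NStore 3 (NVar 3) (NGet 1 (NVar 2)))
       (Seq (RStore 3 (NVar 3) (RGet 0 (NVar 2))) (NAssign 3 (NAdd (NVar 3) (NLit 1))))))"

definition prep :: com where
  "prep = Seq (For 2 0 (NStore 2 (NVar 2) (NVar 2))) (Seq (For 2 0 (NStore 3 (NVar 2) (NVar 2)))
     (Seq (For 2 0 (RStore 4 (NVar 2) (RLit 1))) (Seq (For 2 0 (RStore 1 (NVar 2) (RLit 1)))
     (Seq (For 2 0 (RStore 2 (NVar 2) (RLit 1))) (Seq (NAssign 3 (NVar 0)) (For 2 1 insert_entry))))))"

fun peak :: "real \<Rightarrow> (nat \<Rightarrow> real) \<Rightarrow> nat \<Rightarrow> real" where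
  "peak \<gamma> f 0 = \<gamma>"
| "peak \<gamma> f (Suc k) = max (peak \<gamma> f k) (2 * f k)"

lemma peak_ge: "\<gamma> \<le> peak \<gamma> f k" "i < k \<Longrightarrow> 2 * f i \<le> peak \<gamma> f k"
  by (induction k) (auto simp: less_Suc_eq le_max_iff_disj)

lemma peak_le: "\<gamma> \<le> c \<Longrightarrow> (\<And>i. i < k \<Longrightarrow> 2 * f i \<le> c) \<Longrightarrow> peak \<gamma> f k \<le> c"
  by (induction k) auto

lemma peak_cong: "(\<And>i. i < k \<Longrightarrow> f i = g i) \<Longrightarrow> peak \<gamma> f k = peak \<gamma> g k"
  by (induction k) auto

definition peak_loop :: com where
  "peak_loop = For 2 0 (If (RLess (RVar 3) (RMul (RLit 2) (RGet 8 (NVar 2)))) (RAssign 3 (RMul (RLit 2) (RGet 8 (NVar 2)))) Skip)"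

text \<open>While \<open>\<alpha> = 0\<close>, the residual of the all-one array consists of the row sums.\<close>

definition starting :: com where
  "starting = Seq (residual 2 3 1) (Seq peak_loop (Seq (residual 3 2 1) (Seq peak_loop (RAssign 2 (RVar 3)))))"

definition guard :: bexp where
  "guard = BAnd (RLess (RVar 0) (RVar 3)) (RLess (RLit 1) (RMul (RLit 3) (RMul (RVar 1) (RVar 3))))"

definition scale_program :: "nat \<Rightarrow> com" where
  "scale_program P = Seq prep (Seq starting (While guard (attempt P)))"

text \<open>Twice the largest row or column sum, for which \<open>certified_one\<close> accepts the
  all-one pair. For a nonnegative \<open>a\<close> it is 0 only if all entries are 0, and then no
  phase runs.\<close>

definition start_alpha :: "nat \<Rightarrow> (nat \<Rightarrow> nat \<Rightarrow> real) \<Rightarrow> real" where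
  "start_alpha n a = peak (peak 0 (\<lambda>i. \<Sum>j<n. a i j) n) (\<lambda>i. \<Sum>j<n. a j i) n"

definition rounds :: "real \<Rightarrow> real \<Rightarrow> real \<Rightarrow> nat" where
  "rounds \<epsilon> K \<alpha>\<^sub>0 = (LEAST j. \<not> (\<epsilon> < \<alpha>\<^sub>0 / 2 ^ j \<and> 1 < 3 * (K * (\<alpha>\<^sub>0 / 2 ^ j))))"

lemma rounds_stop:
  assumes "0 < \<epsilon>"
  shows "\<not> (\<epsilon> < \<alpha>\<^sub>0 / 2 ^ rounds \<epsilon> K \<alpha>\<^sub>0 \<and> 1 < 3 * (K * (\<alpha>\<^sub>0 / 2 ^ rounds \<epsilon> K \<alpha>\<^sub>0)))"
  unfolding rounds_def
proof (rule LeastI_ex)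
  have "(\<lambda>k. \<alpha>\<^sub>0 * (1 / 2) ^ k) \<longlonglongrightarrow> \<alpha>\<^sub>0 * 0" by (intro tendsto_mult tendsto_const LIMSEQ_power_zero) auto
  then have "eventually (\<lambda>k. \<alpha>\<^sub>0 * (1 / 2) ^ k < \<epsilon>) sequentially" using assms by (intro order_tendstoD(2)) auto
  then obtain k where "\<alpha>\<^sub>0 * (1 / 2) ^ k < \<epsilon>" by (auto simp: eventually_sequentially)
  then show "\<exists>j. \<not> (\<epsilon> < \<alpha>\<^sub>0 / 2 ^ j \<and> 1 < 3 * (K * (\<alpha>\<^sub>0 / 2 ^ j)))"
    by (intro exI[of _ k]) (simp add: power_one_over)
qed

lemma rounds_continue:
  "j < rounds \<epsilon> K \<alpha>\<^sub>0 \<Longrightarrow> \<epsilon> < \<alpha>\<^sub>0 / 2 ^ j \<and> 1 < 3 * (K * (\<alpha>\<^sub>0 / 2 ^ j))"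
  unfolding rounds_def using not_less_Least by blast

context execution
begin

lemma runs_peak:
  assumes n: "nvar s 0 = n" and Q: "Q (s\<lparr>nvar := (nvar s)(2 := n), rvar := (rvar s)(3 := peak (rvar s 3) (rarr s 8) n)\<rparr>)"
  shows "runs T slv \<omega> peak_loop s (100 * B) Q"
  unfolding peak_loop_def
proof (rule runs_mono[OF runs_For[where N = n and \<tau> = 20 and
      I = "\<lambda>k s'. s' = s\<lparr>nvar := (nvar s)(2 := k), rvar := (rvar s)(3 := peak (rvar s 3) (rarr s 8) k)\<rparr>"] loop_time])
  let ?st = "\<lambda>k. s\<lparr>nvar := (nvar s)(2 := k), rvar := (rvar s)(3 := peak (rvar s 3) (rarr s 8) k)\<rparr>"
  fix k s' assume s': "s' = ?st k"
  show "runs T slv \<omega> (If (RLess (RVar 3) (RMul (RLit 2) (RGet 8 (NVar 2)))) (RAssign 3 (RMul (RLit 2) (RGet 8 (NVar 2)))) Skip) s' 20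
      (\<lambda>s'. nvar s' 2 = k \<and> nvar s' 0 = n \<and> s'\<lparr>nvar := (nvar s')(2 := Suc k)\<rparr> = ?st (Suc k))"
    by (rule runs_If[where \<tau> = 10]) (use n in \<open>auto intro!: runs_RAssign runs_Skip simp: s' max_def\<close>)
qed (use n Q in auto)

lemma runs_starting:
  assumes I: "inputs p s" and z: "rvar s 2 = 0" "rvar s 3 = 0" and one: "\<And>i. i < n \<Longrightarrow> rarr s 1 i = 1"
  shows "runs T slv \<omega> starting s (650 * B) (\<lambda>s'. inputs p s' \<and> rvar s' 0 = rvar s 0 \<and> rvar s' 2 = start_alpha n a \<and>
    rvar s' 3 = start_alpha n a \<and> rarr s' 1 = rarr s 1 \<and> rarr s' 2 = rarr s 2 \<and> calls s' = calls s)"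
    (is "runs _ _ _ _ _ _ ?Q")
proof -
  let ?c5 = "RAssign 2 (RVar 3)"
  let ?c4 = "Seq peak_loop ?c5"
  let ?c3 = "Seq (residual 3 2 1) ?c4"
  let ?c2 = "Seq peak_loop ?c3"
  have n: "nvar s 0 = n" and p: "nvar s 3 = p" and pm: "p \<le> m + n"
    and pad: "padded n p (narr s 2) (narr s 3) (rarr s 3) (rarr s 4) a" using I by (auto simp: inputs_def)
  have nB: "real n \<le> B" and pB: "real p \<le> B" using B pm by auto
  have sum: "resid n b (1 / (1 + 0 / 2)) x i = (\<Sum>j<n. b i j)" if "\<And>i. i < n \<Longrightarrow> x i = 1" "i < n" for b x i
    using that by (simp add: resid_def mv_def)
  let ?row = "\<lambda>i. \<Sum>j<n. a i j" and ?col = "\<lambda>i. \<Sum>j<n. a j i"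
  show ?thesis
    unfolding starting_def
  proof (rule runs_Seq'[where \<rho> = "200 * B" and \<sigma> = "420 * B" and
      P = "\<lambda>s1. \<exists>f. (\<forall>i<n. f i = ?row i) \<and> s1 = s\<lparr>nvar := (nvar s)(2 := p), rarr := (rarr s)(8 := f)\<rparr>"])
    show "runs T slv \<omega> (residual 2 3 1) s (200 * B)
        (\<lambda>s1. \<exists>f. (\<forall>i<n. f i = ?row i) \<and> s1 = s\<lparr>nvar := (nvar s)(2 := p), rarr := (rarr s)(8 := f)\<rparr>)"
      by (rule runs_residual[OF n p _ pad nB pB B1]) (auto simp only: z sum[OF one])
  next
    fix s1 assume "\<exists>f. (\<forall>i<n. f i = ?row i) \<and> s1 = s\<lparr>nvar := (nvar s)(2 := p), rarr := (rarr s)(8 := f)\<rparr>"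
    then obtain f where f: "\<And>i. i < n \<Longrightarrow> f i = ?row i" and s1: "s1 = s\<lparr>nvar := (nvar s)(2 := p), rarr := (rarr s)(8 := f)\<rparr>" by blast
    let ?s2 = "s\<lparr>nvar := (nvar s)(2 := n), rarr := (rarr s)(8 := f), rvar := (rvar s)(3 := peak 0 ?row n)\<rparr>"
    show "runs T slv \<omega> ?c2 s1 (420 * B) ?Q"
    proof (rule runs_Seq'[where \<rho> = "100 * B" and \<sigma> = "310 * B" and P = "\<lambda>s2. s2 = ?s2"])
      show "runs T slv \<omega> peak_loop s1 (100 * B) (\<lambda>s2. s2 = ?s2)"
        by (rule runs_peak) (use n f in \<open>simp_all add: s1 z peak_cong[of n f ?row]\<close>)
    next
      fix s2 assume s2: "s2 = ?s2"
      have pad2: "padded n p (narr s2 3) (narr s2 2) (rarr s2 3) (rarr s2 4) (tr a)"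
        using padded_tr[OF pad] by (simp add: s2)
      have z2: "rvar s2 2 = 0" and one2: "\<And>i. i < n \<Longrightarrow> rarr s2 1 i = 1" using z one by (simp_all add: s2)
      have n2: "nvar s2 0 = n" and p2: "nvar s2 3 = p" using n p by (simp_all add: s2)
      show "runs T slv \<omega> ?c3 s2 (310 * B) ?Q"
      proof (rule runs_Seq'[where \<rho> = "200 * B" and \<sigma> = "110 * B" and
          P = "\<lambda>s3. \<exists>g. (\<forall>i<n. g i = ?col i) \<and> s3 = s2\<lparr>nvar := (nvar s2)(2 := p), rarr := (rarr s2)(8 := g)\<rparr>"])
        show "runs T slv \<omega> (residual 3 2 1) s2 (200 * B)
            (\<lambda>s3. \<exists>g. (\<forall>i<n. g i = ?col i) \<and> s3 = s2\<lparr>nvar := (nvar s2)(2 := p), rarr := (rarr s2)(8 := g)\<rparr>)"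
          by (rule runs_residual[OF n2 p2 _ pad2 nB pB B1]) (auto simp only: z2 sum[OF one2])
      next
        fix s3 assume "\<exists>g. (\<forall>i<n. g i = ?col i) \<and> s3 = s2\<lparr>nvar := (nvar s2)(2 := p), rarr := (rarr s2)(8 := g)\<rparr>"
        then obtain g where g: "\<And>i. i < n \<Longrightarrow> g i = ?col i"
          and s3: "s3 = s2\<lparr>nvar := (nvar s2)(2 := p), rarr := (rarr s2)(8 := g)\<rparr>" by blast
        let ?s4 = "s2\<lparr>nvar := (nvar s2)(2 := n), rarr := (rarr s2)(8 := g), rvar := (rvar s2)(3 := start_alpha n a)\<rparr>"
        show "runs T slv \<omega> ?c4 s3 (110 * B) ?Q"
        proof (rule runs_Seq'[where \<rho> = "100 * B" and \<sigma> = "5 * B" and P = "\<lambda>s4. s4 = ?s4"])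
          show "runs T slv \<omega> peak_loop s3 (100 * B) (\<lambda>s4. s4 = ?s4)"
            by (rule runs_peak) (use n2 g in \<open>simp_all add: s3 s2 start_alpha_def peak_cong[of n g ?col]\<close>)
        next
          fix s4 assume s4: "s4 = ?s4"
          show "runs T slv \<omega> ?c5 s4 (5 * B) ?Q"
            using I B1 by (intro runs_RAssign) (simp_all add: s4 s2 inputs_def)
        qed (use B1 in simp)
      qed (use B1 in simp)
    qed (use B1 in simp)
  qed (use B1 in simp)
qed

lemma runs_prep:
  assumes A: "A \<in> carrier_mat n n" "\<And>i j. i < n \<Longrightarrow> j < n \<Longrightarrow> A $$ (i, j) = a i j" and sp: "sparse_rep n m ri ci v A"
  shows "runs T slv \<omega> prep (init_state n m ri ci v \<epsilon> K) (500 * B) (\<lambda>s. (\<exists>p. inputs p s) \<and> rvar s 0 = \<epsilon> \<and> rvar s 2 = 0 \<and> rvar s 3 = 0 \<and>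
    calls s = 0 \<and> (\<forall>i<n. rarr s 1 i = 1 \<and> rarr s 2 i = 1))" (is "runs _ _ _ _ _ _ ?Q")
proof -
  let ?c7 = "For 2 1 insert_entry"
  let ?c6 = "Seq (NAssign 3 (NVar 0)) ?c7"
  let ?c5 = "Seq (For 2 0 (RStore 2 (NVar 2) (RLit 1))) ?c6"
  let ?c4 = "Seq (For 2 0 (RStore 1 (NVar 2) (RLit 1))) ?c5"
  let ?c3 = "Seq (For 2 0 (RStore 4 (NVar 2) (RLit 1))) ?c4"
  let ?c2 = "Seq (For 2 0 (NStore 3 (NVar 2) (NVar 2))) ?c3"
  let ?s = "init_state n m ri ci v \<epsilon> K"
  have bij: "bij_betw (\<lambda>k. (ri k, ci k)) {..<m} {(i, j). i < n \<and> j < n \<and> A $$ (i, j) \<noteq> 0}"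
    and v: "\<And>k. k < m \<Longrightarrow> v k = A $$ (ri k, ci k)" using sp by (auto simp: sparse_rep_def)
  have ent: "ri k < n" "ci k < n" "v k \<noteq> 0" "v k = a (ri k) (ci k)" if "k < m" for k
    using bij_betw_apply[OF bij, of k] v[OF that] A(2) that by auto
  \<comment> \<open>The matrix made of the first \<open>k\<close> input entries. Each position is
    listed once, so entry \<open>k\<close> meets a zero of \<open>part k\<close>.\<close>
  define part where "part k i j = (if (i, j) \<in> (\<lambda>k. (ri k, ci k)) ` {..<k} then a i j else 0)" for k i j
  have part_Suc: "part (Suc k) = upd2 (part k) (ri k) (ci k) (v k)" if "k < m" for k
    using ent[OF that] by (auto simp: part_def upd2_def fun_eq_iff less_Suc_eq)
  have part_new: "part k (ri k) (ci k) = 0" if "k < m" for k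
  proof -
    have "(ri k, ci k) \<notin> (\<lambda>k. (ri k, ci k)) ` {..<k}"
    proof
      assume "(ri k, ci k) \<in> (\<lambda>k. (ri k, ci k)) ` {..<k}"
      then obtain q where q: "q < k" "(ri q, ci q) = (ri k, ci k)" by auto
      then have "q = k" using inj_onD[OF bij_betw_imp_inj_on[OF bij], of q k] that by simp
      then show False using q by simp
    qed
    then show ?thesis by (simp add: part_def)
  qed
  have part_all: "part m i j = a i j" if "i < n" "j < n" for i j
  proof (cases "a i j = 0")
    case False
    then have "(i, j) \<in> (\<lambda>k. (ri k, ci k)) ` {..<m}" using bij that A(2) unfolding bij_betw_def by auto
    then show ?thesis by (simp add: part_def)
  qed (simp add: part_def)
  \<comment> \<open>The slots below \<open>n\<close> keep the diagonal positions, for updates in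
    place, and array 4 vanishes from \<open>n\<close> on, for appended entries.\<close>
  let ?J = "\<lambda>k s. nvar s 0 = n \<and> nvar s 1 = m \<and> rvar s = rvar ?s \<and> narr s 0 = ri \<and> narr s 1 = ci \<and> rarr s 0 = v \<and> calls s = 0 \<and>
    (\<forall>i<n. rarr s 1 i = 1 \<and> rarr s 2 i = 1) \<and> n \<le> nvar s 3 \<and> nvar s 3 \<le> n + k \<and> (\<forall>q<n. narr s 2 q = q \<and> narr s 3 q = q) \<and>
    (\<forall>q\<ge>n. rarr s 4 q = 0) \<and> padded n (nvar s 3) (narr s 2) (narr s 3) (rarr s 3) (rarr s 4) (part k)"
  have entry: "runs T slv \<omega> insert_entry s 40 (\<lambda>s'. nvar s' 2 = k \<and> nvar s' 1 = m \<and> ?J (Suc k) (s'\<lparr>nvar := (nvar s')(2 := Suc k)\<rparr>))"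
    if J: "?J k s" and k: "k < m" "nvar s 2 = k" for k s
    unfolding insert_entry_def
  proof (rule runs_If[where \<tau> = 20])
    have pad: "padded n (nvar s 3) (narr s 2) (narr s 3) (rarr s 3) (rarr s 4) (part k)" using J by blast
    assume "bval (BAnd (BNot (NLess (NGet 0 (NVar 2)) (NGet 1 (NVar 2)))) (BNot (NLess (NGet 1 (NVar 2)) (NGet 0 (NVar 2))))) s"
    then have eq: "ri k = ci k" using J k by auto
    have "padded n (nvar s 3) (narr s 2) (narr s 3) ((rarr s 3)(ri k := v k)) (rarr s 4) (part (Suc k))"
      unfolding part_Suc[OF k(1)] eq[symmetric]
      by (rule padded_update_diagonal[OF pad]) (use J ent[OF k(1)] in auto)
    then show "runs T slv \<omega> (RStore 3 (NGet 0 (NVar 2)) (RGet 0 (NVar 2))) s 20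
        (\<lambda>s'. nvar s' 2 = k \<and> nvar s' 1 = m \<and> ?J (Suc k) (s'\<lparr>nvar := (nvar s')(2 := Suc k)\<rparr>))"
      using J k(2) by (intro runs_RStore) auto
  next
    have pad: "padded n (nvar s 3) (narr s 2) (narr s 3) (rarr s 3) (rarr s 4) (part k)" using J by blast
    assume "\<not> bval (BAnd (BNot (NLess (NGet 0 (NVar 2)) (NGet 1 (NVar 2)))) (BNot (NLess (NGet 1 (NVar 2)) (NGet 0 (NVar 2))))) s"
    then have neq: "ri k \<noteq> ci k" using J k by auto
    let ?p = "nvar s 3"
    have new: "padded n (Suc ?p) ((narr s 2)(?p := ri k)) ((narr s 3)(?p := ci k)) ((rarr s 3)(?p := v k)) (rarr s 4) (part (Suc k))"
      unfolding part_Suc[OF k(1)]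
      by (rule padded_insert[OF pad ent(1,2)[OF k(1)] neq part_new[OF k(1)] ent(3)[OF k(1)]]) (use J in auto)
    let ?s1 = "s\<lparr>narr := (narr s)(2 := (narr s 2)(?p := ri k))\<rparr>"
    let ?s2 = "s\<lparr>narr := (narr s)(2 := (narr s 2)(?p := ri k), 3 := (narr s 3)(?p := ci k))\<rparr>"
    let ?s3 = "?s2\<lparr>rarr := (rarr s)(3 := (rarr s 3)(?p := v k))\<rparr>"
    show "runs T slv \<omega> (Seq (NStore 2 (NVar 3) (NGet 0 (NVar 2))) (Seq (NStore 3 (NVar 3) (NGet 1 (NVar 2)))
       (Seq (RStore 3 (NVar 3) (RGet 0 (NVar 2))) (NAssign 3 (NAdd (NVar 3) (NLit 1)))))) s 20
        (\<lambda>s'. nvar s' 2 = k \<and> nvar s' 1 = m \<and> ?J (Suc k) (s'\<lparr>nvar := (nvar s')(2 := Suc k)\<rparr>))"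
    proof (rule runs_Seq'[where \<rho> = 5 and \<sigma> = 15 and P = "\<lambda>s1. s1 = ?s1"])
      show "runs T slv \<omega> (NStore 2 (NVar 3) (NGet 0 (NVar 2))) s 5 (\<lambda>s1. s1 = ?s1)"
        using J k(2) by (intro runs_NStore) auto
    next
      fix s1 assume s1: "s1 = ?s1"
      show "runs T slv \<omega> (Seq (NStore 3 (NVar 3) (NGet 1 (NVar 2)))
       (Seq (RStore 3 (NVar 3) (RGet 0 (NVar 2))) (NAssign 3 (NAdd (NVar 3) (NLit 1))))) s1 15
        (\<lambda>s'. nvar s' 2 = k \<and> nvar s' 1 = m \<and> ?J (Suc k) (s'\<lparr>nvar := (nvar s')(2 := Suc k)\<rparr>))"
      proof (rule runs_Seq'[where \<rho> = 5 and \<sigma> = 10 and P = "\<lambda>s2. s2 = ?s2"])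
        show "runs T slv \<omega> (NStore 3 (NVar 3) (NGet 1 (NVar 2))) s1 5 (\<lambda>s2. s2 = ?s2)"
          using J k(2) by (intro runs_NStore) (auto simp: s1)
      next
        fix s2 assume s2: "s2 = ?s2"
        show "runs T slv \<omega> (Seq (RStore 3 (NVar 3) (RGet 0 (NVar 2))) (NAssign 3 (NAdd (NVar 3) (NLit 1)))) s2 10
          (\<lambda>s'. nvar s' 2 = k \<and> nvar s' 1 = m \<and> ?J (Suc k) (s'\<lparr>nvar := (nvar s')(2 := Suc k)\<rparr>))"
        proof (rule runs_Seq'[where \<rho> = 5 and \<sigma> = 5 and P = "\<lambda>s3. s3 = ?s3"])
          show "runs T slv \<omega> (RStore 3 (NVar 3) (RGet 0 (NVar 2))) s2 5 (\<lambda>s3. s3 = ?s3)"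
            using J k(2) by (intro runs_RStore) (auto simp: s2)
        next
          fix s3 assume s3: "s3 = ?s3"
          show "runs T slv \<omega> (NAssign 3 (NAdd (NVar 3) (NLit 1))) s3 5
            (\<lambda>s'. nvar s' 2 = k \<and> nvar s' 1 = m \<and> ?J (Suc k) (s'\<lparr>nvar := (nvar s')(2 := Suc k)\<rparr>))"
            using J k(2) new by (intro runs_NAssign) (auto simp: s3)
        qed simp
      qed simp
    qed simp
  qed simp_all
  let ?iota = "\<lambda>j. if j < n then j else 0" and ?one = "\<lambda>j. if j < n then 1 else 0"
  let ?s1 = "?s\<lparr>nvar := (nvar ?s)(2 := n), narr := (narr ?s)(2 := ?iota)\<rparr>"
  let ?s2 = "?s\<lparr>nvar := (nvar ?s)(2 := n), narr := (narr ?s)(2 := ?iota, 3 := ?iota)\<rparr>"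
  let ?s3 = "?s2\<lparr>rarr := (rarr ?s)(4 := ?one)\<rparr>"
  let ?s4 = "?s2\<lparr>rarr := (rarr ?s)(4 := ?one, 1 := ?one)\<rparr>"
  let ?s5 = "?s2\<lparr>rarr := (rarr ?s)(4 := ?one, 1 := ?one, 2 := ?one)\<rparr>"
  let ?s6 = "?s5\<lparr>nvar := (nvar ?s)(2 := n, 3 := n)\<rparr>"
  have J0: "?J 0 (?s6\<lparr>nvar := (nvar ?s6)(2 := 0)\<rparr>)"
  proof -
    have "bij_betw (\<lambda>k. (?iota k, ?iota k)) {..<n} {(i, j). i < n \<and> j < n \<and> (i = j \<or> part 0 i j \<noteq> 0)}"
      by (rule bij_betw_byWitness[where f' = fst]) (auto simp: part_def)
    then have "padded n n ?iota ?iota (\<lambda>_. 0) ?one (part 0)"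
      unfolding padded_def by (auto simp: part_def)
    then show ?thesis by (simp add: init_state_def)
  qed
  show ?thesis
    unfolding prep_def
  proof (rule runs_Seq'[where \<rho> = "50 * B" and \<sigma> = "450 * B" and P = "\<lambda>s1. s1 = ?s1"])
    show "runs T slv \<omega> (For 2 0 (NStore 2 (NVar 2) (NVar 2))) ?s (50 * B) (\<lambda>s1. s1 = ?s1)"
      by (rule runs_mono[OF runs_NStore_iota_loop[where N = n] loop_time]) (simp_all add: init_state_def cong: if_cong)
  next
    fix s1 assume s1: "s1 = ?s1"
    show "runs T slv \<omega> ?c2 s1 (450 * B) ?Q"
    proof (rule runs_Seq'[where \<rho> = "50 * B" and \<sigma> = "400 * B" and P = "\<lambda>s2. s2 = ?s2"])
      show "runs T slv \<omega> (For 2 0 (NStore 3 (NVar 2) (NVar 2))) s1 (50 * B) (\<lambda>s2. s2 = ?s2)"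
        by (rule runs_mono[OF runs_NStore_iota_loop[where N = n] loop_time]) (simp_all add: s1 init_state_def cong: if_cong)
    next
      fix s2 assume s2: "s2 = ?s2"
      show "runs T slv \<omega> ?c3 s2 (400 * B) ?Q"
      proof (rule runs_Seq'[where \<rho> = "50 * B" and \<sigma> = "350 * B" and P = "\<lambda>s3. s3 = ?s3"])
        show "runs T slv \<omega> (For 2 0 (RStore 4 (NVar 2) (RLit 1))) s2 (50 * B) (\<lambda>s3. s3 = ?s3)"
          by (rule runs_mono[OF runs_map_loop[where N = n and h = "\<lambda>_ _. 1"] loop_time]) (simp_all add: s2 init_state_def cong: if_cong)
      next
        fix s3 assume s3: "s3 = ?s3"
        show "runs T slv \<omega> ?c4 s3 (350 * B) ?Q"
        proof (rule runs_Seq'[where \<rho> = "50 * B" and \<sigma> = "300 * B" and P = "\<lambda>s4. s4 = ?s4"])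
          show "runs T slv \<omega> (For 2 0 (RStore 1 (NVar 2) (RLit 1))) s3 (50 * B) (\<lambda>s4. s4 = ?s4)"
            by (rule runs_mono[OF runs_map_loop[where N = n and h = "\<lambda>_ _. 1"] loop_time]) (simp_all add: s3 init_state_def cong: if_cong)
        next
          fix s4 assume s4: "s4 = ?s4"
          show "runs T slv \<omega> ?c5 s4 (300 * B) ?Q"
          proof (rule runs_Seq'[where \<rho> = "50 * B" and \<sigma> = "250 * B" and P = "\<lambda>s5. s5 = ?s5"])
            show "runs T slv \<omega> (For 2 0 (RStore 2 (NVar 2) (RLit 1))) s4 (50 * B) (\<lambda>s5. s5 = ?s5)"
              by (rule runs_mono[OF runs_map_loop[where N = n and h = "\<lambda>_ _. 1"] loop_time]) (simp_all add: s4 init_state_def cong: if_cong)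
          next
            fix s5 assume s5: "s5 = ?s5"
            show "runs T slv \<omega> ?c6 s5 (250 * B) ?Q"
            proof (rule runs_Seq'[where \<rho> = "2 * B" and \<sigma> = "200 * B" and P = "\<lambda>s6. s6 = ?s6"])
              show "runs T slv \<omega> (NAssign 3 (NVar 0)) s5 (2 * B) (\<lambda>s6. s6 = ?s6)"
                using B1 by (intro runs_NAssign) (auto simp: s5 init_state_def)
            next
              fix s6 assume s6: "s6 = ?s6"
              show "runs T slv \<omega> ?c7 s6 (200 * B) ?Q"
              proof (rule runs_mono[OF runs_For[where N = m and \<tau> = 40 and I = ?J] loop_time])
                fix k and s :: state assume s: "?J k s" "k < m" "nvar s 2 = k" "nvar s 1 = m"
                show "runs T slv \<omega> insert_entry s 40 (\<lambda>s'. nvar s' 2 = k \<and> nvar s' 1 = m \<and> ?J (Suc k) (s'\<lparr>nvar := (nvar s')(2 := Suc k)\<rparr>))"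
                  by (rule entry[OF s(1-3)])
              next
                show "?J 0 (s6\<lparr>nvar := (nvar s6)(2 := 0)\<rparr>)" unfolding s6 by (rule J0)
              next
                fix s :: state assume J: "?J m s \<and> nvar s 2 = m \<and> nvar s 1 = m"
                have pad: "padded n (nvar s 3) (narr s 2) (narr s 3) (rarr s 3) (rarr s 4) a"
                  by (rule padded_cong[of _ _ _ _ _ _ "part m"]) (use J part_all in auto)
                then have "inputs (nvar s 3) s" using J by (auto simp: inputs_def init_state_def)
                then show "?Q s" using J by (auto simp: init_state_def)
              qed (auto simp: s6 init_state_def)
            qed (use B1 in simp)
          qed (use B1 in simp)
        qed (use B1 in simp)
      qed (use B1 in simp)
    qed (use B1 in simp)
  qed simp
qed

lemma runs_scale_program:
  fixes P :: nat and \<epsilon> :: real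
  defines "k \<equiv> steps (24 * (real n * K) ^ P)" and "\<alpha>\<^sub>0 \<equiv> start_alpha n a"
  defines "N \<equiv> rounds \<epsilon> K \<alpha>\<^sub>0"
  assumes A: "A \<in> carrier_mat n n" "\<And>i j. i < n \<Longrightarrow> j < n \<Longrightarrow> A $$ (i, j) = a i j" and sp: "sparse_rep n m ri ci v A"
    and \<epsilon>: "0 < \<epsilon>" and c: "certified n a \<alpha>\<^sub>0 (\<lambda>_. 1)" "certified n (tr a) \<alpha>\<^sub>0 (\<lambda>_. 1)"
  shows "runs T slv \<omega> (scale_program P) (init_state n m ri ci v \<epsilon> K)
    (real N * (real k * (1100 * B + 4 * D) + (950 + real (rcost (budget_exp P))) * B) + 1200 * B)
    (\<lambda>s. (\<forall>i<n. rarr s 1 i = left_at \<alpha>\<^sub>0 k N \<omega> i) \<and> (\<forall>i<n. rarr s 2 i = right_at \<alpha>\<^sub>0 k N \<omega> i))"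
    (is "runs _ _ _ _ _ (?t + _) ?Q")
  unfolding scale_program_def
proof (rule runs_Seq'[OF runs_prep[OF A sp]])
  fix s1 assume s1: "(\<exists>p. inputs p s1) \<and> rvar s1 0 = \<epsilon> \<and> rvar s1 2 = 0 \<and> rvar s1 3 = 0 \<and> calls s1 = 0 \<and> (\<forall>i<n. rarr s1 1 i = 1 \<and> rarr s1 2 i = 1)"
  then obtain p where p: "inputs p s1" by blast
  show "runs T slv \<omega> (Seq starting (While guard (attempt P))) s1 (?t + 700 * B) ?Q"
  proof (rule runs_Seq'[OF runs_starting[OF p]])
    fix s2 assume s2: "inputs p s2 \<and> rvar s2 0 = rvar s1 0 \<and> rvar s2 2 = start_alpha n a \<and> rvar s2 3 = start_alpha n a \<and>
      rarr s2 1 = rarr s1 1 \<and> rarr s2 2 = rarr s1 2 \<and> calls s2 = calls s1"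
    have init: "phase_inv \<epsilon> p k \<alpha>\<^sub>0 \<omega> 0 s2"
      using s1 s2 by (simp add: phase_inv_def alpha_at_def left_at_def right_at_def phase_at_def \<alpha>\<^sub>0_def)
    let ?X = "real k * (1100 * B + 4 * D) + (920 + real (rcost (budget_exp P))) * B"
    have g: "bval guard s \<longleftrightarrow> \<epsilon> < \<alpha>\<^sub>0 / 2 ^ j \<and> 1 < 3 * (K * (\<alpha>\<^sub>0 / 2 ^ j))" if "phase_inv \<epsilon> p k \<alpha>\<^sub>0 \<omega> j s" for j s
      using that by (simp add: guard_def phase_inv_def inputs_def)
    show "runs T slv \<omega> (While guard (attempt P)) s2 (?t + 50 * B) ?Q"
    proof (rule runs_mono[OF runs_While[where I = "phase_inv \<epsilon> p k \<alpha>\<^sub>0 \<omega>" and N = N and \<tau> = ?X]])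
      fix j s assume I: "phase_inv \<epsilon> p k \<alpha>\<^sub>0 \<omega> j s" and j: "j < N"
      have b: "\<epsilon> < \<alpha>\<^sub>0 / 2 ^ j" "bval guard s" using rounds_continue[of j \<epsilon> K \<alpha>\<^sub>0] j unfolding g[OF I] N_def by blast+
      \<comment> \<open>The phase lemmas need a positive start, which the guard provides: for
        \<open>\<alpha>\<^sub>0 = 0\<close> the body is never entered.\<close>
      then have "0 < \<alpha>\<^sub>0 / 2 ^ j" using \<epsilon> by linarith
      then have pos: "0 < \<alpha>\<^sub>0" by (simp add: zero_less_divide_iff)
      have "runs T slv \<omega> (attempt P) s ?X (phase_inv \<epsilon> p k \<alpha>\<^sub>0 \<omega> (Suc j))"
        unfolding k_def by (rule runs_attempt[OF pos c]) (use I in \<open>simp add: k_def\<close>)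
      then show "bval guard s \<and> runs T slv \<omega> (attempt P) s ?X (phase_inv \<epsilon> p k \<alpha>\<^sub>0 \<omega> (Suc j))" using b(2) by (rule conjI[rotated])
    next
      fix s assume "phase_inv \<epsilon> p k \<alpha>\<^sub>0 \<omega> N s"
      then show "\<not> bval guard s" using rounds_stop[OF \<epsilon>, of \<alpha>\<^sub>0 K] g by (simp add: N_def)
    next
      show "phase_inv \<epsilon> p k \<alpha>\<^sub>0 \<omega> 0 s2" by (rule init)
    next
      have "real (1 + bcost guard) + ?X \<le> real k * (1100 * B + 4 * D) + (950 + real (rcost (budget_exp P))) * B"
        using B1 by (simp add: guard_def algebra_simps)
      then have "real N * (real (1 + bcost guard) + ?X) \<le> ?t" by (rule mult_left_mono) simp
      then show "real N * (real (1 + bcost guard) + ?X) + real (1 + bcost guard) \<le> ?t + 50 * B"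
        using B1 by (simp add: guard_def)
    qed (simp add: phase_inv_def)
  qed (use s1 in auto)
next
  have e: "500 * B + (x + 700 * B) = x + 1200 * B" for x by simp
  show "500 * B + (?t + 700 * B) \<le> ?t + 1200 * B" unfolding e by (rule order_refl)
qed

end

section \<open>Number of phases and of steps\<close>

lemma log_factor_ge_1: "1 \<le> log_factor x"
  by (simp add: log_factor_def)

lemma log_factor_ge_ln: "ln x \<le> log_factor x"
  by (simp add: log_factor_def)

lemma ln2_ge: "1 / 2 \<le> ln (2 :: real)"
proof -
  have "1 - 1 / 2 \<le> ln (2 :: real)" using ln_le_minus_one[of "1 / 2 :: real"] by (simp add: ln_div)
  then show ?thesis by simp
qed

lemma ln_3_2_ge: "1 / 3 \<le> ln (3 / 2 :: real)"
proof -
  have "ln (2 / 3 :: real) \<le> 2 / 3 - 1" by (rule ln_le_minus_one) simp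
  then show ?thesis by (simp add: ln_div)
qed

text \<open>One step before the end the budget still exceeds 1; taking logarithms bounds that step
  count. \<open>ln (3 / 2)\<close> at least 1/3 and \<open>ln 24\<close> at most 23 give the 69, and
  76 has room for the last step.\<close>

lemma steps_le:
  assumes x: "1 \<le> x"
  shows "real (steps (24 * x ^ P)) \<le> (76 + 3 * real P) * log_factor x"
proof (cases "steps (24 * x ^ P)")
  case 0 then show ?thesis using log_factor_ge_1[of x] by simp
next
  case (Suc k)
  have pos: "0 < 24 * x ^ P" using x by simp
  have "1 < 24 * x ^ P * (2 / 3) ^ k" using steps_continue[of k "24 * x ^ P"] Suc by simp
  then have "ln 1 < ln (24 * x ^ P * (2 / 3) ^ k)" using pos by (subst ln_less_cancel_iff) auto
  also have "\<dots> = ln 24 + real P * ln x - real k * ln (3 / 2)"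
    using x by (simp add: ln_mult ln_realpow ln_div right_diff_distrib)
  finally have "real k * ln (3 / 2) < ln 24 + real P * ln x" by simp
  moreover have "real k * (1 / 3) \<le> real k * ln (3 / 2)" by (intro mult_left_mono ln_3_2_ge) simp
  moreover have "ln (24 :: real) \<le> 23" using ln_le_minus_one[of "24 :: real"] by simp
  moreover have "real P * ln x \<le> real P * log_factor x" by (intro mult_left_mono log_factor_ge_ln) simp
  ultimately have "real k \<le> 69 + 3 * (real P * log_factor x)" by linarith
  then have "real (Suc k) \<le> 76 * 1 + 3 * real P * log_factor x" by simp
  also have "\<dots> \<le> 76 * log_factor x + 3 * real P * log_factor x"
    using log_factor_ge_1[of x] by (intro add_right_mono mult_left_mono) auto
  finally show ?thesis using Suc by (simp add: distrib_right)
qed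

text \<open>This exploits the first half of the guard and enters the running time.\<close>

lemma rounds_le_log:
  assumes \<epsilon>: "0 < \<epsilon>" and s: "\<alpha>\<^sub>0 \<le> 2 * s"
  shows "real (rounds \<epsilon> K \<alpha>\<^sub>0) \<le> 5 * log_factor (s / \<epsilon>)"
proof (cases "rounds \<epsilon> K \<alpha>\<^sub>0")
  case 0 then show ?thesis using log_factor_ge_1[of "s / \<epsilon>"] by simp
next
  case (Suc j)
  have "\<epsilon> < \<alpha>\<^sub>0 / 2 ^ j" using rounds_continue[of j \<epsilon> K \<alpha>\<^sub>0] Suc by simp
  also have "\<dots> \<le> 2 * s / 2 ^ j" using s by (intro divide_right_mono) auto
  finally have "2 ^ j < 2 * (s / \<epsilon>)" using \<epsilon> by (simp add: field_simps)
  then have sp: "0 < s / \<epsilon>" using zero_less_power[of "2 :: real" j] by linarith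
  have "ln (2 ^ j) < ln (2 * (s / \<epsilon>))" using \<open>2 ^ j < _\<close> sp by (subst ln_less_cancel_iff) auto
  also have "ln (2 * (s / \<epsilon>)) = ln 2 + ln (s / \<epsilon>)" using sp by (intro ln_mult_pos) auto
  finally have "real j * ln 2 < ln 2 + ln (s / \<epsilon>)" by (simp add: ln_realpow)
  moreover have "ln (2 :: real) \<le> 1" using ln_le_minus_one[of "2 :: real"] by simp
  moreover have "real j * (1 / 2) \<le> real j * ln 2" by (intro mult_left_mono ln2_ge) simp
  ultimately have "real j \<le> 2 + 2 * log_factor (s / \<epsilon>)" using log_factor_ge_ln[of "s / \<epsilon>"] by linarith
  then show ?thesis using Suc log_factor_ge_1[of "s / \<epsilon>"] by simp
qed

text \<open>This exploits the second half of the guard: the union bound needs a number of phases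
  free of \<epsilon>. A polynomial in \<open>K\<close> suffices there, so the crude estimate of
  \<open>Suc j\<close> by \<open>2 ^ j\<close> replaces a logarithm.\<close>

lemma rounds_le_square:
  assumes K: "1 \<le> K" and a: "\<alpha>\<^sub>0 \<le> 2 * K"
  shows "real (rounds \<epsilon> K \<alpha>\<^sub>0) \<le> 6 * K\<^sup>2"
proof (cases "rounds \<epsilon> K \<alpha>\<^sub>0")
  case 0 then show ?thesis by simp
next
  case (Suc j)
  have "1 < 3 * (K * (\<alpha>\<^sub>0 / 2 ^ j))" using rounds_continue[of j \<epsilon> K \<alpha>\<^sub>0] Suc by simp
  also have "\<dots> \<le> 3 * (K * (2 * K / 2 ^ j))" using K a by (intro mult_left_mono divide_right_mono) auto
  finally have "2 ^ j < 6 * K\<^sup>2" by (simp add: field_simps power2_eq_square)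
  moreover have "real (Suc j) \<le> 2 ^ j"
    using of_nat_mono[OF Suc_leI[OF less_exp[of j]], where 'a = real] by simp
  ultimately show ?thesis using Suc by simp
qed

section \<open>The main result\<close>

context scaling
begin

lemma start_alpha_bounds:
  "0 \<le> start_alpha n a" "start_alpha n a \<le> 2 * K"
  "certified n a (start_alpha n a) (\<lambda>_. 1)" "certified n (tr a) (start_alpha n a) (\<lambda>_. 1)"
proof -
  interpret X: scaling n "tr a" K ls rs M slv by (rule transposed_scaling)
  have r: "2 * (\<Sum>j<n. a i j) \<le> start_alpha n a" and c: "2 * (\<Sum>j<n. a j i) \<le> start_alpha n a" if "i < n" for i
  proof -
    let ?r = "peak 0 (\<lambda>i. \<Sum>j<n. a i j) n"
    have "2 * (\<Sum>j<n. a i j) \<le> ?r" using peak_ge(2)[OF that, of "\<lambda>i. \<Sum>j<n. a i j" 0] .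
    also have "?r \<le> start_alpha n a" unfolding start_alpha_def by (rule peak_ge(1))
    finally show "2 * (\<Sum>j<n. a i j) \<le> start_alpha n a" .
    show "2 * (\<Sum>j<n. a j i) \<le> start_alpha n a"
      unfolding start_alpha_def using peak_ge(2)[OF that, of "\<lambda>i. \<Sum>j<n. a j i" ?r] .
  qed
  show nn: "0 \<le> start_alpha n a" unfolding start_alpha_def by (meson peak_ge(1) order_trans)
  show "start_alpha n a \<le> 2 * K" unfolding start_alpha_def
    using row_sum_le X.row_sum_le K1 by (intro peak_le) auto
  show "certified n a (start_alpha n a) (\<lambda>_. 1)" "certified n (tr a) (start_alpha n a) (\<lambda>_. 1)"
    using r c nonneg by (auto intro!: certified_one[OF nn])
qed

text \<open>Of the \<open>P\<close> factors \<open>real n * K\<close> in the budget, three cover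
  \<open>K ^ 3 * real n\<close> from the union bound; the others, at least \<open>c\<close> of them,
  cover \<open>real n powr c\<close>.\<close>

lemma scaling_probability:
  fixes P :: nat and A :: "real Matrix.mat" and \<epsilon> :: real
  defines "k \<equiv> steps (24 * (real n * K) ^ P)" and "\<alpha>\<^sub>0 \<equiv> start_alpha n a"
  defines "N \<equiv> rounds \<epsilon> K \<alpha>\<^sub>0"
  assumes \<epsilon>: "0 < \<epsilon>" and A: "A \<in> carrier_mat n n" "\<And>i j. i < n \<Longrightarrow> j < n \<Longrightarrow> A $$ (i, j) = a i j"
    and P: "c + 3 \<le> real P" and c: "0 < c"
  shows "measure seeds {\<omega> \<in> space seeds. scales_to_rcdd (mat_diag n (left_at \<alpha>\<^sub>0 k N \<omega>)) (mat_diag n (right_at \<alpha>\<^sub>0 k N \<omega>)) ((1 + \<epsilon>) \<cdot>\<^sub>m 1\<^sub>m n - A)}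
    \<ge> 1 - real n powr (- c)"
proof -
  note sb = start_alpha_bounds[folded \<alpha>\<^sub>0_def]
  let ?G = "{\<omega> \<in> space seeds. scales_to_rcdd (mat_diag n (left_at \<alpha>\<^sub>0 k N \<omega>)) (mat_diag n (right_at \<alpha>\<^sub>0 k N \<omega>)) ((1 + \<epsilon>) \<cdot>\<^sub>m 1\<^sub>m n - A)}"
  have B: "(1 + \<epsilon>) \<cdot>\<^sub>m 1\<^sub>m n - A \<in> carrier_mat n n" by (rule minus_carrier_mat[OF A(1)])
  have small: "\<alpha>\<^sub>0 / 2 ^ N \<le> \<epsilon> \<or> 3 * K * (\<alpha>\<^sub>0 / 2 ^ N) \<le> 1"
    using rounds_stop[OF \<epsilon>, of \<alpha>\<^sub>0 K] unfolding N_def by (auto simp: not_less mult.assoc)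
  show ?thesis
  proof (cases "\<alpha>\<^sub>0 = 0")
    case True
    \<comment> \<open>Here all entries of \<open>A\<close> are 0. The phase lemmas ask for a
      positive start, but no phase runs and the all-one pair is the output for every seed
      sequence.\<close>
    have "N = 0" unfolding N_def rounds_def using True \<epsilon> by (intro Least_eq_0) simp
    then have "left_at \<alpha>\<^sub>0 k N \<omega> = (\<lambda>_. 1)" "right_at \<alpha>\<^sub>0 k N \<omega> = (\<lambda>_. 1)" for \<omega> by (simp_all add: left_at_def right_at_def phase_at_def)
    then have "?G = space seeds"
      using certified_scales[OF sb(1,3,4) _ \<epsilon> A] True \<epsilon> by simp
    then show ?thesis by (simp only: S.prob_space) simp
  next
    case False
    then have start: "0 < \<alpha>\<^sub>0" "certified n a \<alpha>\<^sub>0 (\<lambda>_. 1)" "certified n (tr a) \<alpha>\<^sub>0 (\<lambda>_. 1)" using sb by auto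
    note m = phase_at_measurable[OF start, of k N]
    note inv = phase_at_invariant[OF start, where k = k and j = N]
    have "?G \<in> sets seeds"
      using scales_measurable[OF B, of "left_at \<alpha>\<^sub>0 k N" seeds "right_at \<alpha>\<^sub>0 k N"] m unfolding pred_def by simp
    moreover have "{\<omega> \<in> space seeds. alpha_at \<alpha>\<^sub>0 k N \<omega> = \<alpha>\<^sub>0 / 2 ^ N} \<subseteq> ?G"
    proof safe
      fix \<omega> assume e: "alpha_at \<alpha>\<^sub>0 k N \<omega> = \<alpha>\<^sub>0 / 2 ^ N"
      show "scales_to_rcdd (mat_diag n (left_at \<alpha>\<^sub>0 k N \<omega>)) (mat_diag n (right_at \<alpha>\<^sub>0 k N \<omega>)) ((1 + \<epsilon>) \<cdot>\<^sub>m 1\<^sub>m n - A)"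
        by (rule certified_scales[OF _ inv(2,3) _ \<epsilon> A]) (use small inv(1)[of \<omega>] in \<open>auto simp: e less_imp_le\<close>)
    qed
    ultimately have "measure seeds {\<omega> \<in> space seeds. alpha_at \<alpha>\<^sub>0 k N \<omega> = \<alpha>\<^sub>0 / 2 ^ N} \<le> measure seeds ?G"
      by (intro S.finite_measure_mono)
    moreover have "1 - real N * (4 * K * sqrt n * (2 / 3) ^ k) \<le> measure seeds {\<omega> \<in> space seeds. alpha_at \<alpha>\<^sub>0 k N \<omega> = \<alpha>\<^sub>0 / 2 ^ N}"
      by (rule phases_success[OF start])
    moreover have "real N * (4 * K * sqrt n * (2 / 3) ^ k) \<le> real n powr (- c)"
    proof -
      have n1: "1 \<le> real n" using n_pos by simp
      have nK: "1 \<le> real n * K" using n1 K1 by (metis mult_mono' mult_1 zero_le_one)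
      have sq: "sqrt n \<le> real n" using n1 by (simp add: real_sqrt_le_iff' sqrt_le_D real_le_lsqrt power2_eq_square)
      have "real N * (4 * K * sqrt n * (2 / 3) ^ k) \<le> (6 * K\<^sup>2) * (4 * K * real n * (2 / 3) ^ k)"
        using rounds_le_square[OF K1 sb(2), of \<epsilon>] K1 sq unfolding N_def by (intro mult_mono mult_nonneg_nonneg) auto
      also have "\<dots> = 24 * (K ^ 3 * real n) * (2 / 3) ^ k" by (simp add: power2_eq_square power3_eq_cube)
      also have "\<dots> \<le> 24 * ((real n * K) ^ P * real n powr (- c)) * (2 / 3) ^ k"
      proof -
        have "real n powr c \<le> real n powr real (P - 3)" using P n1 by (intro powr_mono) (auto simp: of_nat_diff)
        also have "\<dots> = real n ^ (P - 3)" using n1 by (simp add: powr_realpow)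
        also have "\<dots> \<le> (real n * K) ^ (P - 3)" using n1 K1 by (intro power_mono) auto
        finally have "K ^ 3 * real n * real n powr c \<le> (real n * K) ^ 3 * (real n * K) ^ (P - 3)"
        proof -
          assume h: "real n powr c \<le> (real n * K) ^ (P - 3)"
          have "real n * 1 \<le> real n * (real n ^ 2)" using n1 by (intro mult_left_mono) auto
          then have "K ^ 3 * real n \<le> (real n * K) ^ 3"
            using mult_left_mono[of "real n * 1" "real n * (real n ^ 2)" "K ^ 3"] K1
            by (simp add: power_mult_distrib power2_eq_square power3_eq_cube mult_ac)
          then show ?thesis using h K1 n1 by (intro mult_mono) auto
        qed
        also have "\<dots> = (real n * K) ^ P" using P c by (simp flip: power_add)
        finally have "K ^ 3 * real n * real n powr c * real n powr (- c) \<le> (real n * K) ^ P * real n powr (- c)"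
          by (rule mult_right_mono) simp
        moreover have "real n powr c * real n powr (- c) = 1" using n_pos by (simp flip: powr_add)
        ultimately have "K ^ 3 * real n \<le> (real n * K) ^ P * real n powr (- c)" by (simp add: mult.assoc)
        then show ?thesis by (intro mult_right_mono mult_left_mono) auto
      qed
      also have "\<dots> = (24 * (real n * K) ^ P * (2 / 3) ^ k) * real n powr (- c)" by simp
      also have "\<dots> \<le> 1 * real n powr (- c)"
        using steps_stop[of "24 * (real n * K) ^ P"] unfolding k_def by (intro mult_right_mono) auto
      finally show ?thesis by simp
    qed
    ultimately show ?thesis by linarith
  qed
qed

end

text \<open>Both logarithmic factors are at least 1, so the costs outside the innermost loop are
  absorbed into the product.\<close>

lemma time_bound:
  fixes N k B D b c d l1 l2 P :: real
  assumes N: "0 \<le> N" "N \<le> 5 * l2" and k: "0 \<le> k" "k \<le> P * l1" and l: "1 \<le> l1" "1 \<le> l2" and B: "0 \<le> B"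
    and D: "D \<le> d * B" and d: "0 \<le> d" and P: "0 \<le> P" and b: "0 \<le> b"
  shows "N * (k * (1100 * B + 4 * D) + (950 + b) * B) + 1200 * B \<le> (5 * (P * (1100 + 4 * d) + 950 + b) + 1200) * (B * l1 * l2)"
proof -
  have 1: "1100 * B + 4 * D \<le> (1100 + 4 * d) * B" using D by (simp add: distrib_right)
  have "k * (1100 * B + 4 * D) \<le> k * ((1100 + 4 * d) * B)" using 1 k by (rule_tac mult_left_mono)
  also have "\<dots> \<le> (P * l1) * ((1100 + 4 * d) * B)" using k d B by (intro mult_right_mono) auto
  finally have 2: "k * (1100 * B + 4 * D) \<le> (P * (1100 + 4 * d)) * (B * l1)" by (simp add: mult_ac)
  have Bl: "B * 1 \<le> B * l1" using B l by (intro mult_left_mono)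
  then have 3: "(950 + b) * B \<le> (950 + b) * (B * l1)" using b by (intro mult_left_mono) auto
  let ?Z = "P * (1100 + 4 * d) + 950 + b"
  have "k * (1100 * B + 4 * D) + (950 + b) * B \<le> ?Z * (B * l1)" using 2 3 by (simp add: distrib_right)
  then have "N * (k * (1100 * B + 4 * D) + (950 + b) * B) \<le> N * (?Z * (B * l1))" using N by (rule_tac mult_left_mono)
  also have "\<dots> \<le> (5 * l2) * (?Z * (B * l1))"
    using N P d b B l by (intro mult_right_mono mult_nonneg_nonneg add_nonneg_nonneg) auto
  also have "\<dots> = 5 * ?Z * (B * l1 * l2)" by simp
  finally have 4: "N * (k * (1100 * B + 4 * D) + (950 + b) * B) \<le> 5 * ?Z * (B * l1 * l2)" .
  have "B * l1 * 1 \<le> B * l1 * l2" using B l by (intro mult_left_mono mult_nonneg_nonneg) auto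
  then have "1200 * B \<le> 1200 * (B * l1 * l2)" using Bl by simp
  then show ?thesis using 4 by (simp add: distrib_right)
qed

theorem theorem7:
  fixes c :: real
  assumes "c > 0"
  shows "\<exists>prog. \<forall>d. \<exists>C. \<forall>T (M :: 'w measure) slv n m A \<epsilon> K ri ci v.
    solver_time d T \<longrightarrow> rcdd_solver M slv \<longrightarrow>
    0 < n \<longrightarrow> A \<in> carrier_mat n n \<longrightarrow> (\<forall>i<n. \<forall>j<n. 0 \<le> A $$ (i, j)) \<longrightarrow> nnz A = m \<longrightarrow>
    spectral_radius (map_mat complex_of_real A) < 1 \<longrightarrow> 0 < \<epsilon> \<longrightarrow>
    max (induced_norm linf_norm (inverse_mat (1\<^sub>m n - A)))
        (induced_norm l1_norm (inverse_mat (1\<^sub>m n - A))) \<le> K \<longrightarrow>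
    sparse_rep n m ri ci v A \<longrightarrow>
    (let seeds = (\<Pi>\<^sub>M k\<in>(UNIV :: nat set). M);
         run = (\<lambda>\<omega> t s. exec T slv \<omega> prog (init_state n m ri ci v \<epsilon> K) t s)
     in (\<forall>\<omega>\<in>space seeds. \<exists>t s. run \<omega> t s \<and>
           t \<le> C * (T m n (18 * K\<^sup>2) (1 / (216 * K ^ 3)) * log_factor (real n * K) *
                 log_factor ((induced_norm l1_norm A + induced_norm linf_norm A) / \<epsilon>))) \<and>
        measure seeds {\<omega> \<in> space seeds. \<exists>t s. run \<omega> t s \<and>
           scales_to_rcdd (output_L n s) (output_R n s) ((1 + \<epsilon>) \<cdot>\<^sub>m 1\<^sub>m n - A)}
          \<ge> 1 - real n powr (- c))"
proof -
  \<comment> \<open>\<open>P\<close> depends on \<open>c\<close> alone, so the program is fixed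
    before \<open>d\<close>, the oracle and the input are given.\<close>
  define P where "P = nat \<lceil>c\<rceil> + 3"
  have P: "c + 3 \<le> real P" unfolding P_def using assms by (simp add: of_nat_ceiling)
  define b where "b = real (rcost (budget_exp P))"
  show ?thesis
  proof (intro exI[of _ "scale_program P"] allI)
    fix d :: real
    show "\<exists>C. \<forall>T (M :: 'w measure) slv n m A \<epsilon> K ri ci v.
    solver_time d T \<longrightarrow> rcdd_solver M slv \<longrightarrow>
    0 < n \<longrightarrow> A \<in> carrier_mat n n \<longrightarrow> (\<forall>i<n. \<forall>j<n. 0 \<le> A $$ (i, j)) \<longrightarrow> nnz A = m \<longrightarrow>
    spectral_radius (map_mat complex_of_real A) < 1 \<longrightarrow> 0 < \<epsilon> \<longrightarrow>
    max (induced_norm linf_norm (inverse_mat (1\<^sub>m n - A)))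
        (induced_norm l1_norm (inverse_mat (1\<^sub>m n - A))) \<le> K \<longrightarrow>
    sparse_rep n m ri ci v A \<longrightarrow>
    (let seeds = (\<Pi>\<^sub>M k\<in>(UNIV :: nat set). M);
         run = (\<lambda>\<omega> t s. exec T slv \<omega> (scale_program P) (init_state n m ri ci v \<epsilon> K) t s)
     in (\<forall>\<omega>\<in>space seeds. \<exists>t s. run \<omega> t s \<and>
           t \<le> C * (T m n (18 * K\<^sup>2) (1 / (216 * K ^ 3)) * log_factor (real n * K) *
                 log_factor ((induced_norm l1_norm A + induced_norm linf_norm A) / \<epsilon>))) \<and>
        measure seeds {\<omega> \<in> space seeds. \<exists>t s. run \<omega> t s \<and>
           scales_to_rcdd (output_L n s) (output_R n s) ((1 + \<epsilon>) \<cdot>\<^sub>m 1\<^sub>m n - A)}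
          \<ge> 1 - real n powr (- c))"
    \<comment> \<open>The constant of \<open>time_bound\<close>, with the factor of
      \<open>steps_le\<close> in place of its \<open>P\<close>. Apart from \<open>d\<close> it
      depends only on \<open>c\<close>, through \<open>P\<close> and \<open>b\<close>.\<close>
    proof (intro exI[of _ "5 * ((76 + 3 * real P) * (1100 + 4 * d) + 950 + b) + 1200"] allI impI)
      fix T :: "nat \<Rightarrow> nat \<Rightarrow> real \<Rightarrow> real \<Rightarrow> real" and M :: "'w measure" and slv :: "'w solver"
        and n m :: nat and A :: "real Matrix.mat" and \<epsilon> K :: real and ri ci :: "nat \<Rightarrow> nat" and v :: "nat \<Rightarrow> real"
      assume T: "solver_time d T" and slv: "rcdd_solver M slv" and n: "0 < n" and A: "A \<in> carrier_mat n n"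
        and nn: "\<forall>i<n. \<forall>j<n. 0 \<le> A $$ (i, j)" and m: "nnz A = m"
        and sr: "spectral_radius (map_mat complex_of_real A) < 1" and \<epsilon>: "0 < \<epsilon>"
        and K: "max (induced_norm linf_norm (inverse_mat (1\<^sub>m n - A))) (induced_norm l1_norm (inverse_mat (1\<^sub>m n - A))) \<le> K"
        and sp: "sparse_rep n m ri ci v A"
      define a where "a i j = A $$ (i, j)" for i j
      obtain rs ls where "mmatrix n a K rs ls"
        using mmatrix_weights[OF A n _ sr] nn K unfolding a_def[abs_def] by auto
      then interpret scaling n a K rs ls M slv using n slv by (simp add: scaling_def scaling_axioms_def)
      \<comment> \<open>The oracle time suffices for reading the input, so it can serve as the unit
        of linear work too.\<close>
      define B where "B = T m n (18 * K\<^sup>2) \<delta>"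
      have \<delta>: "0 < \<delta>" "\<delta> < 1"
      proof -
        show "0 < \<delta>" by (rule delta_pos)
        have "1 \<le> K ^ 3" using K1 by simp
        then have "1 < 216 * K ^ 3" by linarith
        then show "\<delta> < 1" unfolding accuracy_def by (subst divide_less_eq_1_pos) linarith+
      qed
      have K2: "1 \<le> 18 * K\<^sup>2" using one_le_power[OF K1, of 2] by linarith
      note T' = T[unfolded solver_time_def]
      have T1: "T q n \<kappa> \<delta> \<le> T q' n \<kappa>' \<delta>" if "q \<le> q'" "1 \<le> \<kappa>" "\<kappa> \<le> \<kappa>'" for q q' \<kappa> \<kappa>'
        using T'[THEN conjunct1, rule_format, of q q' n \<kappa> \<kappa>' \<delta>] that n \<delta>
        by (simp only: simp_thms)
      have T2: "real (m + n) \<le> B" "T (m + n) n (18 * K\<^sup>2) \<delta> \<le> d * B"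
        using T'[THEN conjunct2, rule_format, of n "18 * K\<^sup>2" \<delta> m] n \<delta> K2
        unfolding B_def by (simp_all only: simp_thms)
      have B0: "0 < B" using T2(1) n by simp
      \<comment> \<open>Monotonicity in the number of nonzeros against the growth factor for an
        added diagonal: \<open>d\<close> cannot be negative.\<close>
      have "B \<le> d * B" using T1[of m "m + n" "18 * K\<^sup>2" "18 * K\<^sup>2"] K2 T2(2) unfolding B_def by simp
      then have d: "0 \<le> d" using B0 by (smt (verit) mult_nonpos_nonneg)
      interpret execution n a K rs ls M slv T m B "d * B"
      proof unfold_locales
        fix q \<kappa> assume "q \<le> m + n" "1 \<le> \<kappa>" "\<kappa> \<le> 18 * K\<^sup>2"
        then show "T q n \<kappa> (accuracy K) \<le> d * B" by (rule order_trans[OF T1 T2(2)])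
      next
        show "real (m + n) \<le> B" by (rule T2(1))
        show "0 \<le> d * B" using d B0 by simp
      qed
      have Aa: "A $$ (i, j) = a i j" for i j by (simp add: a_def)
      define k where "k = steps (24 * (real n * K) ^ P)"
      define \<alpha>\<^sub>0 where "\<alpha>\<^sub>0 = start_alpha n a"
      define N where "N = rounds \<epsilon> K \<alpha>\<^sub>0"
      let ?s0 = "init_state n m ri ci v \<epsilon> K"
      let ?l1 = "log_factor (real n * K)" and ?S = "induced_norm l1_norm A + induced_norm linf_norm A"
      let ?l2 = "log_factor (?S / \<epsilon>)"
      let ?t = "real N * (real k * (1100 * B + 4 * (d * B)) + (950 + b) * B) + 1200 * B"
      have run: "\<exists>t s. exec T slv \<omega> (scale_program P) ?s0 t s \<and> t \<le> ?t \<and>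
          (\<forall>i<n. rarr s 1 i = left_at \<alpha>\<^sub>0 k N \<omega> i) \<and> (\<forall>i<n. rarr s 2 i = right_at \<alpha>\<^sub>0 k N \<omega> i)" for \<omega>
        using runs_scale_program[OF A Aa sp \<epsilon> start_alpha_bounds(3,4), of \<omega> P]
        unfolding runs_def k_def \<alpha>\<^sub>0_def N_def b_def by blast
      have row: "(\<Sum>j<n. a i j) \<le> induced_norm linf_norm A" "(\<Sum>j<n. a j i) \<le> induced_norm l1_norm A" if "i < n" for i
        using row_sum_le_induced[OF A that] col_sum_le_induced[OF A that] nonneg that by (simp_all add: Aa)
      have S0: "0 \<le> induced_norm linf_norm A" "0 \<le> induced_norm l1_norm A"
        using row[OF n] nonneg n sum_nonneg[of "{..<n}" "\<lambda>j. a 0 j"] sum_nonneg[of "{..<n}" "\<lambda>j. a j 0"] by force+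
      have \<alpha>S: "\<alpha>\<^sub>0 \<le> 2 * ?S" unfolding \<alpha>\<^sub>0_def start_alpha_def
        using row S0 by (intro peak_le) (auto intro: add_increasing add_increasing2)
      have nK: "1 \<le> real n * K" using n K1 mult_mono[of 1 "real n" 1 K] by simp
      have time: "?t \<le> (5 * ((76 + 3 * real P) * (1100 + 4 * d) + 950 + b) + 1200) * (B * ?l1 * ?l2)"
        by (rule time_bound) (use rounds_le_log[OF \<epsilon> \<alpha>S, of K] steps_le[OF nK, of P] log_factor_ge_1 B0 d
            in \<open>auto simp: N_def k_def b_def\<close>)
      have out: "scales_to_rcdd (output_L n s) (output_R n s) X = scales_to_rcdd (mat_diag n (left_at \<alpha>\<^sub>0 k N \<omega>)) (mat_diag n (right_at \<alpha>\<^sub>0 k N \<omega>)) X"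
        if "\<forall>i<n. rarr s 1 i = left_at \<alpha>\<^sub>0 k N \<omega> i" "\<forall>i<n. rarr s 2 i = right_at \<alpha>\<^sub>0 k N \<omega> i" "X \<in> carrier_mat n n" for s \<omega> X
        unfolding output_L_def output_R_def using that by (intro scales_cong) auto
      have X: "(1 + \<epsilon>) \<cdot>\<^sub>m 1\<^sub>m n - A \<in> carrier_mat n n" by (rule minus_carrier_mat[OF A])
      \<comment> \<open>By determinism, the existential over executions is a statement about the
        random process, so the event in the claim is the set whose measure was bounded.\<close>
      have iff: "(\<exists>t s. exec T slv \<omega> (scale_program P) ?s0 t s \<and> scales_to_rcdd (output_L n s) (output_R n s) ((1 + \<epsilon>) \<cdot>\<^sub>m 1\<^sub>m n - A)) \<longleftrightarrow>
          scales_to_rcdd (mat_diag n (left_at \<alpha>\<^sub>0 k N \<omega>)) (mat_diag n (right_at \<alpha>\<^sub>0 k N \<omega>)) ((1 + \<epsilon>) \<cdot>\<^sub>m 1\<^sub>m n - A)" for \<omega>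
      proof -
        obtain t s where s: "exec T slv \<omega> (scale_program P) ?s0 t s"
          "\<forall>i<n. rarr s 1 i = left_at \<alpha>\<^sub>0 k N \<omega> i" "\<forall>i<n. rarr s 2 i = right_at \<alpha>\<^sub>0 k N \<omega> i"
          using run by blast
        have "s' = s" if "exec T slv \<omega> (scale_program P) ?s0 t' s'" for t' s'
          using exec_deterministic[OF s(1) that] by simp
        then show ?thesis using s(1) out[OF s(2,3) X] by blast
      qed
      show "let seeds = (\<Pi>\<^sub>M k\<in>(UNIV :: nat set). M);
         run = (\<lambda>\<omega> t s. exec T slv \<omega> (scale_program P) (init_state n m ri ci v \<epsilon> K) t s)
     in (\<forall>\<omega>\<in>space seeds. \<exists>t s. run \<omega> t s \<and>
           t \<le> (5 * ((76 + 3 * real P) * (1100 + 4 * d) + 950 + b) + 1200) * (T m n (18 * K\<^sup>2) (1 / (216 * K ^ 3)) * log_factor (real n * K) *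
                 log_factor ((induced_norm l1_norm A + induced_norm linf_norm A) / \<epsilon>))) \<and>
        measure seeds {\<omega> \<in> space seeds. \<exists>t s. run \<omega> t s \<and>
           scales_to_rcdd (output_L n s) (output_R n s) ((1 + \<epsilon>) \<cdot>\<^sub>m 1\<^sub>m n - A)}
          \<ge> 1 - real n powr (- c)"
        unfolding Let_def
      proof (intro conjI ballI)
        fix \<omega>
        have bound: "?t \<le> (5 * ((76 + 3 * real P) * (1100 + 4 * d) + 950 + b) + 1200) *
            (T m n (18 * K\<^sup>2) (1 / (216 * K ^ 3)) * ?l1 * ?l2)"
          using time unfolding B_def accuracy_def .
        obtain t s where "exec T slv \<omega> (scale_program P) ?s0 t s" "t \<le> ?t" using run[of \<omega>] by blast
        then show "\<exists>t s. exec T slv \<omega> (scale_program P) ?s0 t s \<and>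
            t \<le> (5 * ((76 + 3 * real P) * (1100 + 4 * d) + 950 + b) + 1200) *
              (T m n (18 * K\<^sup>2) (1 / (216 * K ^ 3)) * ?l1 * ?l2)"
          by (intro exI conjI) (assumption, rule order_trans[OF _ bound])
      next
        have "{\<omega> \<in> space seeds. \<exists>t s. exec T slv \<omega> (scale_program P) ?s0 t s \<and>
              scales_to_rcdd (output_L n s) (output_R n s) ((1 + \<epsilon>) \<cdot>\<^sub>m 1\<^sub>m n - A)} =
            {\<omega> \<in> space seeds. scales_to_rcdd (mat_diag n (left_at \<alpha>\<^sub>0 k N \<omega>)) (mat_diag n (right_at \<alpha>\<^sub>0 k N \<omega>)) ((1 + \<epsilon>) \<cdot>\<^sub>m 1\<^sub>m n - A)}"
          by (simp only: iff)
        then show "1 - real n powr (- c) \<le> measure seeds {\<omega> \<in> space seeds. \<exists>t s. exec T slv \<omega> (scale_program P) ?s0 t s \<and>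
              scales_to_rcdd (output_L n s) (output_R n s) ((1 + \<epsilon>) \<cdot>\<^sub>m 1\<^sub>m n - A)}"
          using scaling_probability[OF \<epsilon> A Aa P assms] unfolding k_def \<alpha>\<^sub>0_def N_def by (simp only:)
      qed
    qed
  qed
qed

end
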